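(* Let $\mathcal{G}=(X_1,X_2,E,\nu)$ be a bipartite graphing with maximum degree $d$. Then $\mathcal{G}$ is the local isomorphic image of a bipartite graphing that has a measurable proper edge coloring with $d$ colors.
   Context: A graphing is a simple undirected graph $\mathcal{G}=(X,E,\nu)$ whose vertex set $X$ is a standard Borel space with a Borel probability measure $\nu$, whose (symmetric) edge set $E\subseteq X\times X$ is Borel, whose degrees are uniformly bounded, and such that $\int_A\deg(x,B)\,d\nu(x)=\int_B\deg(x,A)\,d\nu(x)$ for all measurable $A,B\subseteq X$, where $\deg(x,S)$ is the number of edges from $x$ to $S$. It is bipartite, written $(X_1,X_2,E,\nu)$, if $X=X_1\sqcup X_2$ is a partition into measurable sets and every edge joins $X_1$ to $X_2$. $C_{\mathcal{G}}(x)$ denotes the connected component of $x$. A graphing $\mathcal{G}_1=(Y_1,E_1,\nu_1)$ is the local isomorphic image of a graphing $\mathcal{G}_2=(Y_2,E_2,\nu_2)$ if there is a measurable map $\varphi:Y_2\to Y_1$ with $\varphi_*\nu_2=\nu_1$ such that for $\nu_2$-almost every $x\in Y_2$ the restriction of $\varphi$ to $C_{\mathcal{G}_2}(x)$ is a rooted isomorphism from $(C_{\mathcal{G}_2}(x),x)$ to $(C_{\mathcal{G}_1}(\varphi(x)),\varphi(x))$. An edge coloring is proper if edges sharing a vertex have different colors. Measurability statements are up to null sets. *)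

theory Defs
  imports "HOL-Analysis.Analysis" "HOL-Probability.Probability"
begin

text \<open>Simple graphs are given by a vertex set together with a symmetric irreflexive relation.
  Throughout, \<open>Borel\<close> refers to \<^term>\<open>sets M\<close>, whereas \<open>measurable\<close> means measurable up to null
  sets, that is, with respect to \<^term>\<open>completion M\<close>.\<close>

definition standard_borel :: "'a measure \<Rightarrow> bool" where
  "standard_borel M \<longleftrightarrow>
     (\<exists>T. completely_metrizable_space T \<and> separable_space T \<and> topspace T = space M \<and>
          sets M = sigma_sets (space M) {U. openin T U})"

definition deg :: "('a \<times> 'a) set \<Rightarrow> 'a \<Rightarrow> 'a set \<Rightarrow> nat" where
  "deg E x S = card (E `` {x} \<inter> S)"

text \<open>The integrals below are well defined: as \<open>E\<close> is Borel with finite sections, the function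
  \<open>\<lambda>x. deg E x B\<close> is Borel for every Borel set \<open>B\<close> (Lusin--Novikov).\<close>

locale graphing = prob_space M for M :: "'a measure" +
  fixes E :: "('a \<times> 'a) set"
  assumes standard_borel: "standard_borel M"
    and edges_borel: "E \<in> sets (M \<Otimes>\<^sub>M M)"
    and sym_edges: "sym E"
    and irrefl_edges: "irrefl E"
    and bounded_degree: "\<exists>D. \<forall>x\<in>space M. finite (E `` {x}) \<and> deg E x (space M) \<le> D"
    and preserving: "\<And>A B. A \<in> sets M \<Longrightarrow> B \<in> sets M \<Longrightarrow>
      (\<integral>\<^sup>+x\<in>A. of_nat (deg E x B) \<partial>M) = (\<integral>\<^sup>+x\<in>B. of_nat (deg E x A) \<partial>M)"

locale bipartite_graphing = graphing M E
  for X\<^sub>1 X\<^sub>2 :: "'a set" and M :: "'a measure" and E :: "('a \<times> 'a) set" +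
  assumes parts_measurable: "X\<^sub>1 \<in> sets (completion M)" "X\<^sub>2 \<in> sets (completion M)"
    and parts_cover: "X\<^sub>1 \<union> X\<^sub>2 = space M"
    and parts_disjoint: "X\<^sub>1 \<inter> X\<^sub>2 = {}"
    and edges_between: "E \<subseteq> X\<^sub>1 \<times> X\<^sub>2 \<union> X\<^sub>2 \<times> X\<^sub>1"

text \<open>For a graphing the maximum is over a finite nonempty set of values.\<close>

definition max_degree :: "'a measure \<Rightarrow> ('a \<times> 'a) set \<Rightarrow> nat" where
  "max_degree M E = Max ((\<lambda>x. deg E x (space M)) ` space M)"

definition graph_component :: "('a \<times> 'a) set \<Rightarrow> 'a \<Rightarrow> 'a set" where
  "graph_component E x = E\<^sup>* `` {x}"

definition rooted_isomorphism ::
  "('b \<Rightarrow> 'a) \<Rightarrow> 'b set \<Rightarrow> ('b \<times> 'b) set \<Rightarrow> 'b \<Rightarrow> 'a set \<Rightarrow> ('a \<times> 'a) set \<Rightarrow> 'a \<Rightarrow> bool" where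
  "rooted_isomorphism f V F r V' F' r' \<longleftrightarrow>
     bij_betw f V V' \<and> (\<forall>u\<in>V. \<forall>v\<in>V. (u, v) \<in> F \<longleftrightarrow> (f u, f v) \<in> F') \<and> f r = r'"

text \<open>The graphing on \<open>(M\<^sub>1, E\<^sub>1)\<close> is an image of the one on \<open>(M\<^sub>2, E\<^sub>2)\<close>.\<close>

definition local_isomorphic_image ::
  "'a measure \<Rightarrow> ('a \<times> 'a) set \<Rightarrow> 'b measure \<Rightarrow> ('b \<times> 'b) set \<Rightarrow> bool" where
  "local_isomorphic_image M\<^sub>1 E\<^sub>1 M\<^sub>2 E\<^sub>2 \<longleftrightarrow>
     (\<exists>\<phi>. \<phi> \<in> completion M\<^sub>2 \<rightarrow>\<^sub>M M\<^sub>1 \<and> distr (completion M\<^sub>2) M\<^sub>1 \<phi> = M\<^sub>1 \<and>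
        (AE x in M\<^sub>2. rooted_isomorphism \<phi> (graph_component E\<^sub>2 x) E\<^sub>2 x
                        (graph_component E\<^sub>1 (\<phi> x)) E\<^sub>1 (\<phi> x)))"

text \<open>A coloring assigns a color to each unordered pair \<open>{x, y}\<close> with \<open>(x, y) \<in> E\<close>; its values on
  other sets are irrelevant.\<close>

definition proper_edge_coloring :: "('a \<times> 'a) set \<Rightarrow> nat \<Rightarrow> ('a set \<Rightarrow> nat) \<Rightarrow> bool" where
  "proper_edge_coloring E k c \<longleftrightarrow>
     (\<forall>(x, y)\<in>E. c {x, y} < k) \<and>
     (\<forall>x y z. (x, y) \<in> E \<longrightarrow> (x, z) \<in> E \<longrightarrow> y \<noteq> z \<longrightarrow> c {x, y} \<noteq> c {x, z})"

text \<open>A set of edges is null for the edge measure \<open>F \<mapsto> \<integral> card (F `` {x}) d\<nu>(x)\<close> iff almost every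
  vertex is incident with none of its edges. Hence a coloring is measurable up to null sets iff
  it agrees with a Borel function at all edges of almost every vertex.\<close>

definition measurable_edge_coloring ::
  "'a measure \<Rightarrow> ('a \<times> 'a) set \<Rightarrow> ('a set \<Rightarrow> nat) \<Rightarrow> bool" where
  "measurable_edge_coloring M E c \<longleftrightarrow>
     (\<exists>f \<in> M \<Otimes>\<^sub>M M \<rightarrow>\<^sub>M count_space UNIV. AE x in M. \<forall>y. (x, y) \<in> E \<longrightarrow> c {x, y} = f (x, y))"

end

theory Submission
  imports Defs
begin

text \<open>Up to an invariant null set, the edge set is a disjoint union of countably many measure
  preserving Borel partial matchings; their measurability uses that projections of product Borel
  sets are measurable up to null sets. Among measurable partial colorings with \<open>d\<close> colors, the measure
  of the uncolored edges has infimum zero: given edges whose left ends miss \<open>a\<close> and whose right ends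
  miss \<open>b\<close>, all \<open>(a, b)\<close>-Kempe chains from the right ends avoid the left ends, so they can be
  switched at once, finite or infinite, after which these edges receive color \<open>a\<close>; the gain is
  bounded from below. Recording at each vertex the coloring of its component as seen from there and
  passing to a limit of the joint distributions gives an invariant measure on vertices with proper
  colorings of their components, which carries the covering graphing.\<close>

section \<open>Souslin schemes and the measurable projection theorem\<close>

text \<open>A bipartite graphing of maximum degree d need not itself have a measurable proper edge
  coloring with d colors, already for d = 2; this forces the passage to a larger space. The
  approximate colorings need not converge as functions of the vertex, but the joint laws of a vertex
  and its code do converge along a suitable filter. Every requirement on a coloring (one value per
  edge, a color on every edge, different colors at a vertex) involves finitely many entries of the
  code, so its probability passes to the limit. All entries are at most d, and this compactness
  yields countable additivity of the limit. The limit need not be the law of a function of the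
  vertex, hence the second coordinate of the covering space. The gain is bounded below because the
  end of an uncolored edge sees at most d - 1 colors and so misses one of the d colors. Within a
  single matching, some pair of missing colors therefore accounts for at least 1 / (2 d^2) of the
  measure of the vertices on uncolored edges.\<close>

lemma compact_bounded_sequences: "compact {\<sigma>::nat \<Rightarrow> nat. \<forall>i. \<sigma> i \<le> b i}"
proof -
  have "compactin (product_topology (\<lambda>i::nat. euclidean) UNIV) (PiE UNIV (\<lambda>i. {..b i}))"
    by (subst compactin_PiE) (auto simp: finite_imp_compact)
  moreover have "PiE UNIV (\<lambda>i. {..b i}) = {\<sigma>. \<forall>i. \<sigma> i \<le> b i}"
    by (auto simp: PiE_def)
  ultimately show ?thesis by (simp add: euclidean_product_topology)
qed

lemma open_finitely_determined:
  fixes S :: "(nat \<Rightarrow> nat) set"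
  assumes "\<And>\<sigma> \<tau>. \<forall>i<m. \<sigma> i = \<tau> i \<Longrightarrow> \<sigma> \<in> S \<Longrightarrow> \<tau> \<in> S"
  shows "open S"
proof (subst open_subopen, intro ballI)
  fix \<sigma> assume "\<sigma> \<in> S"
  let ?U = "\<Inter>i\<in>{..<m}. (\<lambda>\<tau>::nat \<Rightarrow> nat. \<tau> i) -` {\<sigma> i}"
  have "open ?U"
    by (intro open_INT finite_lessThan ballI open_vimage continuous_on_product_coordinates) (rule Topological_Spaces.open_discrete)
  moreover have "\<sigma> \<in> ?U" "?U \<subseteq> S" using assms[of \<sigma>] \<open>\<sigma> \<in> S\<close> by auto
  ultimately show "\<exists>T. open T \<and> \<sigma> \<in> T \<and> T \<subseteq> S" by blast
qed

text \<open>Koenig's lemma by compactness: a condition that reads finitely many entries is closed,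
  and the sequences below \<open>b\<close> form a compact space.\<close>

lemma koenig_sequences:
  fixes Q :: "nat \<Rightarrow> (nat \<Rightarrow> nat) \<Rightarrow> bool"
  assumes dep: "\<And>k \<sigma> \<tau>. \<forall>i<m k. \<sigma> i = \<tau> i \<Longrightarrow> Q k \<sigma> \<Longrightarrow> Q k \<tau>"
    and ex: "\<And>n. \<exists>\<sigma>. (\<forall>i. \<sigma> i \<le> b i) \<and> (\<forall>k\<le>n. Q k \<sigma>)"
  shows "\<exists>\<sigma>. (\<forall>i. \<sigma> i \<le> b i) \<and> (\<forall>k. Q k \<sigma>)"
proof -
  have closed: "closed {\<sigma>. Q k \<sigma>}" for k
    unfolding closed_def
  proof (rule open_finitely_determined)
    show "\<tau> \<in> - {\<sigma>. Q k \<sigma>}" if "\<forall>i<m k. \<sigma> i = \<tau> i" "\<sigma> \<in> - {\<sigma>. Q k \<sigma>}" for \<sigma> \<tau>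
      using dep[of k \<tau> \<sigma>] that by auto
  qed
  have fip: "{\<sigma>. \<forall>i. \<sigma> i \<le> b i} \<inter> (\<Inter>k\<in>I. {\<sigma>. Q k \<sigma>}) \<noteq> {}" if "finite I" for I
  proof -
    obtain n where "\<forall>k\<in>I. k \<le> n" using \<open>finite I\<close> finite_nat_set_iff_bounded_le by auto
    then show ?thesis using ex[of n] by blast
  qed
  have "{\<sigma>. \<forall>i. \<sigma> i \<le> b i} \<inter> (\<Inter>k. {\<sigma>. Q k \<sigma>}) \<noteq> {}"
    by (rule compact_imp_fip_image[OF compact_bounded_sequences closed fip])
  then show ?thesis by auto
qed

text \<open>Padding lists by zero gives a countable family of sequences that realizes every finite
  prefix; zero respects all bounds of the form \<open>\<sigma> i \<le> b i\<close>.\<close>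

definition seq_of :: "nat list \<Rightarrow> nat \<Rightarrow> nat" where
  "seq_of l i = (if i < length l then l ! i else 0)"

lemma seq_of_map: "seq_of (map \<sigma> [0..<n]) i = (if i < n then \<sigma> i else 0)"
  by (simp add: seq_of_def)

text \<open>Outer measure is continuous along increasing sequences of arbitrary sets, so the entries
  of the branches can be bounded one after the other while the outer measure stays above
  \<open>r\<close>. Once all entries are bounded, compactness exchanges the union over branches with
  the intersection over levels, and a decreasing intersection of measurable sets remains.\<close>

lemma (in finite_measure) souslin_inner_approx:
  fixes A :: "nat \<Rightarrow> (nat \<Rightarrow> nat) \<Rightarrow> 'a set"
  assumes A: "\<And>n \<sigma>. A n \<sigma> \<in> sets M"
    and dep: "\<And>n \<sigma> \<tau>. \<forall>i<n. \<sigma> i = \<tau> i \<Longrightarrow> A n \<sigma> = A n \<tau>"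
    and r: "r < outer_measure_of M {x. \<exists>\<sigma>. \<forall>n. x \<in> A n \<sigma>}"
  shows "\<exists>T\<in>sets M. T \<subseteq> {x. \<exists>\<sigma>. \<forall>n. x \<in> A n \<sigma>} \<and> r \<le> emeasure M T"
proof -
  \<comment> \<open>Only the first \<open>n\<close> entries are bounded, but all levels are kept.
    Such a set is not known to be measurable, hence the outer measure.\<close>
  define P where "P b n = {x. \<exists>\<sigma>. (\<forall>i<n. \<sigma> i \<le> b i) \<and> (\<forall>k. x \<in> A k \<sigma>)}" for b and n :: nat
  have Psp: "P b n \<subseteq> space M" for b n
  proof
    fix x assume "x \<in> P b n"
    then obtain \<sigma> where "x \<in> A 0 \<sigma>" unfolding P_def by blast
    then show "x \<in> space M" using sets.sets_into_space[OF A] by blast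
  qed
  have P_cong: "P b n = P b' n" if "\<forall>i<n. b i = b' i" for b b' n
    using that by (simp add: P_def)
  have step: "\<exists>c. r < outer_measure_of M (P (b(n := c)) (Suc n))"
    if "r < outer_measure_of M (P b n)" for b n
  proof -
    have P_Suc: "P (b(n := c)) (Suc n) = {x. \<exists>\<sigma>. ((\<forall>i<n. \<sigma> i \<le> b i) \<and> \<sigma> n \<le> c) \<and> (\<forall>k. x \<in> A k \<sigma>)}" for c
    proof -
      have "(\<forall>i<Suc n. \<sigma> i \<le> (b(n := c)) i) \<longleftrightarrow> (\<forall>i<n. \<sigma> i \<le> b i) \<and> \<sigma> n \<le> c" for \<sigma> :: "nat \<Rightarrow> nat"
        by (auto simp: All_less_Suc)
      then show ?thesis unfolding P_def by simp
    qed
    have inc: "incseq (\<lambda>c. P (b(n := c)) (Suc n))"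
      unfolding incseq_def P_Suc by (intro allI impI Collect_mono) (metis order_trans)
    have Un: "(\<Union>c. P (b(n := c)) (Suc n)) = P b n"
    proof (intro set_eqI iffI)
      fix x assume "x \<in> P b n"
      then obtain \<sigma> where "\<forall>i<n. \<sigma> i \<le> b i" "\<forall>k. x \<in> A k \<sigma>" unfolding P_def by auto
      then have "x \<in> P (b(n := \<sigma> n)) (Suc n)" unfolding P_Suc by auto
      then show "x \<in> (\<Union>c. P (b(n := c)) (Suc n))" by (rule UN_I[OF UNIV_I])
    next
      fix x assume "x \<in> (\<Union>c. P (b(n := c)) (Suc n))"
      then obtain c where "x \<in> P (b(n := c)) (Suc n)" by auto
      then show "x \<in> P b n" unfolding P_Suc unfolding P_def by auto
    qed
    have "(SUP c. outer_measure_of M (P (b(n := c)) (Suc n))) = outer_measure_of M (P b n)"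
      using SUP_outer_measure_of_incseq[OF Psp inc] unfolding Un .
    with that have "r < (SUP c. outer_measure_of M (P (b(n := c)) (Suc n)))" by simp
    then show ?thesis unfolding less_SUP_iff by blast
  qed
  have "\<exists>f. \<forall>n. r < outer_measure_of M (P (f n) n) \<and> (\<forall>i. i \<noteq> n \<longrightarrow> f (Suc n) i = f n i)"
  proof (rule dependent_nat_choice)
    show "\<exists>b. r < outer_measure_of M (P b 0)" using r by (simp add: P_def)
    show "\<exists>b'. r < outer_measure_of M (P b' (Suc n)) \<and> (\<forall>i. i \<noteq> n \<longrightarrow> b' i = b i)"
      if "r < outer_measure_of M (P b n)" for b n
    proof -
      from step[OF that] obtain c where "r < outer_measure_of M (P (b(n := c)) (Suc n))" ..
      then show ?thesis by (intro exI[of _ "b(n := c)"]) auto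
    qed
  qed
  then obtain f where f: "\<And>n. r < outer_measure_of M (P (f n) n)"
    and f_eq: "\<And>n i. i \<noteq> n \<Longrightarrow> f (Suc n) i = f n i" by auto
  define b where "b n = f (Suc n) n" for n
  \<comment> \<open>Entry \<open>n\<close> is set in passing from stage \<open>n\<close> to the next
    and never changes afterwards, so the stages have a diagonal limit \<open>b\<close>.\<close>
  have "f (Suc n + k) n = b n" for n k
    by (induction k) (auto simp: b_def f_eq)
  then have "\<forall>i<n. f n i = b i" for n
    by (metis less_iff_Suc_add add_Suc)
  then have Pb: "r < outer_measure_of M (P b n)" for n
    using f[of n] P_cong[of n "f n" b] by simp
  \<comment> \<open>Dropping the levels above \<open>n\<close> makes the condition depend on
    finitely many entries, so that countably many padded lists suffice as witnesses and the set is
    measurable.\<close>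
  define T where "T n = {x\<in>space M. \<exists>\<sigma>. (\<forall>i. \<sigma> i \<le> b i) \<and> (\<forall>k\<le>n. x \<in> A k \<sigma>)}" for n
  have T_alt: "T n = {x\<in>space M. \<exists>l. (\<forall>i. seq_of l i \<le> b i) \<and> (\<forall>k\<le>n. x \<in> A k (seq_of l))}" for n
  proof -
    have "\<exists>l. (\<forall>i. seq_of l i \<le> b i) \<and> (\<forall>k\<le>n. x \<in> A k (seq_of l))"
      if "\<forall>i. \<sigma> i \<le> b i" "\<forall>k\<le>n. x \<in> A k \<sigma>" for x \<sigma>
    proof (intro exI[of _ "map \<sigma> [0..<n]"] conjI allI impI)
      fix k assume "k \<le> n"
      then have "A k (seq_of (map \<sigma> [0..<n])) = A k \<sigma>" by (intro dep) (auto simp: seq_of_map)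
      then show "x \<in> A k (seq_of (map \<sigma> [0..<n]))" using that \<open>k \<le> n\<close> by auto
    qed (use that in \<open>auto simp: seq_of_map\<close>)
    then show ?thesis unfolding T_def by blast
  qed
  have T_sets: "T n \<in> sets M" for n
  proof -
    have "T n = (\<Union>l\<in>{l. \<forall>i. seq_of l i \<le> b i}. space M \<inter> (\<Inter>k\<in>{..n}. A k (seq_of l)))"
      unfolding T_alt by blast
    also have "\<dots> \<in> sets M"
    proof (intro sets.countable_UN'[OF countableI_type] image_subsetI)
      show "space M \<inter> (\<Inter>k\<in>{..n}. A k (seq_of l)) \<in> sets M" for l
        by (rule sets.Int[OF sets.top sets.finite_INT]) (use A in auto)
    qed
    finally show ?thesis .
  qed
  have "P b n \<subseteq> T n" for n
  proof
    fix x assume "x \<in> P b n"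
    then obtain \<sigma> where \<sigma>: "\<forall>i<n. \<sigma> i \<le> b i" "\<forall>k. x \<in> A k \<sigma>" by (auto simp: P_def)
    have "A k (\<lambda>i. if i < n then \<sigma> i else 0) = A k \<sigma>" if "k \<le> n" for k
      using that by (intro dep) auto
    with \<sigma> show "x \<in> T n" using subsetD[OF Psp \<open>x \<in> P b n\<close>] unfolding T_def
      by (auto intro!: exI[of _ "\<lambda>i. if i < n then \<sigma> i else 0"])
  qed
  then have rT: "r \<le> emeasure M (T n)" for n
    using Pb[of n] outer_measure_of_mono[of "P b n" "T n" M] T_sets[of n] by simp
  have "decseq T" unfolding decseq_def T_def by (intro allI impI Collect_mono) (metis order_trans)
  then have "(\<lambda>n. emeasure M (T n)) \<longlonglongrightarrow> emeasure M (\<Inter>n. T n)"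
    using T_sets by (intro Lim_emeasure_decseq) auto
  then have "r \<le> emeasure M (\<Inter>n. T n)"
    using rT by (intro LIMSEQ_le_const) auto
  moreover have "(\<Inter>n. T n) \<subseteq> {x. \<exists>\<sigma>. \<forall>n. x \<in> A n \<sigma>}"
  proof
    fix x assume x: "x \<in> (\<Inter>n. T n)"
    have "\<exists>\<sigma>. (\<forall>i. \<sigma> i \<le> b i) \<and> (\<forall>k. x \<in> A k \<sigma>)"
    proof (rule koenig_sequences[where m = "\<lambda>k. k"])
      show "x \<in> A k \<tau>" if "\<forall>i<k. \<sigma> i = \<tau> i" "x \<in> A k \<sigma>" for k \<sigma> \<tau>
        using dep[OF that(1)] that(2) by simp
      show "\<exists>\<sigma>. (\<forall>i. \<sigma> i \<le> b i) \<and> (\<forall>k\<le>n. x \<in> A k \<sigma>)" for n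
        using x by (auto simp: T_def)
    qed
    then show "x \<in> {x. \<exists>\<sigma>. \<forall>n. x \<in> A n \<sigma>}" by blast
  qed
  moreover have "(\<Inter>n. T n) \<in> sets M" using T_sets by blast
  ultimately show ?thesis by blast
qed

text \<open>A measurable hull \<open>E\<close> of the Souslin set is exhausted from inside up to
  \<open>1 / (k + 1)\<close> for every \<open>k\<close>, so the set and its hull differ by a null
  set.\<close>

lemma (in finite_measure) souslin_measurable:
  fixes A :: "nat \<Rightarrow> (nat \<Rightarrow> nat) \<Rightarrow> 'a set"
  assumes A: "\<And>n \<sigma>. A n \<sigma> \<in> sets M"
    and dep: "\<And>n \<sigma> \<tau>. \<forall>i<n. \<sigma> i = \<tau> i \<Longrightarrow> A n \<sigma> = A n \<tau>"
  shows "{x. \<exists>\<sigma>. \<forall>n. x \<in> A n \<sigma>} \<in> sets (completion M)"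
proof -
  let ?P = "{x. \<exists>\<sigma>. \<forall>n. x \<in> A n \<sigma>}"
  have "?P \<subseteq> space M"
  proof
    fix x assume "x \<in> ?P"
    then obtain \<sigma> where "x \<in> A 0 \<sigma>" by blast
    then show "x \<in> space M" using sets.sets_into_space[OF A] by blast
  qed
  from outer_measure_of_attain[OF this]
  obtain E where E: "E \<in> sets M" "?P \<subseteq> E" "outer_measure_of M ?P = emeasure M E" by auto
  have "\<exists>T\<in>sets M. T \<subseteq> ?P \<and> measure M (E - T) \<le> inverse (real (Suc k))" for k
  proof (cases "measure M E > 0")
    case False
    then have "measure M E = 0" by (simp add: zero_less_measure_iff)
    then show ?thesis by (intro bexI[of _ "{}"]) auto
  next
    case True
    then have "ennreal (measure M E - inverse (real (Suc k))) < outer_measure_of M ?P"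
      unfolding E(3) emeasure_eq_measure by (intro ennreal_lessI) auto
    from souslin_inner_approx[OF assms this] obtain T where
      T: "T \<in> sets M" "T \<subseteq> ?P" "ennreal (measure M E - inverse (real (Suc k))) \<le> emeasure M T"
      by blast
    have "measure M (E - T) = measure M E - measure M T"
      using T E by (intro finite_measure_Diff) auto
    moreover have "measure M E - inverse (real (Suc k)) \<le> measure M T"
      using T(3) unfolding emeasure_eq_measure ennreal_le_iff[OF measure_nonneg] .
    ultimately show ?thesis using T(1,2) by (intro bexI[of _ T]) auto
  qed
  then have "\<forall>k. \<exists>T. T \<in> sets M \<and> T \<subseteq> ?P \<and> measure M (E - T) \<le> inverse (real (Suc k))"
    unfolding Bex_def by (intro allI)
  from choice[OF this] obtain T where T: "\<And>k. T k \<in> sets M" "\<And>k. T k \<subseteq> ?P"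
    and ET: "\<And>k. measure M (E - T k) \<le> inverse (real (Suc k))" by auto
  let ?T = "\<Union>k. T k"
  have T_sets: "?T \<in> sets M" using T(1) by auto
  have "measure M (E - ?T) \<le> inverse (real (Suc k))" for k
  proof -
    have "measure M (E - ?T) \<le> measure M (E - T k)"
      using T(1) E(1) T_sets by (intro finite_measure_mono) auto
    with ET[of k] show ?thesis by simp
  qed
  then have "measure M (E - ?T) \<le> 0"
    using LIMSEQ_le_const[OF LIMSEQ_inverse_real_of_nat] by blast
  then have "measure M (E - ?T) = 0" using measure_nonneg[of M "E - ?T"] by linarith
  then have null: "E - ?T \<in> null_sets M"
    using T_sets E(1) by (intro null_setsI sets.Diff) (simp_all add: emeasure_eq_measure)
  have "?T \<subseteq> ?P" using T(2) by (intro UN_least)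
  then have "?P = ?T \<union> (?P - ?T)" by (simp add: Un_absorb1)
  moreover have "?P - ?T \<subseteq> E - ?T" using E(2) by (rule Diff_mono) simp
  ultimately show ?thesis using null T_sets by (rule sets_completionI)
qed

text \<open>The Souslin operation on rectangles. Schemes are indexed by infinite sequences of which
  level \<open>n\<close> reads the first \<open>n\<close> entries, in place of finite words. The
  second sides are closed so that completeness can produce a common point when they are projected
  away.\<close>

definition souslin_rect :: "'a measure \<Rightarrow> 'b topology \<Rightarrow> ('a \<times> 'b) set \<Rightarrow> bool" where
  "souslin_rect M T S \<longleftrightarrow>
     (\<exists>A C. (\<forall>n \<sigma>. A n \<sigma> \<in> sets M) \<and> (\<forall>n \<sigma>. closedin T (C n \<sigma>)) \<and>
        (\<forall>(n::nat) \<sigma> \<tau>. (\<forall>i<n. \<sigma> i = \<tau> i) \<longrightarrow> A n \<sigma> = A n \<tau> \<and> C n \<sigma> = C n \<tau>) \<and>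
        S = {(x, y). \<exists>\<sigma>::nat \<Rightarrow> nat. \<forall>n. x \<in> A n \<sigma> \<and> y \<in> C n \<sigma>})"

lemma souslin_rectI:
  assumes "\<And>n \<sigma>. A n \<sigma> \<in> sets M" "\<And>n \<sigma>. closedin T (C n \<sigma>)"
    "\<And>(n::nat) \<sigma> \<tau>. \<forall>i<n. \<sigma> i = \<tau> i \<Longrightarrow> A n \<sigma> = A n \<tau> \<and> C n \<sigma> = C n \<tau>"
    "\<And>x y. (x, y) \<in> S \<longleftrightarrow> (\<exists>\<sigma>::nat \<Rightarrow> nat. \<forall>n. x \<in> A n \<sigma> \<and> y \<in> C n \<sigma>)"
  shows "souslin_rect M T S"
  unfolding souslin_rect_def
  by (intro exI[of _ A] exI[of _ C] conjI allI impI assms(1,2) assms(3)[THEN conjunct1] assms(3)[THEN conjunct2])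
    (use assms(4) in auto)

lemma souslin_rectE:
  assumes "souslin_rect M T S"
  obtains A C where "\<And>n \<sigma>. A n \<sigma> \<in> sets M" "\<And>n \<sigma>. closedin T (C n \<sigma>)"
    "\<And>(n::nat) \<sigma> \<tau>. \<forall>i<n. \<sigma> i = \<tau> i \<Longrightarrow> A n \<sigma> = A n \<tau> \<and> C n \<sigma> = C n \<tau>"
    "\<And>x y. (x, y) \<in> S \<longleftrightarrow> (\<exists>\<sigma>::nat \<Rightarrow> nat. \<forall>n. x \<in> A n \<sigma> \<and> y \<in> C n \<sigma>)"
proof -
  from assms obtain A C where *: "(\<forall>n \<sigma>. A n \<sigma> \<in> sets M) \<and> (\<forall>n \<sigma>. closedin T (C n \<sigma>)) \<and>
        (\<forall>(n::nat) \<sigma> \<tau>. (\<forall>i<n. \<sigma> i = \<tau> i) \<longrightarrow> A n \<sigma> = A n \<tau> \<and> C n \<sigma> = C n \<tau>) \<and>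
        S = {(x, y). \<exists>\<sigma>::nat \<Rightarrow> nat. \<forall>n. x \<in> A n \<sigma> \<and> y \<in> C n \<sigma>}"
    unfolding souslin_rect_def by (elim exE)
  show thesis
  proof (rule that[of A C])
    show "A n \<sigma> = A n \<tau> \<and> C n \<sigma> = C n \<tau>" if "\<forall>i<n. \<sigma> i = \<tau> i" for n \<sigma> \<tau>
      using * that by blast
  qed (use * in auto)
qed

lemma souslin_rect_subset:
  assumes "souslin_rect M T S"
  shows "S \<subseteq> space M \<times> topspace T"
proof
  obtain A C where A: "\<And>n \<sigma>. A n \<sigma> \<in> sets M" and C: "\<And>n \<sigma>. closedin T (C n \<sigma>)"
    and "\<And>(n::nat) \<sigma> \<tau>. \<forall>i<n. \<sigma> i = \<tau> i \<Longrightarrow> A n \<sigma> = A n \<tau> \<and> C n \<sigma> = C n \<tau>"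
    and S: "\<And>x y. (x, y) \<in> S \<longleftrightarrow> (\<exists>\<sigma>::nat \<Rightarrow> nat. \<forall>n. x \<in> A n \<sigma> \<and> y \<in> C n \<sigma>)"
    using assms by (rule souslin_rectE) (rule that)
  fix p assume "p \<in> S"
  then obtain \<sigma> where "fst p \<in> A 0 \<sigma>" "snd p \<in> C 0 \<sigma>" using S[of "fst p" "snd p"] by auto
  then show "p \<in> space M \<times> topspace T"
    using sets.sets_into_space[OF A, of 0 \<sigma>] closedin_subset[OF C, of 0 \<sigma>] by (auto simp: mem_Times_iff)
qed

lemma souslin_rect_times: "A \<in> sets M \<Longrightarrow> closedin T C \<Longrightarrow> souslin_rect M T (A \<times> C)"
  by (rule souslin_rectI[where A = "\<lambda>_ _. A" and C = "\<lambda>_ _. C"]) auto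

lemma souslin_rect_familyE:
  fixes M :: "'a measure" and T :: "'b topology"
  assumes "\<And>i::nat. souslin_rect M T (S i)"
  obtains A :: "nat \<Rightarrow> nat \<Rightarrow> (nat \<Rightarrow> nat) \<Rightarrow> 'a set" and C :: "nat \<Rightarrow> nat \<Rightarrow> (nat \<Rightarrow> nat) \<Rightarrow> 'b set" where "\<And>i n \<sigma>. A i n \<sigma> \<in> sets M" "\<And>i n \<sigma>. closedin T (C i n \<sigma>)"
    "\<And>i n \<sigma> \<tau>. \<forall>k<n. \<sigma> k = \<tau> k \<Longrightarrow> A i n \<sigma> = A i n \<tau> \<and> C i n \<sigma> = C i n \<tau>"
    "\<And>i x y. (x, y) \<in> S i \<longleftrightarrow> (\<exists>\<sigma>. \<forall>n. x \<in> A i n \<sigma> \<and> y \<in> C i n \<sigma>)"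
proof -
  have "\<forall>i. \<exists>AC. (\<forall>n \<sigma>. fst AC n \<sigma> \<in> sets M) \<and> (\<forall>n \<sigma>. closedin T (snd AC n \<sigma>)) \<and>
        (\<forall>(n::nat) \<sigma> \<tau>. (\<forall>i<n. \<sigma> i = \<tau> i) \<longrightarrow> fst AC n \<sigma> = fst AC n \<tau> \<and> snd AC n \<sigma> = snd AC n \<tau>) \<and>
        S i = {(x, y). \<exists>\<sigma>::nat \<Rightarrow> nat. \<forall>n. x \<in> fst AC n \<sigma> \<and> y \<in> snd AC n \<sigma>}"
    using assms unfolding souslin_rect_def by (simp only: split_paired_Ex fst_conv snd_conv simp_thms) 
  from choice[OF this] obtain AC where *: "\<forall>i. (\<forall>n \<sigma>. fst (AC i) n \<sigma> \<in> sets M) \<and> (\<forall>n \<sigma>. closedin T (snd (AC i) n \<sigma>)) \<and>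
        (\<forall>(n::nat) \<sigma> \<tau>. (\<forall>i<n. \<sigma> i = \<tau> i) \<longrightarrow> fst (AC i) n \<sigma> = fst (AC i) n \<tau> \<and> snd (AC i) n \<sigma> = snd (AC i) n \<tau>) \<and>
        S i = {(x, y). \<exists>\<sigma>::nat \<Rightarrow> nat. \<forall>n. x \<in> fst (AC i) n \<sigma> \<and> y \<in> snd (AC i) n \<sigma>}" ..
  define A where "A i = fst (AC i)" for i
  define C where "C i = snd (AC i)" for i
  have A: "A i n \<sigma> \<in> sets M" and C: "closedin T (C i n \<sigma>)" for i n \<sigma>
    using * by (auto simp: A_def C_def)
  have dep: "A i n \<sigma> = A i n \<tau> \<and> C i n \<sigma> = C i n \<tau>" if "\<forall>i<n. \<sigma> i = \<tau> i" for i n \<sigma> \<tau>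
    using * that unfolding A_def C_def by blast
  have S: "(x, y) \<in> S i \<longleftrightarrow> (\<exists>\<sigma>. \<forall>n. x \<in> A i n \<sigma> \<and> y \<in> C i n \<sigma>)" for i x y
    using * unfolding A_def C_def by auto
  show thesis by (rule that[OF A C dep S])
qed

text \<open>Entry \<open>0\<close> of the new branch selects the member of the union and the
  remaining entries form a branch for it. Level \<open>0\<close> has to be the whole space since it
  may not read any entry.\<close>

lemma souslin_rect_UN:
  fixes M :: "'a measure" and T :: "'b topology"
  assumes "\<And>i::nat. souslin_rect M T (S i)"
  shows "souslin_rect M T (\<Union>i. S i)"
proof -
  obtain A :: "nat \<Rightarrow> nat \<Rightarrow> (nat \<Rightarrow> nat) \<Rightarrow> 'a set"
    and C :: "nat \<Rightarrow> nat \<Rightarrow> (nat \<Rightarrow> nat) \<Rightarrow> 'b set"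
    where A: "\<And>i n \<sigma>. A i n \<sigma> \<in> sets M" and C: "\<And>i n \<sigma>. closedin T (C i n \<sigma>)"
    and dep: "\<And>i n \<sigma> \<tau>. \<forall>k<n. \<sigma> k = \<tau> k \<Longrightarrow> A i n \<sigma> = A i n \<tau> \<and> C i n \<sigma> = C i n \<tau>"
    and S: "\<And>i x y. (x, y) \<in> S i \<longleftrightarrow> (\<exists>\<sigma>. \<forall>n. x \<in> A i n \<sigma> \<and> y \<in> C i n \<sigma>)"
    using assms by (rule souslin_rect_familyE) (rule that)
  define A' where "A' n \<sigma> = (case n of 0 \<Rightarrow> space M | Suc n \<Rightarrow> A (\<sigma> 0) n (\<lambda>k. \<sigma> (Suc k)))" for n \<sigma>
  define C' where "C' n \<sigma> = (case n of 0 \<Rightarrow> topspace T | Suc n \<Rightarrow> C (\<sigma> 0) n (\<lambda>k. \<sigma> (Suc k)))" for n \<sigma>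
  show ?thesis
  proof (rule souslin_rectI[where A = A' and C = C'])
    fix n and \<sigma> \<tau> :: "nat \<Rightarrow> nat" assume eq: "\<forall>i<n. \<sigma> i = \<tau> i"
    show "A' n \<sigma> = A' n \<tau> \<and> C' n \<sigma> = C' n \<tau>"
    proof (cases n)
      case (Suc m)
      then have "\<sigma> 0 = \<tau> 0" "\<forall>i<m. \<sigma> (Suc i) = \<tau> (Suc i)" using eq by auto
      then show ?thesis
        using Suc dep[of m "\<lambda>k. \<sigma> (Suc k)" "\<lambda>k. \<tau> (Suc k)" "\<tau> 0"] by (simp add: A'_def C'_def)
    qed (simp add: A'_def C'_def)
  next
    fix x y
    show "(x, y) \<in> (\<Union>i. S i) \<longleftrightarrow> (\<exists>\<sigma>. \<forall>n. x \<in> A' n \<sigma> \<and> y \<in> C' n \<sigma>)"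
    proof
      assume "(x, y) \<in> (\<Union>i. S i)"
      then obtain i \<sigma> where \<sigma>: "\<forall>n. x \<in> A i n \<sigma> \<and> y \<in> C i n \<sigma>" using S by auto
      have "x \<in> space M" "y \<in> topspace T"
        using \<sigma> sets.sets_into_space[OF A] closedin_subset[OF C] by blast+
      with \<sigma> show "\<exists>\<sigma>. \<forall>n. x \<in> A' n \<sigma> \<and> y \<in> C' n \<sigma>"
        by (intro exI[of _ "\<lambda>k. case k of 0 \<Rightarrow> i | Suc k \<Rightarrow> \<sigma> k"]) (auto simp: A'_def C'_def split: nat.splits)
    next
      assume "\<exists>\<sigma>. \<forall>n. x \<in> A' n \<sigma> \<and> y \<in> C' n \<sigma>"
      then obtain \<sigma> where \<sigma>: "\<forall>n. x \<in> A' n \<sigma> \<and> y \<in> C' n \<sigma>" ..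
      have "x \<in> A (\<sigma> 0) n (\<lambda>k. \<sigma> (Suc k)) \<and> y \<in> C (\<sigma> 0) n (\<lambda>k. \<sigma> (Suc k))" for n
        using spec[OF \<sigma>, of "Suc n"] by (simp add: A'_def C'_def)
      then have "(x, y) \<in> S (\<sigma> 0)" using S by blast
      then show "(x, y) \<in> (\<Union>i. S i)" by blast
    qed
  qed (auto simp: A'_def C'_def split: nat.splits intro: A C)
qed

lemma all_prod_encode: "(\<forall>n. P n) \<longleftrightarrow> (\<forall>i j. P (prod_encode (i, j)))"
  by (metis prod_decode_inverse surj_pair)

text \<open>Level \<open>prod_encode (i, j)\<close> of an interleaved scheme reads the entries
  \<open>prod_encode (i, k)\<close> with \<open>k < j\<close>; by this inequality they lie in the
  allowed prefix.\<close>

lemma prod_encode_strict_mono2: "k < j \<Longrightarrow> prod_encode (i, k) < prod_encode (i, j)"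
proof (induction j)
  case (Suc j)
  have "prod_encode (i, j) < prod_encode (i, Suc j)" by (simp add: prod_encode_def)
  then show ?case using Suc by (cases "k = j") auto
qed simp

text \<open>One branch encodes countably many: its entry \<open>prod_encode (i, k)\<close> is entry
  \<open>k\<close> of the branch for member \<open>i\<close>, and level
  \<open>prod_encode (i, j)\<close> tests level \<open>j\<close> of that member.\<close>

lemma souslin_rect_INT:
  fixes M :: "'a measure" and T :: "'b topology"
  assumes "\<And>i::nat. souslin_rect M T (S i)"
  shows "souslin_rect M T (\<Inter>i. S i)"
proof -
  obtain A :: "nat \<Rightarrow> nat \<Rightarrow> (nat \<Rightarrow> nat) \<Rightarrow> 'a set"
    and C :: "nat \<Rightarrow> nat \<Rightarrow> (nat \<Rightarrow> nat) \<Rightarrow> 'b set"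
    where A: "\<And>i n \<sigma>. A i n \<sigma> \<in> sets M" and C: "\<And>i n \<sigma>. closedin T (C i n \<sigma>)"
    and dep: "\<And>i n \<sigma> \<tau>. \<forall>k<n. \<sigma> k = \<tau> k \<Longrightarrow> A i n \<sigma> = A i n \<tau> \<and> C i n \<sigma> = C i n \<tau>"
    and S: "\<And>i x y. (x, y) \<in> S i \<longleftrightarrow> (\<exists>\<sigma>. \<forall>n. x \<in> A i n \<sigma> \<and> y \<in> C i n \<sigma>)"
    using assms by (rule souslin_rect_familyE) (rule that)
  define A' where "A' n \<sigma> = A (fst (prod_decode n)) (snd (prod_decode n)) (\<lambda>k. \<sigma> (prod_encode (fst (prod_decode n), k)))" for n \<sigma>
  define C' where "C' n \<sigma> = C (fst (prod_decode n)) (snd (prod_decode n)) (\<lambda>k. \<sigma> (prod_encode (fst (prod_decode n), k)))" for n \<sigma>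
  show ?thesis
  proof (rule souslin_rectI[where A = A' and C = C'])
    fix n and \<sigma> \<tau> :: "nat \<Rightarrow> nat" assume eq: "\<forall>i<n. \<sigma> i = \<tau> i"
    obtain i j where n: "n = prod_encode (i, j)" by (metis prod_decode_inverse surj_pair)
    have "\<forall>k<j. \<sigma> (prod_encode (i, k)) = \<tau> (prod_encode (i, k))"
      using eq n prod_encode_strict_mono2 by blast
    then show "A' n \<sigma> = A' n \<tau> \<and> C' n \<sigma> = C' n \<tau>"
      unfolding A'_def C'_def n prod_encode_inverse fst_conv snd_conv by (rule dep)
  next
    fix x y
    have "(\<forall>n. x \<in> A' n \<sigma> \<and> y \<in> C' n \<sigma>) \<longleftrightarrow>
      (\<forall>i j. x \<in> A i j (\<lambda>k. \<sigma> (prod_encode (i, k))) \<and> y \<in> C i j (\<lambda>k. \<sigma> (prod_encode (i, k))))" for \<sigma>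
      by (subst all_prod_encode) (simp add: A'_def C'_def)
    then have "(\<exists>\<sigma>. \<forall>n. x \<in> A' n \<sigma> \<and> y \<in> C' n \<sigma>) \<longleftrightarrow>
      (\<exists>\<sigma>. \<forall>i j. x \<in> A i j (\<lambda>k. \<sigma> (prod_encode (i, k))) \<and> y \<in> C i j (\<lambda>k. \<sigma> (prod_encode (i, k))))"
      by simp
    also have "\<dots> \<longleftrightarrow> (\<forall>i. \<exists>\<sigma>. \<forall>j. x \<in> A i j \<sigma> \<and> y \<in> C i j \<sigma>)"
    proof
      assume "\<forall>i. \<exists>\<sigma>. \<forall>j. x \<in> A i j \<sigma> \<and> y \<in> C i j \<sigma>"
      from choice[OF this] obtain f where "\<forall>i j. x \<in> A i j (f i) \<and> y \<in> C i j (f i)" ..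
      then show "\<exists>\<sigma>. \<forall>i j. x \<in> A i j (\<lambda>k. \<sigma> (prod_encode (i, k))) \<and> y \<in> C i j (\<lambda>k. \<sigma> (prod_encode (i, k)))"
        by (intro exI[of _ "\<lambda>n. f (fst (prod_decode n)) (snd (prod_decode n))"]) simp
    qed blast
    finally show "(x, y) \<in> (\<Inter>i. S i) \<longleftrightarrow> (\<exists>\<sigma>. \<forall>n. x \<in> A' n \<sigma> \<and> y \<in> C' n \<sigma>)"
      using S by simp
  qed (auto simp: A'_def C'_def intro: A C)
qed

lemma souslin_rect_Un:
  assumes "souslin_rect M T S" "souslin_rect M T S'"
  shows "souslin_rect M T (S \<union> S')"
proof -
  have "souslin_rect M T (\<Union>i::nat. if i = 0 then S else S')"
    by (rule souslin_rect_UN) (use assms in auto)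
  moreover have "(\<Union>i::nat. if i = 0 then S else S') = S \<union> S'" by auto
  ultimately show ?thesis by simp
qed

lemma souslin_rect_Int:
  assumes "souslin_rect M T S" "souslin_rect M T S'"
  shows "souslin_rect M T (S \<inter> S')"
proof -
  have "souslin_rect M T (\<Inter>i::nat. if i = 0 then S else S')"
    by (rule souslin_rect_INT) (use assms in auto)
  moreover have "(\<Inter>i::nat. if i = 0 then S else S') = S \<inter> S'" by (auto split: if_splits)
  ultimately show ?thesis by simp
qed

text \<open>The complement is carried through the induction because Souslin sets are not closed
  under complements. The base case uses that open sets in a metrizable space are countable unions of
  closed sets.\<close>

lemma souslin_rect_space_times:
  assumes T: "metrizable_space T"
    and b: "b \<in> sigma_sets (topspace T) {U. openin T U}"
  shows "souslin_rect M T (space M \<times> b) \<and> souslin_rect M T (space M \<times> (topspace T - b))"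
  using b
proof induction
  case (Basic U)
  then have U: "openin T U" by simp
  then obtain C where C: "\<And>n::nat. closedin T (C n)" "\<Union> (range C) = U"
    using open_imp_fsigma_in[OF T] unfolding fsigma_in_ascending by metis
  have "souslin_rect M T (\<Union>n. space M \<times> C n)"
    by (intro souslin_rect_UN souslin_rect_times C sets.top)
  moreover have "(\<Union>n. space M \<times> C n) = space M \<times> U" using C by blast
  ultimately show ?case using souslin_rect_times[OF sets.top openin_closedin_eq[THEN iffD1, OF U, THEN conjunct2]]
    by simp
next
  case Empty
  then show ?case by (intro conjI souslin_rect_times) auto
next
  case (Compl b)
  have "b \<subseteq> topspace T"
    using openin_subset by (intro sigma_sets_into_sp[OF _ Compl.hyps]) blast
  then have "topspace T - (topspace T - b) = b" by blast
  with Compl.IH show ?case by simp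
next
  case (Union b)
  have "space M \<times> (topspace T - (\<Union>i. b i)) = (\<Inter>i. space M \<times> (topspace T - b i))"
    by auto
  moreover have "space M \<times> (\<Union>i. b i) = (\<Union>i. space M \<times> b i)" by auto
  ultimately show ?case using Union.IH
    by (simp add: souslin_rect_UN souslin_rect_INT)
qed

lemma souslin_rect_pair_sets:
  assumes T: "metrizable_space T" and N: "space N = topspace T" "sets N = sigma_sets (space N) {U. openin T U}"
    and S: "S \<in> sets (M \<Otimes>\<^sub>M N)"
  shows "souslin_rect M T S"
proof -
  \<comment> \<open>As before, the complement is included to make the induction over the sigma
    algebra go through.\<close>
  have "souslin_rect M T S \<and> souslin_rect M T (space M \<times> topspace T - S)"
    using S unfolding sets_pair_measure N(1)
  proof induction
    case (Basic S)
    then obtain a b where S: "S = a \<times> b" and a: "a \<in> sets M" and b: "b \<in> sets N" by auto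
    have b': "souslin_rect M T (space M \<times> b)" "souslin_rect M T (space M \<times> (topspace T - b))"
      using souslin_rect_space_times[OF T, of b M] b N by auto
    have "S = (a \<times> topspace T) \<inter> (space M \<times> b)"
      using sets.sets_into_space[OF a] sets.sets_into_space[OF b] S N by auto
    moreover have "space M \<times> topspace T - S = ((space M - a) \<times> topspace T) \<union> (space M \<times> (topspace T - b))"
      using sets.sets_into_space[OF a] sets.sets_into_space[OF b] S N by auto
    ultimately show ?case
      using b' a by (auto intro!: souslin_rect_Int souslin_rect_Un souslin_rect_times)
  next
    case Empty
    have "souslin_rect M T ({} \<times> topspace T)" "souslin_rect M T (space M \<times> topspace T)"
      by (intro souslin_rect_times; simp)+
    then show ?case by simp
  next
    case (Compl S)
    then show ?case using souslin_rect_subset by (metis double_diff order_refl)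
  next
    case (Union S)
    have "souslin_rect M T (\<Inter>i. space M \<times> topspace T - S i)"
      by (rule souslin_rect_INT) (use Union.IH in blast)
    moreover have "souslin_rect M T (\<Union>i. S i)"
      by (rule souslin_rect_UN) (use Union.IH in blast)
    moreover have "(\<Inter>i. space M \<times> topspace T - S i) = space M \<times> topspace T - (\<Union>i. S i)" by auto
    ultimately show ?case by simp
  qed
  then show ?thesis ..
qed

section \<open>Projection along a Polish factor\<close>

lemma separable_dense_sequence:
  assumes "Metric_space Y d" and "separable_space (Metric_space.mtopology Y d)" "Y \<noteq> {}"
  obtains q :: "nat \<Rightarrow> 'b" where "range q \<subseteq> Y" "\<And>y e. y \<in> Y \<Longrightarrow> e > 0 \<Longrightarrow> \<exists>k. d (q k) y < e"
proof -
  interpret Y: Metric_space Y d by fact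
  obtain Q where Q: "countable Q" "Q \<subseteq> Y" "Y.mtopology closure_of Q = Y"
    using assms(2) unfolding separable_space_def by auto
  then have "Q \<noteq> {}" using assms(3) by auto
  with Q(1) have rq: "range (from_nat_into Q) = Q" by (rule range_from_nat_into[rotated])
  show thesis
  proof (rule that[of "from_nat_into Q"])
    fix y and e :: real assume "y \<in> Y" "e > 0"
    then have "\<exists>z\<in>Q. z \<in> Y.mball y e" using Q(3) unfolding Y.metric_closure_of by blast
    then obtain z where "z \<in> Q" "d y z < e" by auto
    then show "\<exists>k. d (from_nat_into Q k) y < e"
      using rq Y.commute by (metis imageE)
  qed (use rq Q in auto)
qed

text \<open>The existence of a second coordinate has to be tested level by level. Even entries of a
  new branch follow the old branch, odd entries choose closed balls of radius
  \<open>1 / (j + 1)\<close> around points of a dense sequence. If all second sides along a branch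
  are nonempty, they are nested closed sets inside arbitrarily small balls, and completeness
  provides a common point.\<close>

lemma (in finite_measure) souslin_rect_projection:
  assumes T: "completely_metrizable_space T" "separable_space T" and S: "souslin_rect M T S"
  shows "fst ` S \<in> sets (completion M)"
proof (cases "S = {}")
  case False
  obtain Y d where d: "Metric_space Y d" "Metric_space.mcomplete Y d" "T = Metric_space.mtopology Y d"
    using T(1) unfolding completely_metrizable_space_def by auto
  interpret Y: Metric_space Y d by fact
  have topT: "topspace T = Y" using d(3) by simp
  with False souslin_rect_subset[OF S] have "Y \<noteq> {}" by auto
  then obtain q :: "nat \<Rightarrow> 'b" where q: "range q \<subseteq> Y" "\<And>y e. y \<in> Y \<Longrightarrow> e > 0 \<Longrightarrow> \<exists>k. d (q k) y < e"
    using separable_dense_sequence[OF d(1)] T(2) d(3) by metis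
  obtain A C where A: "\<And>n \<sigma>. A n \<sigma> \<in> sets M" and C: "\<And>n \<sigma>. closedin T (C n \<sigma>)"
    and dep: "\<And>(n::nat) \<sigma> \<tau>. \<forall>i<n. \<sigma> i = \<tau> i \<Longrightarrow> A n \<sigma> = A n \<tau> \<and> C n \<sigma> = C n \<tau>"
    and SAC: "\<And>x y. (x, y) \<in> S \<longleftrightarrow> (\<exists>\<sigma>::nat \<Rightarrow> nat. \<forall>n. x \<in> A n \<sigma> \<and> y \<in> C n \<sigma>)"
    using S by (rule souslin_rectE) (rule that)
  define ev where "ev \<sigma> = (\<lambda>k. \<sigma> (2 * k))" for \<sigma> :: "nat \<Rightarrow> nat"
  define ball where "ball \<sigma> j = Y.mcball (q (\<sigma> (2 * j + 1))) (inverse (real (Suc j)))" for \<sigma> :: "nat \<Rightarrow> nat" and j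
  \<comment> \<open>All earlier levels are intersected to make the sets decrease. The index
    \<open>k div 2\<close> and the bound \<open>2 * j + 1 < n\<close> ensure that only the first
    \<open>n\<close> entries are read.\<close>
  define D where "D n \<sigma> = (\<Inter>k\<in>{..n}. C (k div 2) (ev \<sigma>)) \<inter> (\<Inter>j\<in>{j. 2 * j + 1 < n}. ball \<sigma> j)"
    for n and \<sigma> :: "nat \<Rightarrow> nat"
  have D_dec: "D n \<sigma> \<subseteq> D m \<sigma>" if "m \<le> n" for m n \<sigma>
    using that unfolding D_def by fastforce
  have D_closed: "closedin T (D n \<sigma>)" for n \<sigma>
  proof -
    have "closedin T (\<Inter>k\<in>{..n}. C (k div 2) (ev \<sigma>))" using C by blast
    moreover have "closedin T (ball \<sigma> j)" for j unfolding ball_def d(3) by auto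
    ultimately show ?thesis unfolding D_def
      by (cases "{j. 2 * j + 1 < n} = {}") (auto intro!: closedin_Int closedin_INT simp del: Collect_empty_eq)
  qed
  have D_dep: "D n \<sigma> = D n \<tau>" and A_dep: "A (n div 2) (ev \<sigma>) = A (n div 2) (ev \<tau>)"
    if "\<forall>i<n. \<sigma> i = \<tau> i" for n \<sigma> \<tau>
  proof -
    have "\<forall>i<k div 2. ev \<sigma> i = ev \<tau> i" if "k \<le> n" for k
      using \<open>\<forall>i<n. \<sigma> i = \<tau> i\<close> that by (auto simp: ev_def)
    then have eq: "A (k div 2) (ev \<sigma>) = A (k div 2) (ev \<tau>) \<and> C (k div 2) (ev \<sigma>) = C (k div 2) (ev \<tau>)"
      if "k \<le> n" for k using dep that by blast
    have "ball \<sigma> j = ball \<tau> j" if "2 * j + 1 < n" for j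
      using \<open>\<forall>i<n. \<sigma> i = \<tau> i\<close> that unfolding ball_def by simp
    with eq show "D n \<sigma> = D n \<tau>"
      unfolding D_def by (intro arg_cong2[where f = "(\<inter>)"] INF_cong) simp_all
    show "A (n div 2) (ev \<sigma>) = A (n div 2) (ev \<tau>)" using eq by simp
  qed
  \<comment> \<open>Whether \<open>D n \<sigma>\<close> is empty depends on the first
    \<open>n\<close> entries only, so the test can be absorbed into the first side, and what remains
    is a scheme on the first factor alone.\<close>
  define A' where "A' n \<sigma> = (if D n \<sigma> = {} then {} else A (n div 2) (ev \<sigma>))" for n \<sigma>
  have "fst ` S = {x. \<exists>\<sigma>. \<forall>n. x \<in> A' n \<sigma>}"
  proof (intro set_eqI iffI)
    fix x assume "x \<in> fst ` S"
    then obtain y \<sigma> where \<sigma>: "\<forall>n. x \<in> A n \<sigma> \<and> y \<in> C n \<sigma>" using SAC by (metis imageE prod.collapse)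
    have "y \<in> Y" using \<sigma> closedin_subset[OF C] topT by blast
    then have "\<forall>j. \<exists>k. d (q k) y < inverse (real (Suc j))" using q(2) by simp
    from choice[OF this] obtain \<tau> where \<tau>: "\<And>j. d (q (\<tau> j)) y < inverse (real (Suc j))" by auto
    define \<rho> where "\<rho> n = (if even n then \<sigma> (n div 2) else \<tau> (n div 2))" for n
    have ev: "ev \<rho> = \<sigma>" by (auto simp: ev_def \<rho>_def)
    have "y \<in> ball \<rho> j" for j
      using \<tau>[of j] \<open>y \<in> Y\<close> q(1) by (auto simp: ball_def \<rho>_def Y.in_mcball)
    then have "y \<in> D n \<rho>" for n using \<sigma> unfolding D_def ev by auto
    then have "D n \<rho> \<noteq> {}" for n by blast
    then have "\<forall>n. x \<in> A' n \<rho>" using \<sigma> ev by (simp add: A'_def)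
    then show "x \<in> {x. \<exists>\<sigma>. \<forall>n. x \<in> A' n \<sigma>}" by blast
  next
    fix x assume "x \<in> {x. \<exists>\<sigma>. \<forall>n. x \<in> A' n \<sigma>}"
    then obtain \<sigma> where \<sigma>: "\<forall>n. x \<in> A' n \<sigma>" by blast
    then have ne: "D n \<sigma> \<noteq> {}" and xA: "x \<in> A (n div 2) (ev \<sigma>)" for n unfolding A'_def by (metis empty_iff)+
    have small: "\<exists>n a. D n \<sigma> \<subseteq> Y.mcball a e" if "e > 0" for e
    proof -
      obtain j where j: "inverse (real (Suc j)) < e" using reals_Archimedean[OF \<open>e > 0\<close>] by auto
      have "D (2 * j + 2) \<sigma> \<subseteq> ball \<sigma> j" unfolding D_def by auto
      also have "\<dots> \<subseteq> Y.mcball (q (\<sigma> (2 * j + 1))) e"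
        unfolding ball_def using j by (intro Y.mcball_subset_concentric) simp
      finally show ?thesis by blast
    qed
    have "(\<Inter>n. D n \<sigma>) \<noteq> {}"
      using d(2)[unfolded Y.mcomplete_nest, rule_format, of "\<lambda>n. D n \<sigma>"] D_closed ne small D_dec
      unfolding d(3) decseq_def by blast
    then obtain y where y: "\<And>n. y \<in> D n \<sigma>" by auto
    have "y \<in> C ((2 * k) div 2) (ev \<sigma>)" for k
      using y[of "2 * k"] unfolding D_def by blast
    then have "x \<in> A k (ev \<sigma>) \<and> y \<in> C k (ev \<sigma>)" for k
      using xA[of "2 * k"] by simp
    then have "(x, y) \<in> S" using SAC by blast
    then show "x \<in> fst ` S" by force
  qed
  moreover have "\<dots> \<in> sets (completion M)"
  proof (rule souslin_measurable)
    show "A' n \<sigma> \<in> sets M" for n \<sigma> using A by (simp add: A'_def)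
    show "A' n \<sigma> = A' n \<tau>"
      if "\<forall>i<n. \<sigma> i = \<tau> i" for n \<sigma> \<tau>
      using D_dep[OF that] A_dep[OF that] by (simp add: A'_def)
  qed
  ultimately show ?thesis by simp
qed simp

section \<open>Decomposition of a bipartite graphing into matchings\<close>

lemma countable_open_base:
  assumes "metrizable_space T" "separable_space T"
  shows "\<exists>U :: nat \<Rightarrow> 'a set. (\<forall>n. openin T (U n)) \<and>
    (\<forall>V x. openin T V \<longrightarrow> x \<in> V \<longrightarrow> (\<exists>n. x \<in> U n \<and> U n \<subseteq> V))"
proof (cases "topspace T = {}")
  case True
  then show ?thesis
    using openin_subset by (intro exI[of _ "\<lambda>_. {}"]) fastforce
next
  case False
  obtain Y d where d: "Metric_space Y d" "T = Metric_space.mtopology Y d"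
    using assms(1) unfolding metrizable_space_def by auto
  interpret Y: Metric_space Y d by fact
  have "Y \<noteq> {}" using False d(2) by simp
  then obtain q :: "nat \<Rightarrow> 'a" where q: "range q \<subseteq> Y" "\<And>y e. y \<in> Y \<Longrightarrow> e > 0 \<Longrightarrow> \<exists>k. d (q k) y < e"
    using separable_dense_sequence[OF d(1)] assms(2) d(2) by metis
  define U where "U n = Y.mball (q (fst (prod_decode n))) (inverse (real (Suc (snd (prod_decode n)))))" for n
  show ?thesis
  proof (intro exI[of _ U] conjI allI impI)
    show "openin T (U n)" for n unfolding U_def d(2) by simp
    fix V x assume V: "openin T V" "x \<in> V"
    then obtain r where r: "r > 0" "Y.mball x r \<subseteq> V" and x: "x \<in> Y"
      unfolding d(2) Y.openin_mtopology by blast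
    obtain j where j: "inverse (real (Suc j)) < r / 2" using reals_Archimedean[of "r / 2"] r by auto
    obtain k where k: "d (q k) x < inverse (real (Suc j))" using q(2)[OF x, of "inverse (real (Suc j))"] by auto
    have qk: "q k \<in> Y" using q(1) by auto
    have "U (prod_encode (k, j)) \<subseteq> Y.mball x r"
    proof
      fix z assume "z \<in> U (prod_encode (k, j))"
      then have z: "z \<in> Y" "d (q k) z < inverse (real (Suc j))" by (auto simp: U_def)
      have "d x z \<le> d x (q k) + d (q k) z" using x z qk by (intro Y.triangle) auto
      also have "\<dots> < r" using k z j by (simp add: Y.commute)
      finally show "z \<in> Y.mball x r" using x z by simp
    qed
    then show "\<exists>n. x \<in> U n \<and> U n \<subseteq> V"
      using k x qk r(2) by (intro exI[of _ "prod_encode (k, j)"]) (auto simp: U_def)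
  qed
qed

lemma sigma_sets_countable_base:
  assumes U: "\<And>n::nat. openin T (U n)"
    and base: "\<And>V x. openin T V \<Longrightarrow> x \<in> V \<Longrightarrow> \<exists>n. x \<in> U n \<and> U n \<subseteq> V"
  shows "sigma_sets (topspace T) {V. openin T V} = sigma_sets (topspace T) (range U)"
proof (rule sigma_sets_eqI)
  fix V assume "V \<in> {V. openin T V}"
  then have "V = (\<Union>n\<in>{n. U n \<subseteq> V}. U n)" using base by blast
  also have "\<dots> \<in> sigma_sets (topspace T) (range U)"
  proof (cases "{n. U n \<subseteq> V} = {}")
    case False
    then have "(\<Union>n\<in>{n. U n \<subseteq> V}. U n) = (\<Union>i. U (from_nat_into {n. U n \<subseteq> V} i))"
      by (intro UN_from_nat_into) auto
    then show ?thesis by (simp add: sigma_sets.Union sigma_sets.Basic)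
  qed (auto intro: sigma_sets.Empty)
  finally show "V \<in> sigma_sets (topspace T) (range U)" .
qed (use U in auto)

text \<open>Separation from a finite set, and not just from one point, allows one neighbor of a
  vertex to be isolated from all its other neighbors.\<close>

definition separating_base :: "'a measure \<Rightarrow> (nat \<Rightarrow> 'a set) \<Rightarrow> bool" where
  "separating_base M U \<longleftrightarrow> sets M = sigma_sets (space M) (range U) \<and> range U \<subseteq> sets M \<and>
     (\<forall>x\<in>space M. \<forall>Z. finite Z \<longrightarrow> x \<notin> Z \<longrightarrow> (\<exists>n. x \<in> U n \<and> U n \<inter> Z = {}))"

lemma separating_base_exists:
  assumes "standard_borel M"
  obtains U where "separating_base M U"
proof -
  obtain T where T: "completely_metrizable_space T" "separable_space T" "topspace T = space M"
    "sets M = sigma_sets (space M) {U. openin T U}"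
    using assms unfolding standard_borel_def by auto
  have met: "metrizable_space T" using T(1) by (rule completely_metrizable_imp_metrizable_space)
  from countable_open_base[OF met T(2)]
  obtain U :: "nat \<Rightarrow> 'a set" where U': "\<forall>n. openin T (U n)"
    "\<forall>V x. openin T V \<longrightarrow> x \<in> V \<longrightarrow> (\<exists>n. x \<in> U n \<and> U n \<subseteq> V)"
    by (elim exE conjE) (rule that)
  note U = U'[rule_format]
  have "\<exists>n. x \<in> U n \<and> U n \<inter> Z = {}" if "x \<in> space M" "finite Z" "x \<notin> Z" for x Z
  proof -
    have "closedin T (topspace T \<inter> Z)"
      using metrizable_imp_t1_space[OF met] that(2) by (simp add: t1_space_closedin_finite)
    then have "openin T (topspace T - (topspace T \<inter> Z))" by blast
    moreover have "x \<in> topspace T - (topspace T \<inter> Z)" using that T(3) by auto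
    ultimately obtain n where "x \<in> U n" "U n \<subseteq> topspace T - (topspace T \<inter> Z)"
      using U(2) by blast
    then show ?thesis by blast
  qed
  moreover have "sets M = sigma_sets (space M) (range U)"
    using sigma_sets_countable_base[OF U] T by simp
  moreover have "range U \<subseteq> sets M" using U(1) T(4) by auto
  ultimately have "separating_base M U" unfolding separating_base_def by simp
  then show thesis by (rule that)
qed

lemma completion_borel_approx:
  assumes "A \<in> sets (completion M)"
  obtains A' N where "A' \<in> sets M" "N \<in> null_sets M" "A' \<subseteq> A" "A \<subseteq> A' \<union> N"
  using sets_completionE[OF assms] by (metis Un_mono Un_upper1 order_refl)

section \<open>Neighborhoods of measurable sets and measure preserving matchings\<close>

context bipartite_graphing begin

lemma edge_in_space: "(x, y) \<in> E \<Longrightarrow> x \<in> space M \<and> y \<in> space M"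
  using sets.sets_into_space[OF edges_borel] by (auto simp: space_pair_measure)

lemma edge_sym: "(x, y) \<in> E \<Longrightarrow> (y, x) \<in> E"
  using sym_edges by (rule symD)

lemma finite_nbrs: "finite (E `` {x})"
proof (cases "x \<in> space M")
  case False
  then have "E `` {x} = {}" using edge_in_space by blast
  then show ?thesis by simp
qed (use bounded_degree in blast)

text \<open>By symmetry of \<open>E\<close>, the neighborhood of \<open>B\<close> is the projection
  of the product Borel set of edges ending in \<open>B\<close>; the projection theorem makes it
  measurable up to a null set.\<close>

lemma nbrs_of_Borel: 
  assumes "B \<in> sets M" shows "E `` B \<in> sets (completion M)"
proof -
  obtain T where T: "completely_metrizable_space T" "separable_space T" "topspace T = space M"
    "sets M = sigma_sets (space M) {U. openin T U}"
    using standard_borel unfolding standard_borel_def by auto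
  have "E \<inter> (space M \<times> B) \<in> sets (M \<Otimes>\<^sub>M M)" using edges_borel assms by auto
  then have "souslin_rect M T (E \<inter> (space M \<times> B))"
    using T by (intro souslin_rect_pair_sets[of T M]) (auto intro: completely_metrizable_imp_metrizable_space)
  then have "fst ` (E \<inter> (space M \<times> B)) \<in> sets (completion M)"
    by (rule souslin_rect_projection[OF T(1,2)])
  moreover have "fst ` (E \<inter> (space M \<times> B)) = E `` B"
    using edge_sym edge_in_space by force
  ultimately show ?thesis by simp
qed

text \<open>Mass transport: the measure of the neighborhood is at most the integral of the degree
  into \<open>B\<close>, which equals the integral of the full degree over the null set
  \<open>B\<close>.\<close>

lemma nbrs_of_null_Borel:
  assumes "B \<in> null_sets M" shows "E `` B \<in> null_sets (completion M)"
proof -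
  have B: "B \<in> sets M" using assms by auto
  have "emeasure (completion M) (E `` B) = (\<integral>\<^sup>+x. indicator (E `` B) x \<partial>completion M)"
    using nbrs_of_Borel[OF B] by simp
  also have "\<dots> = (\<integral>\<^sup>+x. indicator (E `` B) x \<partial>M)" by (rule nn_integral_completion)
  also have "\<dots> \<le> (\<integral>\<^sup>+x\<in>space M. of_nat (deg E x B) \<partial>M)"
  proof (rule nn_integral_mono)
    fix x assume "x \<in> space M"
    have "1 \<le> deg E x B" if "x \<in> E `` B"
    proof -
      have "E `` {x} \<inter> B \<noteq> {}" using that edge_sym by blast
      then show ?thesis using finite_nbrs[of x] by (simp add: deg_def Suc_le_eq card_gt_0_iff)
    qed
    then have "(of_nat 1::ennreal) \<le> of_nat (deg E x B)" if "x \<in> E `` B"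
      using that by (intro of_nat_mono) auto
    then show "indicator (E `` B) x \<le> (of_nat (deg E x B) * indicator (space M) x :: ennreal)"
      using \<open>x \<in> space M\<close> unfolding of_nat_1 by (cases "x \<in> E `` B") simp_all
  qed
  also have "\<dots> = (\<integral>\<^sup>+x\<in>B. of_nat (deg E x (space M)) \<partial>M)"
    using B by (intro preserving) auto
  also have "\<dots> = 0" using assms by (rule nn_integral_null_set)
  finally show ?thesis using nbrs_of_Borel[OF B] by (intro null_setsI) auto
qed

lemma nbrs_of_null:
  assumes "B \<in> null_sets (completion M)" shows "E `` B \<in> null_sets (completion M)"
proof -
  obtain N where "N \<in> null_sets M" "B \<subseteq> N" using assms unfolding null_sets_completion_iff2 by auto
  then have "E `` B \<subseteq> E `` N" "E `` N \<in> null_sets (completion M)" using nbrs_of_null_Borel by auto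
  then show ?thesis by (rule null_sets_completion_subset)
qed

lemma nbrs_measurable:
  assumes "B \<in> sets (completion M)" shows "E `` B \<in> sets (completion M)"
proof -
  obtain B' N where B: "B' \<in> sets M" "N \<in> null_sets M" "B' \<subseteq> B" "B \<subseteq> B' \<union> N"
    by (rule completion_borel_approx[OF assms]) (rule that)
  have "B - B' \<in> null_sets (completion M)"
    unfolding null_sets_completion_iff2 by (rule bexI[OF _ B(2)]) (use B(4) in blast)
  then have "E `` (B - B') \<in> sets (completion M)" using nbrs_of_null by auto
  moreover have "E `` B = E `` B' \<union> E `` (B - B')" using B(3) by blast
  ultimately show ?thesis using nbrs_of_Borel[OF B(1)] by auto
qed

text \<open>Replacing a set by a Borel subset of the same measure changes degrees only at neighbors
  of a null set, and these form a null set again.\<close>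

lemma preserving_completion:
  assumes A: "A \<in> sets (completion M)" and B: "B \<in> sets (completion M)"
  shows "(\<integral>\<^sup>+x\<in>A. of_nat (deg E x B) \<partial>M) = (\<integral>\<^sup>+x\<in>B. of_nat (deg E x A) \<partial>M)"
proof -
  obtain A' NA where A': "A' \<in> sets M" "NA \<in> null_sets M" "A' \<subseteq> A" "A \<subseteq> A' \<union> NA"
    by (rule completion_borel_approx[OF A]) (rule that)
  obtain B' NB where B': "B' \<in> sets M" "NB \<in> null_sets M" "B' \<subseteq> B" "B \<subseteq> B' \<union> NB"
    by (rule completion_borel_approx[OF B]) (rule that)
  have eq: "(\<integral>\<^sup>+x\<in>A. of_nat (deg E x B) \<partial>M) = (\<integral>\<^sup>+x\<in>A'. of_nat (deg E x B') \<partial>M)"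
    if "N \<in> null_sets M" "A' \<subseteq> A" "A \<subseteq> A' \<union> N" "N' \<in> null_sets M" "B' \<subseteq> B" "B \<subseteq> B' \<union> N'"
    for A A' B B' N N'
  proof (rule nn_integral_cong_AE)
    have "AE x in M. x \<notin> N" using that(1) by (rule AE_not_in)
    moreover have "AE x in M. x \<notin> E `` N'"
      using AE_not_in[OF nbrs_of_null_Borel[OF that(4)]] by (simp add: AE_completion_iff)
    ultimately show "AE x in M. of_nat (deg E x B) * indicator A x = (of_nat (deg E x B') * indicator A' x :: ennreal)"
    proof eventually_elim
      case (elim x)
      have "E `` {x} \<inter> B = E `` {x} \<inter> B'" using elim(2) that(5,6) edge_sym by blast
      moreover have "x \<in> A \<longleftrightarrow> x \<in> A'" using elim(1) that(2,3) by blast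
      ultimately show ?case by (simp add: deg_def indicator_def)
    qed
  qed
  show ?thesis
    unfolding eq[OF A'(2-4) B'(2-4)] eq[OF B'(2-4) A'(2-4)] by (rule preserving[OF A'(1) B'(1)])
qed

text \<open>Two distinct neighbors in \<open>Q\<close> are split by some \<open>U n\<close>, so
  uniqueness is a countable condition on neighborhoods of measurable sets.\<close>

lemma unique_nbr_measurable:
  assumes U: "separating_base M U" and Q: "Q \<in> sets (completion M)"
  shows "{x. \<exists>!y. y \<in> Q \<and> (x, y) \<in> E} \<in> sets (completion M)"
proof -
  have "{x. \<exists>!y. y \<in> Q \<and> (x, y) \<in> E} = E `` Q - (\<Union>n. E `` (Q \<inter> U n) \<inter> E `` (Q - U n))"
  proof (intro set_eqI iffI)
    fix x assume "x \<in> {x. \<exists>!y. y \<in> Q \<and> (x, y) \<in> E}"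
    then show "x \<in> E `` Q - (\<Union>n. E `` (Q \<inter> U n) \<inter> E `` (Q - U n))" using edge_sym by blast
  next
    fix x assume x: "x \<in> E `` Q - (\<Union>n. E `` (Q \<inter> U n) \<inter> E `` (Q - U n))"
    then obtain y where y: "y \<in> Q" "(x, y) \<in> E" using edge_sym by blast
    have "z = y" if z: "z \<in> Q" "(x, z) \<in> E" for z
    proof (rule ccontr)
      assume "z \<noteq> y"
      then obtain n where "y \<in> U n" "U n \<inter> {z} = {}"
        using U edge_in_space[OF y(2)] unfolding separating_base_def by (metis finite.emptyI finite_insert singletonD)
      then show False using x y z edge_sym by blast
    qed
    with y show "x \<in> {x. \<exists>!y. y \<in> Q \<and> (x, y) \<in> E}" by blast
  qed
  moreover have "U n \<in> sets (completion M)" for n using U unfolding separating_base_def by blast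
  ultimately show ?thesis using Q by (auto intro!: sets.Diff sets.countable_UN nbrs_measurable)
qed

text \<open>A matching is a partial involution of the vertices, and the last clause says that it
  preserves measure. The completion is used since neighborhoods are known to be measurable only up
  to null sets.\<close>

definition pmp_matching :: "('a \<times> 'a) set \<Rightarrow> bool" where
  "pmp_matching \<mu> \<longleftrightarrow> \<mu> \<subseteq> E \<and> sym \<mu> \<and> single_valued \<mu> \<and>
     (\<forall>C\<in>sets (completion M). \<mu> `` C \<in> sets (completion M) \<and>
        emeasure (completion M) (\<mu> `` C) = emeasure (completion M) (C \<inter> Domain \<mu>))"

text \<open>Discarding every edge between \<open>P\<close> and \<open>Q\<close> that meets another
  such edge leaves a matching that is obtained without any choice, hence measurably.\<close>

definition exclusive_edges :: "'a set \<Rightarrow> 'a set \<Rightarrow> ('a \<times> 'a) set" where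
  "exclusive_edges P Q = {(x, y)\<in>E. x \<in> P \<and> y \<in> Q \<and>
     (\<forall>y'\<in>Q. (x, y') \<in> E \<longrightarrow> y' = y) \<and> (\<forall>x'\<in>P. (x', y) \<in> E \<longrightarrow> x' = x)}"

text \<open>Edge preservation is applied to the range and to the part of \<open>C\<close> in the
  domain. On the range, the degree into that part is the indicator of the image of \<open>C\<close>;
  on the domain, the degree into the range is one.\<close>

lemma emeasure_matching_image:
  assumes nbr: "\<And>x y. (x, y) \<in> \<mu> \<Longrightarrow> E `` {x} \<inter> Range \<mu> = {y}"
      "\<And>x y. (x, y) \<in> \<mu> \<Longrightarrow> E `` {y} \<inter> Domain \<mu> = {x}"
    and dom: "Domain \<mu> \<in> sets (completion M)" "Range \<mu> \<in> sets (completion M)"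
    and C: "C \<in> sets (completion M)" "\<mu> `` C \<in> sets (completion M)"
  shows "emeasure (completion M) (\<mu> `` C) = emeasure (completion M) (C \<inter> Domain \<mu>)"
proof -
  have "of_nat (deg E x (C \<inter> Domain \<mu>)) * indicator (Range \<mu>) x = (indicator (\<mu> `` C) x :: ennreal)" for x
  proof (cases "x \<in> Range \<mu>")
    case True
    then obtain z where z: "(z, x) \<in> \<mu>" by auto
    have "E `` {x} \<inter> (C \<inter> Domain \<mu>) = (if z \<in> C then {z} else {})" using nbr(2)[OF z] by auto
    moreover have "z' = z" if "(z', x) \<in> \<mu>" for z' using nbr(2)[OF z] nbr(2)[OF that] by simp
    then have "x \<in> \<mu> `` C \<longleftrightarrow> z \<in> C" using z by blast
    ultimately show ?thesis using True by (simp add: deg_def indicator_def)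
  qed (auto simp: indicator_def)
  then have "emeasure (completion M) (\<mu> `` C) = (\<integral>\<^sup>+x\<in>Range \<mu>. of_nat (deg E x (C \<inter> Domain \<mu>)) \<partial>M)"
    using C(2) by (simp add: nn_integral_completion flip: nn_integral_indicator)
  also have "\<dots> = (\<integral>\<^sup>+x\<in>C \<inter> Domain \<mu>. of_nat (deg E x (Range \<mu>)) \<partial>M)"
    using C dom by (intro preserving_completion) auto
  also have "\<dots> = (\<integral>\<^sup>+x. indicator (C \<inter> Domain \<mu>) x \<partial>completion M)"
    unfolding nn_integral_completion
  proof (intro nn_integral_cong)
    fix x
    have "deg E x (Range \<mu>) = 1" if "x \<in> Domain \<mu>" using that nbr(1) by (auto simp: deg_def)
    then show "of_nat (deg E x (Range \<mu>)) * indicator (C \<inter> Domain \<mu>) x = (indicator (C \<inter> Domain \<mu>) x :: ennreal)"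
      by (auto simp: indicator_def)
  qed
  finally show ?thesis using C dom by simp
qed

lemma matching_between:
  assumes U: "separating_base M U" and PQ: "P \<in> sets (completion M)" "Q \<in> sets (completion M)"
    and sub: "P \<subseteq> X\<^sub>1" "Q \<subseteq> X\<^sub>2"
  defines "\<mu> \<equiv> exclusive_edges P Q"
  shows "pmp_matching (\<mu> \<union> \<mu>\<inverse>)"
proof -
  note \<mu>_def = \<mu>_def[unfolded exclusive_edges_def]
  define one where "one A = {x. \<exists>!y. y \<in> A \<and> (x, y) \<in> E}" for A
  have one: "one P \<in> sets (completion M)" "one Q \<in> sets (completion M)"
    unfolding one_def using unique_nbr_measurable[OF U] PQ by auto
  have disj: "P \<inter> Q = {}" using sub parts_disjoint by blast
  have sv: "y = z" if "(x, y) \<in> \<mu>" "(x, z) \<in> \<mu>" for x y z using that unfolding \<mu>_def by blast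
  have sv': "x = z" if "(x, y) \<in> \<mu>" "(z, y) \<in> \<mu>" for x y z using that unfolding \<mu>_def by blast
  have sub\<mu>: "x \<in> P \<and> y \<in> Q \<and> (x, y) \<in> E" if "(x, y) \<in> \<mu>" for x y using that unfolding \<mu>_def by blast
  \<comment> \<open>Apart from adjacency, membership splits into one condition on each end. Images
    under the matching thus become neighborhoods of measurable sets cut by measurable sets.\<close>
  have mem: "(x, y) \<in> \<mu> \<longleftrightarrow> (x, y) \<in> E \<and> x \<in> P \<and> y \<in> Q \<and> x \<in> one Q \<and> y \<in> one P" for x y
  proof (cases "(x, y) \<in> E \<and> x \<in> P \<and> y \<in> Q")
    case True
    then have "x \<in> one Q \<longleftrightarrow> (\<forall>y'\<in>Q. (x, y') \<in> E \<longrightarrow> y' = y)" unfolding one_def by blast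
    moreover have "y \<in> one P \<longleftrightarrow> (\<forall>x'\<in>P. (x', y) \<in> E \<longrightarrow> x' = x)"
    proof -
      have "(y, x') \<in> E \<longleftrightarrow> (x', y) \<in> E" for x' using edge_sym by blast
      then show ?thesis using True unfolding one_def by auto
    qed
    ultimately show ?thesis using True unfolding \<mu>_def by simp
  qed (auto simp: \<mu>_def)
  have fwd: "\<mu> `` C = Q \<inter> one P \<inter> E `` (C \<inter> P \<inter> one Q)" for C
    by (auto simp: mem)
  have bwd: "\<mu>\<inverse> `` C = P \<inter> one Q \<inter> E `` (C \<inter> Q \<inter> one P)" for C
  proof (rule set_eqI)
    fix x
    have "x \<in> \<mu>\<inverse> `` C \<longleftrightarrow> (\<exists>y\<in>C. (x, y) \<in> \<mu>)" by blast
    moreover have "x \<in> E `` S \<longleftrightarrow> (\<exists>y\<in>S. (x, y) \<in> E)" for S using edge_sym by blast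
    ultimately show "x \<in> \<mu>\<inverse> `` C \<longleftrightarrow> x \<in> P \<inter> one Q \<inter> E `` (C \<inter> Q \<inter> one P)"
      by (auto simp: mem)
  qed
  have fwd_meas: "\<mu> `` C \<in> sets (completion M)" if "C \<in> sets (completion M)" for C
    unfolding fwd using that one PQ by (auto intro!: sets.Int nbrs_measurable)
  have bwd_meas: "\<mu>\<inverse> `` C \<in> sets (completion M)" if "C \<in> sets (completion M)" for C
    unfolding bwd using that one PQ by (auto intro!: sets.Int nbrs_measurable)
  have dom: "Domain \<mu> \<in> sets (completion M)" "Range \<mu> \<in> sets (completion M)"
  proof -
    have "Domain \<mu> = \<mu>\<inverse> `` space M" "Range \<mu> = \<mu> `` space M"
      using sub\<mu> edge_in_space by blast+
    then show "Domain \<mu> \<in> sets (completion M)" "Range \<mu> \<in> sets (completion M)"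
      using fwd_meas[of "space M"] bwd_meas[of "space M"] by auto
  qed
  have nbr: "E `` {x} \<inter> Range \<mu> = {y}" "E `` {y} \<inter> Domain \<mu> = {x}" if "(x, y) \<in> \<mu>" for x y
    using that edge_sym unfolding \<mu>_def by blast+
  have em_fwd: "emeasure (completion M) (\<mu> `` C) = emeasure (completion M) (C \<inter> Domain \<mu>)"
    if "C \<in> sets (completion M)" for C
    by (rule emeasure_matching_image[OF nbr dom that fwd_meas[OF that]])
  have "emeasure (completion M) (\<mu>\<inverse> `` C) = emeasure (completion M) (C \<inter> Domain (\<mu>\<inverse>))"
    if "C \<in> sets (completion M)" for C
    by (rule emeasure_matching_image) (simp_all add: nbr dom that bwd_meas)
  then have em_bwd: "emeasure (completion M) (\<mu>\<inverse> `` C) = emeasure (completion M) (C \<inter> Range \<mu>)"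
    if "C \<in> sets (completion M)" for C using that by simp
  have disj': "Domain \<mu> \<inter> Range \<mu> = {}" using sub\<mu> disj by blast
  have "emeasure (completion M) ((\<mu> \<union> \<mu>\<inverse>) `` C) = emeasure (completion M) (C \<inter> Domain (\<mu> \<union> \<mu>\<inverse>))"
    if C: "C \<in> sets (completion M)" for C
  proof -
    have "(\<mu> \<union> \<mu>\<inverse>) `` C = \<mu> `` C \<union> \<mu>\<inverse> `` C" by blast
    moreover have "\<mu> `` C \<inter> \<mu>\<inverse> `` C = {}" using disj' by blast
    ultimately have "emeasure (completion M) ((\<mu> \<union> \<mu>\<inverse>) `` C)
        = emeasure (completion M) (\<mu> `` C) + emeasure (completion M) (\<mu>\<inverse> `` C)"
      using plus_emeasure[OF fwd_meas[OF C] bwd_meas[OF C]] by simp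
    also have "\<dots> = emeasure (completion M) (C \<inter> Domain \<mu>) + emeasure (completion M) (C \<inter> Range \<mu>)"
      using em_fwd[OF C] em_bwd[OF C] by simp
    also have "\<dots> = emeasure (completion M) ((C \<inter> Domain \<mu>) \<union> (C \<inter> Range \<mu>))"
      using C dom disj' by (intro plus_emeasure) auto
    also have "(C \<inter> Domain \<mu>) \<union> (C \<inter> Range \<mu>) = C \<inter> Domain (\<mu> \<union> \<mu>\<inverse>)" by blast
    finally show ?thesis .
  qed
  moreover have "(\<mu> \<union> \<mu>\<inverse>) `` C \<in> sets (completion M)" if "C \<in> sets (completion M)" for C
    using fwd_meas[OF that] bwd_meas[OF that] by (simp add: Un_Image)
  moreover have "\<mu> \<union> \<mu>\<inverse> \<subseteq> E" by (auto dest: sub\<mu> intro: edge_sym)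
  moreover have "sym (\<mu> \<union> \<mu>\<inverse>)" by (auto simp: sym_def)
  moreover have "single_valued (\<mu> \<union> \<mu>\<inverse>)"
    using sv sv' disj' by (auto simp: single_valued_def)
  ultimately show ?thesis unfolding pmp_matching_def by blast
qed

end

text \<open>Matchings as everywhere defined involutions that fix the unmatched vertices, so that
  preservation of measure becomes invariance under a map. \<open>T_disjoint\<close> says that an
  edge belongs to one matching only; \<open>X\<close> is one side of the bipartition.\<close>

locale involution_system = prob_space M for M :: "'a measure" +
  fixes T :: "nat \<Rightarrow> 'a \<Rightarrow> 'a" and X :: "'a set" and d :: nat
  assumes T_measurable[measurable]: "T j \<in> M \<rightarrow>\<^sub>M M"
    and T_involution: "T j (T j x) = x"
    and T_preserving: "distr M M (T j) = M"
    and T_disjoint: "T i x = T j x \<Longrightarrow> T i x \<noteq> x \<Longrightarrow> i = j"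
    and X_measurable[measurable]: "X \<in> sets M"
    and T_bipartite: "x \<in> space M \<Longrightarrow> T j x \<noteq> x \<Longrightarrow> x \<in> X \<longleftrightarrow> T j x \<notin> X"
    and T_degree: "x \<in> space M \<Longrightarrow> finite {j. T j x \<noteq> x} \<and> card {j. T j x \<noteq> x} \<le> d"

section \<open>From the edge set to a countable family of involutions\<close>

context bipartite_graphing begin

lemma pmp_matching_measurable:
  "pmp_matching \<mu> \<Longrightarrow> C \<in> sets (completion M) \<Longrightarrow> \<mu> `` C \<in> sets (completion M)"
  unfolding pmp_matching_def by blast

lemma pmp_matching_emeasure:
  "pmp_matching \<mu> \<Longrightarrow> C \<in> sets (completion M) \<Longrightarrow>
    emeasure (completion M) (\<mu> `` C) = emeasure (completion M) (C \<inter> Domain \<mu>)"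
  unfolding pmp_matching_def by blast

lemma pmp_matching_sym: "pmp_matching \<mu> \<Longrightarrow> (x, y) \<in> \<mu> \<Longrightarrow> (y, x) \<in> \<mu>"
  unfolding pmp_matching_def sym_def by blast

lemma pmp_matching_unique: "pmp_matching \<mu> \<Longrightarrow> (x, y) \<in> \<mu> \<Longrightarrow> (x, z) \<in> \<mu> \<Longrightarrow> y = z"
  unfolding pmp_matching_def single_valued_def by blast

lemma pmp_matching_edge: "pmp_matching \<mu> \<Longrightarrow> (x, y) \<in> \<mu> \<Longrightarrow> (x, y) \<in> E"
  unfolding pmp_matching_def by blast

lemma Domain_pmp_matching:
  assumes "pmp_matching \<mu>"
  shows "Domain \<mu> = \<mu> `` space M" "Domain \<mu> \<in> sets (completion M)"
proof -
  show "Domain \<mu> = \<mu> `` space M"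
    using pmp_matching_sym[OF assms] pmp_matching_edge[OF assms] edge_in_space by blast
  then show "Domain \<mu> \<in> sets (completion M)" using pmp_matching_measurable[OF assms, of "space M"] by auto
qed

text \<open>The partners of a vertex under the two matchings differ exactly if some
  \<open>U n\<close> contains the first and not the second.\<close>

lemma Domain_Int_pmp_matching:
  assumes U: "separating_base M U" and \<mu>: "pmp_matching \<mu>" "pmp_matching \<mu>'"
  shows "Domain (\<mu> \<inter> \<mu>') \<in> sets (completion M)"
proof -
  have "Domain (\<mu> \<inter> \<mu>') = Domain \<mu> \<inter> Domain \<mu>' - (\<Union>n. \<mu> `` U n \<inter> \<mu>' `` (space M - U n))"
  proof (intro set_eqI iffI)
    fix x assume "x \<in> Domain (\<mu> \<inter> \<mu>')"
    then obtain y where y: "(x, y) \<in> \<mu>" "(x, y) \<in> \<mu>'" by blast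
    have "x \<notin> \<mu> `` U n \<inter> \<mu>' `` (space M - U n)" for n
    proof
      assume "x \<in> \<mu> `` U n \<inter> \<mu>' `` (space M - U n)"
      then obtain z z' where "(z, x) \<in> \<mu>" "z \<in> U n" "(z', x) \<in> \<mu>'" "z' \<notin> U n" by blast
      moreover from this have "z = y" "z' = y"
        using pmp_matching_sym pmp_matching_unique \<mu> y by meson+
      ultimately show False by simp
    qed
    then show "x \<in> Domain \<mu> \<inter> Domain \<mu>' - (\<Union>n. \<mu> `` U n \<inter> \<mu>' `` (space M - U n))"
      using y by blast
  next
    fix x assume x: "x \<in> Domain \<mu> \<inter> Domain \<mu>' - (\<Union>n. \<mu> `` U n \<inter> \<mu>' `` (space M - U n))"
    then obtain y y' where y: "(x, y) \<in> \<mu>" "(x, y') \<in> \<mu>'" by blast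
    have sp: "y \<in> space M" "y' \<in> space M"
      using y pmp_matching_edge[OF \<mu>(1)] pmp_matching_edge[OF \<mu>(2)] edge_in_space by blast+
    have "y = y'"
    proof (rule ccontr)
      assume "y \<noteq> y'"
      then have "y \<notin> {y'}" by simp
      then obtain n where "y \<in> U n" "U n \<inter> {y'} = {}"
        using U sp(1) unfolding separating_base_def by (meson finite.emptyI finite.insertI)
      then have "x \<in> \<mu> `` U n \<inter> \<mu>' `` (space M - U n)"
        using y sp(2) pmp_matching_sym[OF \<mu>(1) y(1)] pmp_matching_sym[OF \<mu>(2) y(2)] by blast
      then show False using x by blast
    qed
    then show "x \<in> Domain (\<mu> \<inter> \<mu>')" using y by blast
  qed
  moreover have Un: "U n \<in> sets (completion M)" for n using U unfolding separating_base_def by blast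
  moreover have "space M - U n \<in> sets (completion M)" for n
    using sets.compl_sets[OF Un] by simp
  moreover have "space M \<in> sets (completion M)" by simp
  ultimately show ?thesis
    by (simp only:) (intro sets.Diff sets.Int sets.countable_UN image_subsetI
        Domain_pmp_matching(2) pmp_matching_measurable \<mu>; assumption?)
qed

lemma pmp_matching_restrict:
  assumes \<mu>: "pmp_matching \<mu>" and G: "G \<in> sets (completion M)" "\<mu> `` G \<subseteq> G"
  shows "pmp_matching {(x, y)\<in>\<mu>. x \<notin> G}"
proof -
  let ?\<nu> = "{(x, y)\<in>\<mu>. x \<notin> G}"
  have inv: "x \<in> G \<longleftrightarrow> y \<in> G" if "(x, y) \<in> \<mu>" for x y
    using that G(2) pmp_matching_sym[OF \<mu>] by blast
  have "?\<nu> `` C = \<mu> `` (C - G)" for C by blast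
  moreover have "Domain ?\<nu> = Domain \<mu> - G" by blast
  moreover have "C \<inter> (Domain \<mu> - G) = (C - G) \<inter> Domain \<mu>" for C by blast
  moreover have "C - G \<in> sets (completion M)" if "C \<in> sets (completion M)" for C using that G(1) by blast
  moreover have "sym ?\<nu>" using inv pmp_matching_sym[OF \<mu>] by (auto simp: sym_def)
  moreover have "single_valued ?\<nu>" "?\<nu> \<subseteq> E" using \<mu> unfolding pmp_matching_def single_valued_def by blast+
  ultimately show ?thesis using pmp_matching_measurable[OF \<mu>] pmp_matching_emeasure[OF \<mu>]
    unfolding pmp_matching_def by simp
qed

text \<open>Every edge is exclusive between suitable base sets: one around each end that avoids the
  other neighbors of the opposite end, which are finitely many. Pairs of base sets are countable, so
  countably many matchings cover \<open>E\<close>.\<close>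

lemma matching_decomposition:
  assumes U: "separating_base M U"
  shows "\<exists>\<nu> :: nat \<Rightarrow> ('a \<times> 'a) set. (\<forall>j. pmp_matching (\<nu> j)) \<and> (\<Union>j. \<nu> j) = E \<and> (\<forall>i j. i \<noteq> j \<longrightarrow> \<nu> i \<inter> \<nu> j = {})"
proof -
  let ?m = exclusive_edges
  define \<mu> where "\<mu> j = (let P = U (fst (prod_decode j)) \<inter> X\<^sub>1; Q = U (snd (prod_decode j)) \<inter> X\<^sub>2 in ?m P Q \<union> (?m P Q)\<inverse>)"
    for j
  have Um: "U n \<in> sets (completion M)" for n using U unfolding separating_base_def by blast
  have pmp: "pmp_matching (\<mu> j)" for j
    unfolding \<mu>_def Let_def using Um parts_measurable
    by (intro matching_between[OF U]) auto
  have cover12: "\<exists>j. (x, y) \<in> \<mu> j" if xy: "(x, y) \<in> E" "x \<in> X\<^sub>1" "y \<in> X\<^sub>2" for x y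
  proof -
    have sp: "x \<in> space M" "y \<in> space M" using xy edge_in_space by auto
    have sep: "\<exists>n. z \<in> U n \<and> U n \<inter> Z = {}" if "z \<in> space M" "finite Z" "z \<notin> Z" for z Z
      using U that unfolding separating_base_def by blast
    obtain k where k: "x \<in> U k" "U k \<inter> (E `` {y} - {x}) = {}"
      using sep[OF sp(1), of "E `` {y} - {x}"] finite_nbrs by auto
    obtain l where l: "y \<in> U l" "U l \<inter> (E `` {x} - {y}) = {}"
      using sep[OF sp(2), of "E `` {x} - {y}"] finite_nbrs by auto
    have "(x, y) \<in> ?m (U k \<inter> X\<^sub>1) (U l \<inter> X\<^sub>2)"
      using k l xy edge_sym unfolding exclusive_edges_def by blast
    then have "(x, y) \<in> \<mu> (prod_encode (k, l))" by (simp add: \<mu>_def Let_def)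
    then show ?thesis ..
  qed
  have cover: "\<exists>j. (x, y) \<in> \<mu> j" if xy: "(x, y) \<in> E" for x y
  proof (cases "x \<in> X\<^sub>1 \<and> y \<in> X\<^sub>2")
    case False
    then have "y \<in> X\<^sub>1" "x \<in> X\<^sub>2" using xy edges_between by auto
    then show ?thesis using cover12[OF edge_sym[OF xy]] pmp_matching_sym[OF pmp] by blast
  qed (use cover12[OF xy] in auto)
  \<comment> \<open>A vertex has at most one edge in each matching, so removing the edges used
    earlier amounts to removing the vertices where two matchings agree.\<close>
  define \<nu> where "\<nu> j = {(x, y)\<in>\<mu> j. x \<notin> (\<Union>i\<in>{..<j}. Domain (\<mu> i \<inter> \<mu> j))}" for j
  have \<nu>: "(x, y) \<in> \<nu> j \<longleftrightarrow> (x, y) \<in> \<mu> j \<and> (\<forall>i<j. (x, y) \<notin> \<mu> i)" for x y j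
    unfolding \<nu>_def using pmp_matching_unique[OF pmp] by blast
  have pmp\<nu>: "pmp_matching (\<nu> j)" for j
    unfolding \<nu>_def
  proof (rule pmp_matching_restrict[OF pmp])
    show "(\<Union>i\<in>{..<j}. Domain (\<mu> i \<inter> \<mu> j)) \<in> sets (completion M)"
      using Domain_Int_pmp_matching[OF U pmp pmp] by blast
    show "\<mu> j `` (\<Union>i\<in>{..<j}. Domain (\<mu> i \<inter> \<mu> j)) \<subseteq> (\<Union>i\<in>{..<j}. Domain (\<mu> i \<inter> \<mu> j))"
    proof
      fix y assume "y \<in> \<mu> j `` (\<Union>i\<in>{..<j}. Domain (\<mu> i \<inter> \<mu> j))"
      then obtain x i z where "(x, y) \<in> \<mu> j" "i < j" "(x, z) \<in> \<mu> i" "(x, z) \<in> \<mu> j" by blast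
      moreover from this have "z = y" using pmp_matching_unique[OF pmp] by blast
      ultimately have "i < j" "(y, x) \<in> \<mu> i \<inter> \<mu> j" using pmp_matching_sym[OF pmp] by blast+
      then show "y \<in> (\<Union>i\<in>{..<j}. Domain (\<mu> i \<inter> \<mu> j))" by blast
    qed
  qed
  have "(\<Union>j. \<nu> j) = E"
  proof (intro set_eqI iffI)
    fix p assume "p \<in> E"
    then obtain x y where p: "p = (x, y)" "\<exists>j. (x, y) \<in> \<mu> j" using cover by (metis surj_pair)
    then have "(x, y) \<in> \<nu> (LEAST j. (x, y) \<in> \<mu> j)"
      unfolding \<nu> by (auto intro: LeastI dest: not_less_Least)
    then show "p \<in> (\<Union>j. \<nu> j)" using p(1) by blast
  next
    fix p assume "p \<in> (\<Union>j. \<nu> j)"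
    then show "p \<in> E" using pmp\<nu> unfolding pmp_matching_def by blast
  qed
  moreover have "\<nu> i \<inter> \<nu> j = {}" if "i \<noteq> j" for i j
  proof -
    have "p \<notin> \<nu> i \<inter> \<nu> j" for p
      using \<nu>[of "fst p" "snd p"] \<open>i \<noteq> j\<close> by (cases i j rule: linorder_cases) auto
    then show ?thesis by blast
  qed
  ultimately show ?thesis using pmp\<nu> by blast
qed

text \<open>Neighbors of a null set form a null set, so closing under neighbors countably often
  keeps the measure zero.\<close>

lemma invariant_null_set:
  assumes "N \<in> null_sets M"
  shows "\<exists>Z\<in>null_sets M. N \<subseteq> Z \<and> E `` Z \<subseteq> Z"
proof -
  have step: "\<exists>K'. K' \<in> null_sets M \<and> K \<union> E `` K \<subseteq> K'" if K: "K \<in> null_sets M" for K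
  proof -
    obtain K' where "K' \<in> null_sets M" "E `` K \<subseteq> K'"
      using nbrs_of_null_Borel[OF K] unfolding null_sets_completion_iff2 by auto
    then show ?thesis using K by (intro exI[of _ "K \<union> K'"]) auto
  qed
  have "\<exists>Z. \<forall>n::nat. (Z n \<in> null_sets M \<and> (n = 0 \<longrightarrow> Z n = N)) \<and> Z n \<union> E `` Z n \<subseteq> Z (Suc n)"
  proof (rule dependent_nat_choice)
    show "\<exists>x. x \<in> null_sets M \<and> (0 = 0 \<longrightarrow> x = N)" using assms by blast
    show "\<exists>y. (y \<in> null_sets M \<and> (Suc n = 0 \<longrightarrow> y = N)) \<and> x \<union> E `` x \<subseteq> y"
      if "x \<in> null_sets M \<and> (n = 0 \<longrightarrow> x = N)" for x and n :: nat
      using step[of x] that by simp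
  qed
  then obtain Z where Z: "\<And>n. Z n \<in> null_sets M" "Z 0 = N" "\<And>n. Z n \<union> E `` Z n \<subseteq> Z (Suc n)" by blast
  have "(\<Union>n. Z n) \<in> null_sets M" using Z(1) by blast
  moreover have "N \<subseteq> (\<Union>n. Z n)" using Z(2) by blast
  moreover have "E `` (\<Union>n. Z n) \<subseteq> (\<Union>n. Z n)" using Z(3) by blast
  ultimately show ?thesis by blast
qed

end

text \<open>The conclusion is for every null set above \<open>N\<close>, so that \<open>N\<close>
  can later be enlarged to a null set closed under neighbors.\<close>

lemma borel_modulo_null_set:
  assumes "\<And>n::nat. S n \<in> sets (completion M)"
  shows "\<exists>N\<in>null_sets M. \<forall>Z\<in>null_sets M. N \<subseteq> Z \<longrightarrow> (\<forall>n. S n - Z \<in> sets M)"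
proof -
  have "\<forall>n. \<exists>K. K \<in> null_sets M \<and> S n - K \<in> sets M"
  proof
    fix n
    obtain S' K where S: "S' \<in> sets M" "K \<in> null_sets M" "S' \<subseteq> S n" "S n \<subseteq> S' \<union> K"
      by (rule completion_borel_approx[OF assms]) (rule that)
    then have "S n - K = S' - K" by blast
    then show "\<exists>K. K \<in> null_sets M \<and> S n - K \<in> sets M" using S(1,2) by (intro exI[of _ K]) auto
  qed
  from choice[OF this] obtain K where K: "\<And>n. K n \<in> null_sets M" "\<And>n. S n - K n \<in> sets M" by auto
  have "S n - Z \<in> sets M" if "Z \<in> null_sets M" "(\<Union>n. K n) \<subseteq> Z" for Z n
  proof -
    have "S n - Z = (S n - K n) - Z" using that(2) by blast
    then show ?thesis using K(2)[of n] that(1) by auto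
  qed
  moreover have "(\<Union>n. K n) \<in> null_sets M" using K(1) by blast
  ultimately show ?thesis by blast
qed


text \<open>Countably many sets matter: the domains of the matchings, the images of base sets and
  one side. All become Borel once a null set \<open>Z\<close> closed under neighbors is removed. The
  involutions are the identity on \<open>Z\<close>, and partners of vertices outside
  \<open>Z\<close> stay outside.\<close>

lemma (in bipartite_graphing) involution_system_exists:
  assumes deg_le: "\<And>x. x \<in> space M \<Longrightarrow> deg E x (space M) \<le> d"
  shows "\<exists>T X Z. involution_system M T X d \<and> Z \<in> null_sets M \<and>
    (\<forall>x. x \<notin> space M - Z \<longrightarrow> (\<forall>j. T j x = x)) \<and>
    (\<forall>x\<in>space M - Z. \<forall>y. (x, y) \<in> E \<longleftrightarrow> (\<exists>j. y = T j x \<and> y \<noteq> x))"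
proof -
  obtain U where U: "separating_base M U"
    by (rule separating_base_exists[OF standard_borel]) (rule that)
  have Um: "U n \<in> sets M" for n using U unfolding separating_base_def by blast
  obtain \<nu> :: "nat \<Rightarrow> ('a \<times> 'a) set" where \<nu>: "\<And>j. pmp_matching (\<nu> j)" "(\<Union>j. \<nu> j) = E"
    "\<And>i j. i \<noteq> j \<Longrightarrow> \<nu> i \<inter> \<nu> j = {}"
    using matching_decomposition[OF U] by auto
  have "\<exists>N\<in>null_sets M. \<forall>Z\<in>null_sets M. N \<subseteq> Z \<longrightarrow> (\<forall>j. Domain (\<nu> j) - Z \<in> sets M)"
    by (rule borel_modulo_null_set) (rule Domain_pmp_matching(2)[OF \<nu>(1)])
  then obtain N1 where N1: "N1 \<in> null_sets M"
    "\<And>Z j. Z \<in> null_sets M \<Longrightarrow> N1 \<subseteq> Z \<Longrightarrow> Domain (\<nu> j) - Z \<in> sets M" by auto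
  have "\<exists>N\<in>null_sets M. \<forall>Z\<in>null_sets M. N \<subseteq> Z \<longrightarrow>
      (\<forall>n. \<nu> (fst (prod_decode n)) `` U (snd (prod_decode n)) - Z \<in> sets M)"
    using Um by (intro borel_modulo_null_set pmp_matching_measurable[OF \<nu>(1)]) auto
  then obtain N2 where N2: "N2 \<in> null_sets M"
    "\<And>Z n. Z \<in> null_sets M \<Longrightarrow> N2 \<subseteq> Z \<Longrightarrow> \<nu> (fst (prod_decode n)) `` U (snd (prod_decode n)) - Z \<in> sets M"
    by auto
  have "\<exists>N\<in>null_sets M. \<forall>Z\<in>null_sets M. N \<subseteq> Z \<longrightarrow> (\<forall>n::nat. X\<^sub>1 - Z \<in> sets M)"
    by (rule borel_modulo_null_set) (rule parts_measurable(1))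
  then obtain N3 where N3: "N3 \<in> null_sets M"
    "\<And>Z. Z \<in> null_sets M \<Longrightarrow> N3 \<subseteq> Z \<Longrightarrow> X\<^sub>1 - Z \<in> sets M" by auto
  obtain Z where Z: "Z \<in> null_sets M" "N1 \<union> N2 \<union> N3 \<subseteq> Z" "E `` Z \<subseteq> Z"
    using invariant_null_set[OF null_sets.Un[OF null_sets.Un[OF N1(1) N2(1)] N3(1)]] by auto
  have Zinv: "x \<in> Z \<longleftrightarrow> y \<in> Z" if "(x, y) \<in> E" for x y using that edge_sym Z(3) by blast
  have Dom: "Domain (\<nu> j) - Z \<in> sets M" for j using N1(2)[OF Z(1)] Z(2) by auto
  have \<nu>U: "\<nu> j `` U l - Z \<in> sets M" for j l using N2(2)[OF Z(1), of "prod_encode (j, l)"] Z(2) by auto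
  have X1: "X\<^sub>1 - Z \<in> sets M" using N3(2)[OF Z(1)] Z(2) by auto
  define T where "T j x = (if x \<notin> Z \<and> x \<in> Domain (\<nu> j) then THE y. (x, y) \<in> \<nu> j else x)" for j x
  have irr: "(x, x) \<notin> E" for x using irrefl_edges by (simp add: irrefl_def)
  have \<nu>E: "(x, y) \<in> E" if "(x, y) \<in> \<nu> j" for x y j using that pmp_matching_edge[OF \<nu>(1)] by blast
  have T_eq: "T j x = y" if "x \<notin> Z" "(x, y) \<in> \<nu> j" for j x y
  proof -
    have "(THE y. (x, y) \<in> \<nu> j) = y" using that(2) pmp_matching_unique[OF \<nu>(1)] by (intro the_equality) auto
    then show ?thesis using that by (auto simp: T_def)
  qed
  have T_fix: "T j x = x" if "x \<in> Z \<or> x \<notin> Domain (\<nu> j)" for j x using that by (auto simp: T_def)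
  have T_move: "(x, T j x) \<in> \<nu> j \<and> x \<notin> Z \<and> T j x \<notin> Z" if "T j x \<noteq> x" for j x
  proof -
    have x: "x \<notin> Z" "x \<in> Domain (\<nu> j)" using that T_fix by blast+
    then obtain y where y: "(x, y) \<in> \<nu> j" by blast
    then show ?thesis using T_eq[OF x(1) y] Zinv[OF \<nu>E[OF y]] x(1) by simp
  qed
  have inv: "T j (T j x) = x" for j x
  proof (cases "T j x = x")
    case False
    then have "T j x \<notin> Z" "(T j x, x) \<in> \<nu> j" using T_move pmp_matching_sym[OF \<nu>(1)] by blast+
    then show ?thesis by (rule T_eq)
  qed simp
  have T_space: "T j x \<in> space M" if "x \<in> space M" for j x
    using that T_move[of j x] \<nu>E edge_in_space by metis
  have preimage: "T j -` C \<inter> space M = (C - (Domain (\<nu> j) - Z)) \<union> (\<nu> j `` C - Z)" if "C \<subseteq> space M" for j C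
  proof (intro set_eqI iffI)
    fix x assume x: "x \<in> T j -` C \<inter> space M"
    show "x \<in> (C - (Domain (\<nu> j) - Z)) \<union> (\<nu> j `` C - Z)"
    proof (cases "T j x = x")
      case True
      then have "x \<notin> Domain (\<nu> j) - Z" using T_eq irr \<nu>E by (metis DiffE DomainE)
      then show ?thesis using x True by simp
    next
      case False
      then show ?thesis using x T_move[OF False] pmp_matching_sym[OF \<nu>(1)] by blast
    qed
  next
    fix x assume "x \<in> (C - (Domain (\<nu> j) - Z)) \<union> (\<nu> j `` C - Z)"
    then consider "x \<in> C" "x \<notin> Domain (\<nu> j) - Z" | y where "y \<in> C" "(y, x) \<in> \<nu> j" "x \<notin> Z" by blast
    then show "x \<in> T j -` C \<inter> space M"
    proof cases
      case 1
      then show ?thesis using T_fix[of x j] \<open>C \<subseteq> space M\<close> by auto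
    next
      case 2
      then have "T j x = y" using T_eq pmp_matching_sym[OF \<nu>(1)] by blast
      then show ?thesis using 2(1) edge_in_space[OF \<nu>E[OF 2(2)]] by simp
    qed
  qed
  \<comment> \<open>Only preimages of the generators \<open>U l\<close> are tested, because images
    of arbitrary Borel sets under a matching need not become Borel off \<open>Z\<close>.\<close>
  have T_meas: "T j \<in> M \<rightarrow>\<^sub>M M" for j
  proof (rule measurable_sigma_sets)
    show "sets M = sigma_sets (space M) (range U)" using U unfolding separating_base_def by blast
    show "range U \<subseteq> Pow (space M)" using Um sets.sets_into_space by blast
    show "T j \<in> space M \<rightarrow> space M" using T_space by auto
    fix C assume "C \<in> range U"
    then obtain l where C: "C = U l" by blast
    show "T j -` C \<inter> space M \<in> sets M"
      unfolding C preimage[OF sets.sets_into_space[OF Um]] by (rule sets.Un[OF sets.Diff[OF Um Dom] \<nu>U])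
  qed
  \<comment> \<open>For an arbitrary Borel set the image under the matching is measurable only up to
    a null set, so the computation takes place in the completion.\<close>
  have pres: "distr M M (T j) = M" for j
  proof (rule measure_eqI)
    fix C assume "C \<in> sets (distr M M (T j))"
    then have C: "C \<in> sets M" by simp
    then have C': "C \<in> sets (completion M)" by simp
    have meas: "\<nu> j `` C \<in> sets (completion M)" "Domain (\<nu> j) \<in> sets (completion M)"
      using pmp_matching_measurable[OF \<nu>(1) C'] Domain_pmp_matching(2)[OF \<nu>(1)] by auto
    have TC: "T j -` C \<inter> space M \<in> sets M" using T_meas C by (rule measurable_sets)
    have "emeasure (distr M M (T j)) C = emeasure (completion M) (T j -` C \<inter> space M)"
      using T_meas C TC by (simp add: emeasure_distr)
    also have "\<dots> = emeasure (completion M) ((C - Domain (\<nu> j)) \<union> \<nu> j `` C)"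
    proof (rule emeasure_eq_AE)
      have "AE x in completion M. x \<notin> Z" using AE_not_in[OF Z(1)] by (rule AE_completion)
      then show "AE x in completion M. x \<in> T j -` C \<inter> space M \<longleftrightarrow> x \<in> (C - Domain (\<nu> j)) \<union> \<nu> j `` C"
        unfolding preimage[OF sets.sets_into_space[OF C]] by eventually_elim blast
    qed (use TC C' meas in auto)
    also have "\<dots> = emeasure (completion M) (C - Domain (\<nu> j)) + emeasure (completion M) (\<nu> j `` C)"
    proof (rule plus_emeasure[symmetric])
      show "(C - Domain (\<nu> j)) \<inter> \<nu> j `` C = {}" using pmp_matching_sym[OF \<nu>(1)] by blast
    qed (use C' meas in auto)
    also have "\<dots> = emeasure (completion M) (C - Domain (\<nu> j)) + emeasure (completion M) (C \<inter> Domain (\<nu> j))"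
      using pmp_matching_emeasure[OF \<nu>(1) C'] by simp
    also have "\<dots> = emeasure (completion M) ((C - Domain (\<nu> j)) \<union> (C \<inter> Domain (\<nu> j)))"
      using C' meas by (intro plus_emeasure) auto
    also have "(C - Domain (\<nu> j)) \<union> (C \<inter> Domain (\<nu> j)) = C" by blast
    finally show "emeasure (distr M M (T j)) C = emeasure M C" using C by simp
  qed simp
  have disj: "i = j" if "T i x = T j x" "T i x \<noteq> x" for i j x
    using \<nu>(3)[of i j] T_move[of i x] T_move[of j x] that by auto
  have adj: "(x, y) \<in> E \<longleftrightarrow> (\<exists>j. y = T j x \<and> y \<noteq> x)" if "x \<in> space M - Z" for x y
  proof
    assume xy: "(x, y) \<in> E"
    then obtain j where "(x, y) \<in> \<nu> j" using \<nu>(2) by blast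
    then have "T j x = y" using that T_eq by blast
    moreover have "y \<noteq> x" using irr xy by auto
    ultimately show "\<exists>j. y = T j x \<and> y \<noteq> x" by auto
  next
    assume "\<exists>j. y = T j x \<and> y \<noteq> x"
    then show "(x, y) \<in> E" using T_move \<nu>E by blast
  qed
  have "involution_system M T (X\<^sub>1 - Z) d"
  proof (intro involution_system.intro involution_system_axioms.intro prob_space_axioms)
    fix x j assume "T j x \<noteq> x"
    from T_move[OF this] have "(x, T j x) \<in> E" "x \<notin> Z" "T j x \<notin> Z" using \<nu>E by blast+
    then show "x \<in> X\<^sub>1 - Z \<longleftrightarrow> T j x \<notin> X\<^sub>1 - Z" using edges_between parts_disjoint by blast
  next
    fix x assume x: "x \<in> space M"
    have sub: "(\<lambda>j. T j x) ` {j. T j x \<noteq> x} \<subseteq> E `` {x} \<inter> space M"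
      using T_move \<nu>E edge_in_space by blast
    have inj: "inj_on (\<lambda>j. T j x) {j. T j x \<noteq> x}" using disj by (auto simp: inj_on_def)
    have "card {j. T j x \<noteq> x} \<le> deg E x (space M)"
      unfolding deg_def using card_inj_on_le[OF inj sub] finite_nbrs by simp
    moreover have "finite {j. T j x \<noteq> x}"
      using inj_on_finite[OF inj sub] finite_nbrs by simp
    ultimately show "finite {j. T j x \<noteq> x} \<and> card {j. T j x \<noteq> x} \<le> d" using deg_le[OF x] by simp
  qed (use T_meas inv pres disj X1 in blast)+
  moreover have "T j x = x" if "x \<notin> space M - Z" for j x
    using that T_move[of j x] \<nu>E edge_in_space by blast
  ultimately show ?thesis using Z(1) adj by blast
qed

section \<open>Approximate edge colorings\<close>

context involution_system begin

lemma T_in_space: "x \<in> space M \<Longrightarrow> T j x \<in> space M"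
  using T_measurable by (rule measurable_space)

text \<open>Moving changes sides, so being moved can be read off from the measurable set
  \<open>X\<close>.\<close>

lemma moved_iff: "x \<in> space M \<Longrightarrow> T j x \<noteq> x \<longleftrightarrow> (x \<in> X \<longleftrightarrow> T j x \<notin> X)"
  using T_bipartite[of x j] by metis

lemma moved_measurable[measurable]: "{x\<in>space M. T j x \<noteq> x} \<in> sets M"
proof -
  have "{x\<in>space M. T j x \<noteq> x} = {x\<in>space M. x \<in> X \<longleftrightarrow> T j x \<notin> X}" using moved_iff by blast
  also have "\<dots> \<in> sets M" by measurable
  finally show ?thesis .
qed

lemma measure_preimage:
  assumes "A \<in> sets M" shows "measure M (T j -` A \<inter> space M) = measure M A"
  using measure_distr[OF T_measurable assms] unfolding T_preserving by simp

text \<open>The colors are the numbers below \<open>d\<close>. The value \<open>d\<close> stands for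
  the absence of a color and is also forced at fixed points of \<open>T j\<close>, where there is no
  edge.\<close>

definition partial_coloring :: "(nat \<Rightarrow> 'a \<Rightarrow> nat) \<Rightarrow> bool" where
  "partial_coloring \<kappa> \<longleftrightarrow> (\<forall>j. \<kappa> j \<in> M \<rightarrow>\<^sub>M count_space UNIV) \<and>
     (\<forall>j. \<forall>x\<in>space M. \<kappa> j x \<le> d \<and> \<kappa> j (T j x) = \<kappa> j x \<and> (\<kappa> j x < d \<longrightarrow> T j x \<noteq> x)) \<and>
     (\<forall>i j. \<forall>x\<in>space M. i \<noteq> j \<longrightarrow> \<kappa> i x = \<kappa> j x \<longrightarrow> \<kappa> i x = d)"

definition uncolored :: "(nat \<Rightarrow> 'a \<Rightarrow> nat) \<Rightarrow> nat \<Rightarrow> 'a set" where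
  "uncolored \<kappa> j = {x\<in>space M. T j x \<noteq> x \<and> \<kappa> j x = d}"

lemma partial_coloring_measurable: "partial_coloring \<kappa> \<Longrightarrow> \<kappa> j \<in> M \<rightarrow>\<^sub>M count_space UNIV"
  unfolding partial_coloring_def by blast

lemma partial_coloringD:
  assumes "partial_coloring \<kappa>" "x \<in> space M"
  shows "\<kappa> j x \<le> d" "\<kappa> j (T j x) = \<kappa> j x" "\<kappa> j x < d \<Longrightarrow> T j x \<noteq> x"
    "\<kappa> i x = \<kappa> j x \<Longrightarrow> \<kappa> i x < d \<Longrightarrow> i = j"
  using assms unfolding partial_coloring_def by (blast, blast, blast, metis less_irrefl)

lemma uncolored_measurable:
  assumes "partial_coloring \<kappa>" shows "uncolored \<kappa> j \<in> sets M"
proof -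
  have [measurable]: "\<kappa> j \<in> M \<rightarrow>\<^sub>M count_space UNIV" for j using assms by (rule partial_coloring_measurable)
  have "uncolored \<kappa> j = {x\<in>space M. T j x \<noteq> x} \<inter> {x\<in>space M. \<kappa> j x = d}"
    by (auto simp: uncolored_def)
  then show ?thesis by simp
qed

text \<open>Each edge is represented by its end in \<open>X\<close>. The case \<open>a = b\<close>
  is included; switching is then the identity.\<close>

definition augmentable :: "(nat \<Rightarrow> 'a \<Rightarrow> nat) \<Rightarrow> nat \<Rightarrow> nat \<Rightarrow> nat \<Rightarrow> 'a set" where
  "augmentable \<kappa> j a b = {x\<in>uncolored \<kappa> j \<inter> X. (\<forall>i. \<kappa> i x \<noteq> a) \<and> (\<forall>i. \<kappa> i (T j x) \<noteq> b)}"

lemma augmentable_measurable: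
  assumes "partial_coloring \<kappa>" shows "augmentable \<kappa> j a b \<in> sets M"
proof -
  have [measurable]: "\<kappa> j \<in> M \<rightarrow>\<^sub>M count_space UNIV" for j using assms by (rule partial_coloring_measurable)
  note [measurable] = uncolored_measurable[OF assms]
  have "augmentable \<kappa> j a b = (uncolored \<kappa> j \<inter> X) \<inter> {x\<in>space M. (\<forall>i. \<kappa> i x \<noteq> a) \<and> (\<forall>i. \<kappa> i (T j x) \<noteq> b)}"
    unfolding augmentable_def uncolored_def by auto
  also have "\<dots> \<in> sets M" by measurable
  finally show ?thesis .
qed

text \<open>Bipartiteness makes the Kempe chains started at the endpoints \<open>T j x\<close> of all edges in question
  disjoint from all other endpoints \<open>x\<close>, so all these chains, finite or infinite, can be
  switched simultaneously.\<close>

lemma augment_coloring: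
  fixes j :: nat
  assumes \<kappa>: "partial_coloring \<kappa>" and ab: "a < d" "b < d"
  defines "S \<equiv> augmentable \<kappa> j a b"
  shows "\<exists>\<kappa>'. partial_coloring \<kappa>' \<and> uncolored \<kappa>' j \<subseteq> uncolored \<kappa> j - S \<and>
    (\<forall>i. i \<noteq> j \<longrightarrow> uncolored \<kappa>' i = uncolored \<kappa> i)"
proof -
  have \<kappa>_meas[measurable]: "\<kappa> j \<in> M \<rightarrow>\<^sub>M count_space UNIV" for j
    using \<kappa> by (rule partial_coloring_measurable)
  note [measurable] = uncolored_measurable[OF \<kappa>]
  have S_meas[measurable]: "S \<in> sets M" unfolding S_def by (rule augmentable_measurable[OF \<kappa>])
  note S_def = S_def[unfolded augmentable_def]
  have S_space: "S \<subseteq> space M" using S_meas by (rule sets.sets_into_space)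
  \<comment> \<open>Chains grow in one direction: out of vertices outside \<open>X\<close> along
    color \<open>a\<close>, out of vertices of \<open>X\<close> along color \<open>b\<close>. The
    countable union of the stages makes all chains, of any length, one measurable set.\<close>
  define Wn where "Wn = rec_nat {y\<in>space M. T j y \<in> S} (\<lambda>_ W. W \<union>
     {w\<in>space M. \<exists>i. T i w \<in> W \<and> (T i w \<notin> X \<and> \<kappa> i w = a \<or> T i w \<in> X \<and> \<kappa> i w = b)})"
  have Wn_0: "Wn 0 = {y\<in>space M. T j y \<in> S}" by (simp add: Wn_def)
  have Wn_Suc: "Wn (Suc n) = Wn n \<union>
     {w\<in>space M. \<exists>i. T i w \<in> Wn n \<and> (T i w \<notin> X \<and> \<kappa> i w = a \<or> T i w \<in> X \<and> \<kappa> i w = b)}" for n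
    by (simp add: Wn_def)
  have Wn_meas: "Wn n \<in> sets M" for n
  proof (induction n)
    case (Suc n)
    note [measurable] = Suc.IH
    show ?case unfolding Wn_Suc by measurable
  qed (unfold Wn_0, measurable)
  define W where "W = (\<Union>n. Wn n)"
  have W_meas[measurable]: "W \<in> sets M" unfolding W_def using Wn_meas by auto
  have W_space: "w \<in> space M" if "w \<in> W" for w using that sets.sets_into_space[OF W_meas] by blast
  have W_step: "T i w \<in> W" if "w \<in> W" "w \<notin> X \<and> \<kappa> i w = a \<or> w \<in> X \<and> \<kappa> i w = b" for w i
  proof -
    obtain n where n: "w \<in> Wn n" using \<open>w \<in> W\<close> unfolding W_def by blast
    have "\<kappa> i (T i w) = \<kappa> i w" using partial_coloringD(2)[OF \<kappa> W_space[OF that(1)]] .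
    then have "T i (T i w) \<in> Wn n \<and> (T i (T i w) \<notin> X \<and> \<kappa> i (T i w) = a \<or> T i (T i w) \<in> X \<and> \<kappa> i (T i w) = b)"
      using n that(2) by (simp add: T_involution)
    then have "T i w \<in> Wn (Suc n)"
      using T_in_space[OF W_space[OF that(1)]] unfolding Wn_Suc by blast
    then show ?thesis unfolding W_def by blast
  qed
  have W_origin: "T j w \<in> S \<or> (\<exists>i. T i w \<in> W \<and> (T i w \<notin> X \<and> \<kappa> i w = a \<or> T i w \<in> X \<and> \<kappa> i w = b))"
    if "w \<in> W" for w
  proof -
    have "w \<in> Wn n \<Longrightarrow> T j w \<in> S \<or> (\<exists>i. T i w \<in> W \<and> (T i w \<notin> X \<and> \<kappa> i w = a \<or> T i w \<in> X \<and> \<kappa> i w = b))" for n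
    proof (induction n)
      case (Suc n)
      then show ?case unfolding Wn_Suc W_def by blast
    qed (simp add: Wn_0)
    then show ?thesis using that unfolding W_def by blast
  qed
  have start: "y \<notin> X \<and> \<kappa> i y \<noteq> b" if "T j y \<in> S" "y \<in> space M" for y i
  proof -
    have "T j (T j y) \<noteq> T j y" "T j y \<in> X" "\<kappa> i (T j (T j y)) \<noteq> b"
      using that(1) unfolding S_def uncolored_def by auto
    then show ?thesis using T_bipartite[of y j] that(2) T_involution by simp
  qed
  have moves: "T i w \<in> X \<longleftrightarrow> w \<notin> X" if "w \<in> space M" "\<kappa> i w < d" for i w
    using partial_coloringD(3)[OF \<kappa> that] T_bipartite[OF that(1)] by blast
  have uniq: "i = i'" if "w \<in> space M" "\<kappa> i w = \<kappa> i' w" "\<kappa> i w < d" for i i' w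
    using partial_coloringD(4)[OF \<kappa> that] .
  \<comment> \<open>Edges in the direction of growth stay in \<open>W\<close> by construction. An
    edge against it has the color through which \<open>w\<close> was reached, and since a color
    occurs at most once at \<open>w\<close>, it leads back to the predecessor. Starting points have
    no such edge because they miss \<open>b\<close>.\<close>
  have W_closed: "T i w \<in> W" if w: "w \<in> W" and i: "\<kappa> i w = a \<or> \<kappa> i w = b" for w i
  proof (cases "w \<notin> X \<and> \<kappa> i w = a \<or> w \<in> X \<and> \<kappa> i w = b")
    case False
    have ws: "w \<in> space M" using W_space[OF w] .
    have "T j w \<notin> S" using start[of w i] ws i False by blast
    then obtain i' where i': "T i' w \<in> W" "T i' w \<notin> X \<and> \<kappa> i' w = a \<or> T i' w \<in> X \<and> \<kappa> i' w = b"
      using W_origin[OF w] by blast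
    then have "\<kappa> i' w < d" using ab by auto
    then have "\<kappa> i w = \<kappa> i' w" using i' moves[OF ws, of i'] i False by auto
    then have "i = i'" using uniq[OF ws] \<open>\<kappa> i' w < d\<close> by simp
    then show ?thesis using i' by simp
  qed (use W_step[OF w] in blast)
  have W_iff: "T i w \<in> W \<longleftrightarrow> w \<in> W" if "w \<in> space M" "\<kappa> i w = a \<or> \<kappa> i w = b" for i w
    using W_closed[of w i] W_closed[of "T i w" i] that partial_coloringD(2)[OF \<kappa> that(1), of i] T_involution by metis
  \<comment> \<open>A vertex of \<open>X\<close> can be reached only along color \<open>a\<close>,
    which the vertices of \<open>S\<close> miss.\<close>
  have SW: "x \<notin> W" if "x \<in> S" for x
  proof
    assume x: "x \<in> W"
    have xs: "x \<in> space M" "x \<in> X" "\<And>i. \<kappa> i x \<noteq> a" using that S_space unfolding S_def by auto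
    have "T j x \<notin> S" using start[of x] xs by blast
    then obtain i where "T i x \<in> X" "\<kappa> i x = b" using W_origin[OF x] xs(3) by blast
    then show False using moves[OF xs(1), of i] ab xs(2) by simp
  qed
  define swap where "swap c = (if c = a then b else if c = b then a else c)" for c
  have swap_d: "swap c = d \<longleftrightarrow> c = d" "swap c < d \<longleftrightarrow> c < d" "swap c \<le> d \<longleftrightarrow> c \<le> d" for c
    using ab by (auto simp: swap_def)
  have swap_inj: "swap c = swap c' \<longleftrightarrow> c = c'" for c c' by (auto simp: swap_def)
  have swap_a: "swap c = a \<longleftrightarrow> c = b" for c by (auto simp: swap_def)
  define \<kappa>\<^sub>1 where "\<kappa>\<^sub>1 i x = (if x \<in> W then swap (\<kappa> i x) else \<kappa> i x)" for i x
  define \<kappa>' where "\<kappa>' i x = (if i = j \<and> (x \<in> S \<or> T j x \<in> S) then a else \<kappa>\<^sub>1 i x)" for i x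
  have \<kappa>1_d: "\<kappa>\<^sub>1 i x = d \<longleftrightarrow> \<kappa> i x = d" "\<kappa>\<^sub>1 i x < d \<longleftrightarrow> \<kappa> i x < d" "\<kappa>\<^sub>1 i x \<le> d \<longleftrightarrow> \<kappa> i x \<le> d" for i x
    by (simp_all add: \<kappa>\<^sub>1_def swap_d)
  have \<kappa>1_T: "\<kappa>\<^sub>1 i (T i x) = \<kappa>\<^sub>1 i x" if "x \<in> space M" for i x
    using W_iff[OF that, of i] partial_coloringD(2)[OF \<kappa> that, of i]
    by (auto simp: \<kappa>\<^sub>1_def swap_def)
  have S_unc: "x \<in> uncolored \<kappa> j" if "x \<in> S \<or> T j x \<in> S" "x \<in> space M" for x
    using that partial_coloringD(2)[OF \<kappa> that(2), of j] T_involution[of j x]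
    unfolding S_def uncolored_def by auto
  \<comment> \<open>After the switch both ends miss \<open>a\<close>: the end in \<open>X\<close>
    lies outside \<open>W\<close> and is unchanged, while the other end has traded its missing color
    \<open>b\<close> for \<open>a\<close>.\<close>
  have special: "\<kappa>\<^sub>1 i x \<noteq> a" if "x \<in> S \<or> T j x \<in> S" "x \<in> space M" for i x
    using that(1)
  proof
    assume "x \<in> S"
    then show ?thesis using SW by (auto simp: \<kappa>\<^sub>1_def S_def)
  next
    assume T: "T j x \<in> S"
    then have "x \<in> Wn 0" using that(2) by (simp add: Wn_0)
    then have "x \<in> W" unfolding W_def by blast
    then show ?thesis using start[OF T that(2)] by (simp add: \<kappa>\<^sub>1_def swap_a)
  qed
  have "partial_coloring \<kappa>'"
    unfolding partial_coloring_def
  proof (intro conjI allI ballI impI)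
    fix i show "\<kappa>' i \<in> M \<rightarrow>\<^sub>M count_space UNIV"
      unfolding \<kappa>'_def \<kappa>\<^sub>1_def swap_def by measurable
  next
    fix i x assume x: "x \<in> space M"
    show "\<kappa>' i x \<le> d" using partial_coloringD(1)[OF \<kappa> x] ab by (simp add: \<kappa>'_def \<kappa>1_d)
    show "\<kappa>' i (T i x) = \<kappa>' i x" using \<kappa>1_T[OF x] T_involution by (auto simp: \<kappa>'_def)
    show "T i x \<noteq> x" if "\<kappa>' i x < d"
    proof (cases "i = j \<and> (x \<in> S \<or> T j x \<in> S)")
      case True
      then show ?thesis using S_unc[of x] x unfolding uncolored_def by blast
    next
      case False
      then have "\<kappa>' i x = \<kappa>\<^sub>1 i x" unfolding \<kappa>'_def by (rule if_not_P)
      then have "\<kappa> i x < d" using that by (simp add: \<kappa>1_d)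
      then show ?thesis using partial_coloringD(3)[OF \<kappa> x] by blast
    qed
  next
    fix i i' x assume x: "x \<in> space M" and ne: "i \<noteq> i'" and eq: "\<kappa>' i x = \<kappa>' i' x"
    show "\<kappa>' i x = d"
    proof (cases "x \<in> S \<or> T j x \<in> S")
      case False
      then have "\<kappa> i x = \<kappa> i' x" using eq by (auto simp: \<kappa>'_def \<kappa>\<^sub>1_def swap_inj split: if_splits)
      then have "\<kappa> i x = d" using uniq[OF x] ne partial_coloringD(1)[OF \<kappa> x, of i] by fastforce
      then show ?thesis using False by (simp add: \<kappa>'_def \<kappa>1_d)
    next
      case True
      have "i \<noteq> j" "i' \<noteq> j" using eq ne special[OF True x, of i] special[OF True x, of i'] True
        by (auto simp: \<kappa>'_def split: if_splits)
      then have "\<kappa> i x = \<kappa> i' x" using eq by (auto simp: \<kappa>'_def \<kappa>\<^sub>1_def swap_inj split: if_splits)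
      then have "\<kappa> i x = d" using uniq[OF x] ne partial_coloringD(1)[OF \<kappa> x, of i] by fastforce
      then show ?thesis using \<open>i \<noteq> j\<close> by (simp add: \<kappa>'_def \<kappa>1_d)
    qed
  qed
  moreover have "uncolored \<kappa>' j \<subseteq> uncolored \<kappa> j - S"
    using ab by (auto simp: uncolored_def \<kappa>'_def \<kappa>1_d split: if_splits)
  moreover have "\<forall>i. i \<noteq> j \<longrightarrow> uncolored \<kappa>' i = uncolored \<kappa> i"
    by (auto simp: uncolored_def \<kappa>'_def \<kappa>1_d)
  ultimately show ?thesis by blast
qed

text \<open>At most \<open>d\<close> matchings move \<open>x\<close>, and \<open>j\<close> is one of
  them without using a color, so at most \<open>d - 1\<close> colors occur at
  \<open>x\<close>.\<close>

lemma missing_color: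
  assumes \<kappa>: "partial_coloring \<kappa>" and x: "x \<in> uncolored \<kappa> j"
  shows "\<exists>a<d. \<forall>i. \<kappa> i x \<noteq> a"
proof (rule ccontr)
  assume contr: "\<not> ?thesis"
  have xs: "x \<in> space M" "j \<in> {i. T i x \<noteq> x}" "\<kappa> j x = d" using x by (auto simp: uncolored_def)
  have fin: "finite {i. T i x \<noteq> x}" and le: "card {i. T i x \<noteq> x} \<le> d" using T_degree[OF xs(1)] by auto
  have "{..<d} \<subseteq> (\<lambda>i. \<kappa> i x) ` ({i. T i x \<noteq> x} - {j})"
  proof
    fix a assume "a \<in> {..<d}"
    then obtain i where "\<kappa> i x = a" "a < d" using contr by auto
    then show "a \<in> (\<lambda>i. \<kappa> i x) ` ({i. T i x \<noteq> x} - {j})"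
      using partial_coloringD(3)[OF \<kappa> xs(1), of i] xs(3) by auto
  qed
  then have "d \<le> card ((\<lambda>i. \<kappa> i x) ` ({i. T i x \<noteq> x} - {j}))"
    using fin by (metis card_lessThan card_mono finite_Diff finite_imageI)
  also have "\<dots> \<le> card ({i. T i x \<noteq> x} - {j})" using fin by (intro card_image_le) simp
  also have "\<dots> < card {i. T i x \<noteq> x}" using fin xs(2) by (rule card_Diff1_less)
  finally show False using le by simp
qed

text \<open>The factor \<open>2\<close> arises because \<open>T j\<close> exchanges the uncolored
  ends in \<open>X\<close> with those outside and preserves measure; \<open>d ^ 2\<close> is the
  number of pairs of missing colors, one of which has at least average measure.\<close>

lemma large_augmentable_set:
  assumes \<kappa>: "partial_coloring \<kappa>" and pos: "measure M (uncolored \<kappa> j) > 0"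
  shows "\<exists>a b. a < d \<and> b < d \<and> measure M (uncolored \<kappa> j) \<le>
    2 * real d ^ 2 * measure M (augmentable \<kappa> j a b)"
proof -
  have \<kappa>_meas[measurable]: "\<kappa> j \<in> M \<rightarrow>\<^sub>M count_space UNIV" for j
    using \<kappa> by (rule partial_coloring_measurable)
  note unc[measurable] = uncolored_measurable[OF \<kappa>]
  define S where "S = augmentable \<kappa> j"
  have S_meas[measurable]: "S a b \<in> sets M" for a b unfolding S_def by (rule augmentable_measurable[OF \<kappa>])
  have T_unc: "T j x \<in> uncolored \<kappa> j \<longleftrightarrow> x \<in> uncolored \<kappa> j" if "x \<in> space M" for x
    using partial_coloringD(2)[OF \<kappa> that, of j] T_involution[of j x] T_in_space[OF that, of j] that
    by (auto simp: uncolored_def)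
  have "uncolored \<kappa> j - X = T j -` (uncolored \<kappa> j \<inter> X) \<inter> space M"
    using T_unc T_bipartite[of _ j] unfolding uncolored_def by blast
  then have "measure M (uncolored \<kappa> j - X) = measure M (uncolored \<kappa> j \<inter> X)"
    using measure_preimage[of "uncolored \<kappa> j \<inter> X" j] unc by simp
  moreover have "measure M (uncolored \<kappa> j) = measure M (uncolored \<kappa> j \<inter> X) + measure M (uncolored \<kappa> j - X)"
  proof -
    have "uncolored \<kappa> j = (uncolored \<kappa> j \<inter> X) \<union> (uncolored \<kappa> j - X)" by blast
    then show ?thesis using finite_measure_Union[of "uncolored \<kappa> j \<inter> X" "uncolored \<kappa> j - X"] unc X_measurable
      by (metis Diff_disjoint Int_Diff inf_commute inf_left_idem sets.Diff sets.Int)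
  qed
  ultimately have two: "measure M (uncolored \<kappa> j) = 2 * measure M (uncolored \<kappa> j \<inter> X)" by simp
  have "uncolored \<kappa> j \<inter> X \<subseteq> (\<Union>p\<in>{..<d} \<times> {..<d}. S (fst p) (snd p))"
  proof
    fix x assume x: "x \<in> uncolored \<kappa> j \<inter> X"
    then have "x \<in> space M" by (auto simp: uncolored_def)
    then have "T j x \<in> uncolored \<kappa> j" using x T_unc by blast
    then obtain a b where "a < d" "b < d" "\<forall>i. \<kappa> i x \<noteq> a" "\<forall>i. \<kappa> i (T j x) \<noteq> b"
      using missing_color[OF \<kappa>] x by blast
    then have "(a, b) \<in> {..<d} \<times> {..<d}" "x \<in> S a b" using x unfolding S_def augmentable_def by auto
    then show "x \<in> (\<Union>p\<in>{..<d} \<times> {..<d}. S (fst p) (snd p))" by force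
  qed
  then have "measure M (uncolored \<kappa> j \<inter> X) \<le> measure M (\<Union>p\<in>{..<d} \<times> {..<d}. S (fst p) (snd p))"
    by (intro finite_measure_mono) auto
  also have "\<dots> \<le> (\<Sum>p\<in>{..<d} \<times> {..<d}. measure M (S (fst p) (snd p)))"
    by (intro finite_measure_subadditive_finite) auto
  finally have le: "measure M (uncolored \<kappa> j \<inter> X) \<le> (\<Sum>p\<in>{..<d} \<times> {..<d}. measure M (S (fst p) (snd p)))" .
  have "\<exists>p\<in>{..<d} \<times> {..<d}. measure M (uncolored \<kappa> j) \<le> 2 * real d ^ 2 * measure M (S (fst p) (snd p))"
  proof (rule ccontr)
    assume "\<not> ?thesis"
    then have "2 * real d ^ 2 * measure M (S (fst p) (snd p)) \<le> measure M (uncolored \<kappa> j)"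
      and less: "2 * real d ^ 2 * measure M (S (fst p) (snd p)) < measure M (uncolored \<kappa> j)"
      if "p \<in> {..<d} \<times> {..<d}" for p using that by force+
    have "d > 0"
    proof (rule ccontr)
      assume "\<not> d > 0"
      then show False using le two pos by simp
    qed
    then have "(\<Sum>p\<in>{..<d} \<times> {..<d}. 2 * real d ^ 2 * measure M (S (fst p) (snd p)))
        < (\<Sum>p\<in>{..<d} \<times> {..<d}. measure M (uncolored \<kappa> j))"
      using less by (intro sum_strict_mono) auto
    also have "\<dots> = real d ^ 2 * (2 * measure M (uncolored \<kappa> j \<inter> X))"
      using two by (simp add: power2_eq_square)
    also have "\<dots> \<le> 2 * real d ^ 2 * (\<Sum>p\<in>{..<d} \<times> {..<d}. measure M (S (fst p) (snd p)))"
      using le by (simp add: mult_left_mono)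
    finally show False by (simp add: sum_distrib_left)
  qed
  then show ?thesis unfolding S_def by force
qed

text \<open>If the infimum \<open>c\<close> were positive, a coloring within \<open>\<delta>\<close>
  of it would have a matching among the first \<open>n\<close> that is far from fully colored. One
  augmentation there gains at least \<open>\<delta>\<close> and leaves the other terms unchanged,
  which falls below the infimum.\<close>

lemma approximate_coloring:
  assumes "\<epsilon> > 0"
  shows "\<exists>\<kappa>. partial_coloring \<kappa> \<and> (\<Sum>j<n. measure M (uncolored \<kappa> j)) < \<epsilon>"
proof (rule ccontr)
  assume contr: "\<not> ?thesis"
  define u where "u \<kappa> = (\<Sum>j<n. measure M (uncolored \<kappa> j))" for \<kappa>
  define C where "C = u ` {\<kappa>. partial_coloring \<kappa>}"
  define c where "c = Inf C"
  have "partial_coloring (\<lambda>_ _. d)" unfolding partial_coloring_def by simp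
  then have "C \<noteq> {}" unfolding C_def by blast
  have ge: "\<epsilon> \<le> u \<kappa>" if "partial_coloring \<kappa>" for \<kappa> using contr that unfolding u_def by force
  have "\<epsilon> \<le> c" unfolding c_def using \<open>C \<noteq> {}\<close> ge by (intro cInf_greatest) (auto simp: C_def)
  then have "c > 0" using assms by simp
  have bdd: "bdd_below C" using ge unfolding C_def by (intro bdd_belowI[of _ \<epsilon>]) auto
  \<comment> \<open>Some matching has uncolored measure at least \<open>c / (n + 1)\<close>, and a
    fraction \<open>1 / (2 d ^ 2)\<close> of it can be augmented. Using \<open>n + 1\<close> and
    \<open>d + 1\<close> avoids zero denominators and makes the first bound available by a strict
    inequality.\<close>
  define \<delta> where "\<delta> = c / real (n + 1) / (2 * real (d + 1) ^ 2)"
  have "\<delta> > 0" unfolding \<delta>_def using \<open>c > 0\<close> by simp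
  then obtain \<kappa> where \<kappa>: "partial_coloring \<kappa>" "u \<kappa> < c + \<delta>"
    using cInf_lessD[OF \<open>C \<noteq> {}\<close>, of "c + \<delta>"] unfolding c_def[symmetric] by (auto simp: C_def)
  have "c \<le> u \<kappa>" unfolding c_def using \<kappa>(1) bdd by (intro cInf_lower) (auto simp: C_def)
  have "\<exists>j<n. c / real (n + 1) \<le> measure M (uncolored \<kappa> j)"
  proof (rule ccontr)
    assume "\<not> ?thesis"
    then have "u \<kappa> \<le> (\<Sum>j<n. c / real (n + 1))" unfolding u_def by (intro sum_mono) force
    also have "\<dots> = c * (real n / real (n + 1))" by simp
    also have "\<dots> < c * 1" using \<open>c > 0\<close> by (intro mult_strict_left_mono) auto
    finally show False using \<open>c \<le> u \<kappa>\<close> by simp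
  qed
  then obtain j where j: "j < n" "c / real (n + 1) \<le> measure M (uncolored \<kappa> j)" by blast
  have "measure M (uncolored \<kappa> j) > 0" using j(2) \<open>c > 0\<close> by (smt (verit) divide_pos_pos of_nat_0_less_iff zero_less_Suc Suc_eq_plus1)
  then obtain a b where ab: "a < d" "b < d" "measure M (uncolored \<kappa> j) \<le>
    2 * real d ^ 2 * measure M (augmentable \<kappa> j a b)"
    using large_augmentable_set[OF \<kappa>(1)] by blast
  define S where "S = augmentable \<kappa> j a b"
  have "c / real (n + 1) \<le> 2 * real (d + 1) ^ 2 * measure M S"
  proof -
    have "2 * real d ^ 2 * measure M S \<le> 2 * real (d + 1) ^ 2 * measure M S"
      by (intro mult_right_mono mult_left_mono power_mono) auto
    then show ?thesis using ab(3) j(2) unfolding S_def by linarith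
  qed
  then have S: "\<delta> \<le> measure M S" unfolding \<delta>_def by (subst pos_divide_le_eq) (auto simp: mult.commute)
  obtain \<kappa>' where \<kappa>': "partial_coloring \<kappa>'" "uncolored \<kappa>' j \<subseteq> uncolored \<kappa> j - S"
    "\<And>i. i \<noteq> j \<Longrightarrow> uncolored \<kappa>' i = uncolored \<kappa> i"
    using augment_coloring[OF \<kappa>(1) ab(1,2), of j] unfolding S_def by blast
  have Sm: "S \<in> sets M" unfolding S_def by (rule augmentable_measurable[OF \<kappa>(1)])
  have "measure M (uncolored \<kappa>' j) \<le> measure M (uncolored \<kappa> j - S)"
    using \<kappa>'(2) Sm uncolored_measurable[OF \<kappa>(1)] by (intro finite_measure_mono) auto
  also have "\<dots> = measure M (uncolored \<kappa> j) - measure M S"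
    using Sm uncolored_measurable[OF \<kappa>(1)] by (intro finite_measure_Diff) (auto simp: S_def augmentable_def)
  finally have "measure M (uncolored \<kappa>' j) \<le> measure M (uncolored \<kappa> j) - \<delta>" using S by simp
  moreover have "u \<kappa> = measure M (uncolored \<kappa> j) + (\<Sum>i\<in>{..<n} - {j}. measure M (uncolored \<kappa> i))"
    unfolding u_def using j(1) by (intro sum.remove) auto
  moreover have "u \<kappa>' = measure M (uncolored \<kappa>' j) + (\<Sum>i\<in>{..<n} - {j}. measure M (uncolored \<kappa>' i))"
    unfolding u_def using j(1) by (intro sum.remove) auto
  moreover have "(\<Sum>i\<in>{..<n} - {j}. measure M (uncolored \<kappa>' i)) = (\<Sum>i\<in>{..<n} - {j}. measure M (uncolored \<kappa> i))"
    using \<kappa>'(3) by (intro sum.cong) auto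
  ultimately have "u \<kappa>' < c" using \<kappa>(2) by linarith
  moreover have "c \<le> u \<kappa>'" unfolding c_def using \<kappa>'(1) bdd by (intro cInf_lower) (auto simp: C_def)
  ultimately show False by simp
qed

end

section \<open>Limits of random labelings\<close>

lemma compact_unit_cube: "compact {f :: 'i \<Rightarrow> real. \<forall>i. f i \<in> {0..1}}"
proof -
  have "compactin (product_topology (\<lambda>i::'i. euclidean) UNIV) (PiE UNIV (\<lambda>i. {0..1::real}))"
    by (subst compactin_PiE) auto
  moreover have "PiE UNIV (\<lambda>i. {0..1::real}) = {f :: 'i \<Rightarrow> real. \<forall>i. f i \<in> {0..1}}"
    by (auto simp: PiE_def)
  ultimately show ?thesis by (simp add: euclidean_product_topology)
qed

text \<open>A cluster point \<open>L\<close> exists by compactness of the cube, and \<open>G\<close>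
  consists of the indices at which \<open>h\<close> is close to \<open>L\<close>. A filter is used
  in place of a subsequence because the index set may be uncountable.\<close>

lemma pointwise_limit_along_filter:
  fixes h :: "nat \<Rightarrow> 'i \<Rightarrow> real"
  assumes "\<And>k i. h k i \<in> {0..1}"
  shows "\<exists>G L. G \<noteq> bot \<and> G \<le> sequentially \<and> (\<forall>i. ((\<lambda>k. h k i) \<longlongrightarrow> L i) G)"
proof -
  have "filtermap h sequentially \<noteq> bot" by (simp add: filtermap_bot_iff)
  moreover have "eventually (\<lambda>f. f \<in> {f. \<forall>i. f i \<in> {0..1}}) (filtermap h sequentially)"
    using assms by (simp add: eventually_filtermap)
  ultimately obtain L where L: "inf (nhds L) (filtermap h sequentially) \<noteq> bot"
    using compact_unit_cube unfolding compact_filter by blast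
  define G where "G = inf (filtercomap h (nhds L)) sequentially"
  have "G \<noteq> bot"
  proof
    assume "G = bot"
    then have "eventually (\<lambda>_. False) G" by simp
    then obtain P Q where P: "eventually P (filtercomap h (nhds L))" and Q: "eventually Q sequentially"
      and PQ: "\<And>k. P k \<Longrightarrow> Q k \<Longrightarrow> False"
      unfolding G_def eventually_inf by auto
    obtain R where R: "eventually R (nhds L)" "\<And>k. R (h k) \<Longrightarrow> P k"
      using P unfolding eventually_filtercomap by auto
    have "eventually (\<lambda>f. \<exists>k. Q k \<and> f = h k) (filtermap h sequentially)"
      unfolding eventually_filtermap using Q by eventually_elim auto
    then have "eventually (\<lambda>_. False) (inf (nhds L) (filtermap h sequentially))"
      unfolding eventually_inf using R PQ by (intro exI[of _ R] exI[of _ "\<lambda>f. \<exists>k. Q k \<and> f = h k"]) auto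
    then show False using L by (simp add: trivial_limit_def)
  qed
  moreover have "G \<le> sequentially" unfolding G_def by simp
  moreover have "((\<lambda>k. h k i) \<longlongrightarrow> L i) G" for i
  proof -
    have "continuous_on UNIV (\<lambda>f::'i \<Rightarrow> real. f i)" by (rule continuous_on_product_coordinates)
    then have "((\<lambda>f. f i) \<longlongrightarrow> L i) (at L)" by (simp add: continuous_on_def)
    then have c: "((\<lambda>f. f i) \<longlongrightarrow> L i) (nhds L)"
      using tendsto_at_iff_tendsto_nhds[of "\<lambda>f. f i" L] by simp
    have "filterlim h (nhds L) (filtercomap h (nhds L))" by (rule filterlim_filtercomap)
    then have "filterlim h (nhds L) G" unfolding G_def by (rule filterlim_mono) simp_all
    then show ?thesis by (rule filterlim_compose[OF c])
  qed
  ultimately show ?thesis by blast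
qed

section \<open>Labeled vertices and cylinder sets\<close>

abbreviation seqM :: "(nat \<Rightarrow> nat) measure" where
  "seqM \<equiv> PiM UNIV (\<lambda>_. count_space UNIV)"

abbreviation labeled :: "'a measure \<Rightarrow> ('a \<times> (nat \<Rightarrow> nat)) measure" where
  "labeled M \<equiv> M \<Otimes>\<^sub>M seqM"

lemma space_seqM[simp]: "space seqM = UNIV"
  by (simp add: space_PiM PiE_def)

text \<open>Finite dependence concerns the label only; the vertex may enter in any jointly
  measurable way.\<close>

definition cylinder :: "'a measure \<Rightarrow> nat \<Rightarrow> ('a \<times> (nat \<Rightarrow> nat)) set \<Rightarrow> bool" where
  "cylinder M m Z \<longleftrightarrow> Z \<in> sets (labeled M) \<and>
     (\<forall>x s t. (\<forall>i<m. s i = t i) \<longrightarrow> (x, s) \<in> Z \<longrightarrow> (x, t) \<in> Z)"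

lemma cylinderI:
  assumes "Z \<in> sets (labeled M)" "\<And>x s t. \<forall>i<m. s i = t i \<Longrightarrow> (x, s) \<in> Z \<Longrightarrow> (x, t) \<in> Z"
  shows "cylinder M m Z"
  using assms unfolding cylinder_def by blast

lemma cylinder_sets: "cylinder M m Z \<Longrightarrow> Z \<in> sets (labeled M)"
  unfolding cylinder_def by blast

lemma cylinder_cong: "cylinder M m Z \<Longrightarrow> \<forall>i<m. s i = t i \<Longrightarrow> (x, s) \<in> Z \<Longrightarrow> (x, t) \<in> Z"
  unfolding cylinder_def by blast

lemma cylinder_mono:
  assumes "cylinder M m Z" "m \<le> m'" shows "cylinder M m' Z"
proof (rule cylinderI[OF cylinder_sets[OF assms(1)]])
  fix x and s t :: "nat \<Rightarrow> nat" assume "\<forall>i<m'. s i = t i" and Z: "(x, s) \<in> Z"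
  then have "\<forall>i<m. s i = t i" using assms(2) by auto
  then show "(x, t) \<in> Z" using Z by (rule cylinder_cong[OF assms(1)])
qed

lemma cylinder_Un:
  assumes "cylinder M m Z" "cylinder M m' Z'" shows "cylinder M (max m m') (Z \<union> Z')"
proof -
  have *: "cylinder M (max m m') Z" "cylinder M (max m m') Z'" using assms cylinder_mono by (meson max.cobounded1 max.cobounded2)+
  show ?thesis
  proof (rule cylinderI)
    fix x and s t :: "nat \<Rightarrow> nat" assume "\<forall>i<max m m'. s i = t i" and Z: "(x, s) \<in> Z \<union> Z'"
    then show "(x, t) \<in> Z \<union> Z'" using cylinder_cong[OF *(1)] cylinder_cong[OF *(2)] by blast
  qed (use assms cylinder_sets in blast)
qed

lemma cylinder_Diff:
  assumes "cylinder M m Z" shows "cylinder M m (space M \<times> UNIV - Z)"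
proof (rule cylinderI)
  have "space (labeled M) - Z \<in> sets (labeled M)" using cylinder_sets[OF assms] by blast
  then show "space M \<times> UNIV - Z \<in> sets (labeled M)" by (simp add: space_pair_measure)
  fix x and s t :: "nat \<Rightarrow> nat" assume eq: "\<forall>i<m. s i = t i" and Z: "(x, s) \<in> space M \<times> UNIV - Z"
  have "\<forall>i<m. t i = s i" using eq by simp
  then show "(x, t) \<in> space M \<times> UNIV - Z" using Z cylinder_cong[OF assms] by blast
qed

lemma algebra_cylinders: "algebra (space M \<times> UNIV) {Z. \<exists>m. cylinder M m Z}"
  unfolding algebra_iff_Un
proof (intro conjI ballI)
  show "{Z. \<exists>m. cylinder M m Z} \<subseteq> Pow (space M \<times> UNIV)"
    using sets.sets_into_space[OF cylinder_sets] by (fastforce simp: space_pair_measure)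
  show "{} \<in> {Z. \<exists>m. cylinder M m Z}" by (auto simp: cylinder_def)
qed (auto intro: cylinder_Diff cylinder_Un)

text \<open>The vertex and every single label entry are measurable for the sigma algebra generated
  by cylinders, hence so is the identity into the product.\<close>

lemma sigma_sets_cylinders:
  "sigma_sets (space M \<times> UNIV) {Z. \<exists>m. cylinder M m Z} = sets (labeled M)"
proof
  have sp: "space M \<times> UNIV = space (labeled M)" by (simp add: space_pair_measure)
  show "sigma_sets (space M \<times> UNIV) {Z. \<exists>m. cylinder M m Z} \<subseteq> sets (labeled M)"
    unfolding sp by (rule sets.sigma_sets_subset) (auto dest: cylinder_sets)
  define N where "N = sigma (space M \<times> UNIV) {Z. \<exists>m. cylinder M m Z}"
  have sub: "{Z. \<exists>m. cylinder M m Z} \<subseteq> Pow (space M \<times> UNIV)"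
    using algebra_cylinders unfolding algebra_iff_Un by blast
  have N: "space N = space M \<times> UNIV" "sets N = sigma_sets (space M \<times> UNIV) {Z. \<exists>m. cylinder M m Z}"
    unfolding N_def using sub by (simp_all add: space_measure_of sets_measure_of)
  have cyl: "Z \<in> sets N" if "cylinder M m Z" for m Z using that unfolding N(2) by (blast intro: sigma_sets.Basic)
  have "(\<lambda>p. (fst p, snd p)) \<in> N \<rightarrow>\<^sub>M labeled M"
  proof (rule measurable_Pair)
    show "fst \<in> N \<rightarrow>\<^sub>M M"
    proof (rule measurableI)
      fix A assume A: "A \<in> sets M"
      have "fst -` A \<inter> space N = A \<times> UNIV" using sets.sets_into_space[OF A] N(1) by auto
      moreover have "cylinder M 0 (A \<times> UNIV)"
        using A sets.top[of seqM] by (intro cylinderI) auto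
      ultimately show "fst -` A \<inter> space N \<in> sets N" using cyl by simp
    qed (auto simp: N)
    show "snd \<in> N \<rightarrow>\<^sub>M seqM"
    proof (rule measurable_PiM_single')
      fix n :: nat
      show "(\<lambda>p. snd p n) \<in> N \<rightarrow>\<^sub>M count_space UNIV"
      proof (rule measurableI)
        fix A :: "nat set"
        have "(\<lambda>p. snd p n) \<in> labeled M \<rightarrow>\<^sub>M count_space UNIV" by measurable
        from measurable_sets[OF this, of A]
        have "{p\<in>space (labeled M). snd p n \<in> A} \<in> sets (labeled M)"
          by (simp add: vimage_def Int_def conj_commute)
        then have "cylinder M (Suc n) {p\<in>space (labeled M). snd p n \<in> A}"
          by (rule cylinderI) (auto simp: space_pair_measure)
        moreover have "(\<lambda>p. snd p n) -` A \<inter> space N = {p\<in>space (labeled M). snd p n \<in> A}"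
          using N(1) by (auto simp: space_pair_measure)
        ultimately show "(\<lambda>p. snd p n) -` A \<inter> space N \<in> sets N" using cyl by simp
      qed simp
    qed auto
  qed
  then have id: "(\<lambda>p. p) \<in> N \<rightarrow>\<^sub>M labeled M" by simp
  show "sets (labeled M) \<subseteq> sigma_sets (space M \<times> UNIV) {Z. \<exists>m. cylinder M m Z}"
  proof
    fix A assume A: "A \<in> sets (labeled M)"
    have "(\<lambda>p. p) -` A \<inter> space N = A"
      using sets.sets_into_space[OF A] N(1) by (auto simp: space_pair_measure)
    then show "A \<in> sigma_sets (space M \<times> UNIV) {Z. \<exists>m. cylinder M m Z}"
      using measurable_sets[OF id A] N(2) by simp
  qed
qed

text \<open>Frequencies of cylinders converge along a filter to an additive set function, which
  Caratheodory's theorem extends. Continuity at the empty set can be transferred to \<open>M\<close>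
  because the vertex always has law \<open>M\<close> and the labels are bounded.\<close>

lemma (in prob_space) limit_joining:
  assumes g[measurable]: "\<And>k. g k \<in> M \<rightarrow>\<^sub>M seqM" and bound: "\<And>k x n. x \<in> space M \<Longrightarrow> g k x n \<le> b"
  shows "\<exists>N G. prob_space N \<and> sets N = sets (labeled M) \<and> G \<noteq> bot \<and> G \<le> sequentially \<and>
    (\<forall>m Z. cylinder M m Z \<longrightarrow> ((\<lambda>k. measure M {x\<in>space M. (x, g k x) \<in> Z}) \<longlongrightarrow> measure N Z) G)"
proof -
  let ?\<Omega> = "space M \<times> (UNIV :: (nat \<Rightarrow> nat) set)"
  let ?\<Z> = "{Z. \<exists>m. cylinder M m Z}"
  define h where "h k Z = measure M {x\<in>space M. (x, g k x) \<in> Z}" for k Z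
  have "h k Z \<in> {0..1}" for k Z unfolding h_def by simp
  then obtain G L where G: "G \<noteq> bot" "G \<le> sequentially" and L: "\<And>Z. ((\<lambda>k. h k Z) \<longlongrightarrow> L Z) G"
    using pointwise_limit_along_filter[of h] by blast
  have meas: "{x\<in>space M. (x, g k x) \<in> Z} \<in> sets M" if "cylinder M m Z" for k m Z
    using cylinder_sets[OF that] by measurable
  interpret algebra ?\<Omega> ?\<Z> by (rule algebra_cylinders)
  have L_nonneg: "L Z \<ge> 0" for Z
    by (rule tendsto_lowerbound[OF L _ G(1)]) (simp add: h_def)
  have L_empty: "L {} = 0"
    by (rule tendsto_unique[OF G(1) L]) (simp add: h_def)
  have L_add: "L (A \<union> B) = L A + L B" if "A \<in> ?\<Z>" "B \<in> ?\<Z>" "A \<inter> B = {}" for A B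
  proof (rule tendsto_unique[OF G(1) L])
    have "h k (A \<union> B) = h k A + h k B" for k
    proof -
      have "{x\<in>space M. (x, g k x) \<in> A \<union> B} = {x\<in>space M. (x, g k x) \<in> A} \<union> {x\<in>space M. (x, g k x) \<in> B}"
        by auto
      moreover have "{x\<in>space M. (x, g k x) \<in> A} \<inter> {x\<in>space M. (x, g k x) \<in> B} = {}" using that(3) by auto
      ultimately show ?thesis unfolding h_def using that meas by (auto intro!: finite_measure_Union)
    qed
    then show "((\<lambda>k. h k (A \<union> B)) \<longlongrightarrow> L A + L B) G" using tendsto_add[OF L L] by simp
  qed
  \<comment> \<open>The vertices that admit a bounded label in \<open>A i\<close> form sets
    \<open>P i\<close>. They decrease to the empty set by Koenig's lemma, and their measures
    dominate the limits \<open>L (A i)\<close>.\<close>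
  have cont: "(\<lambda>i. ennreal (L (A i))) \<longlonglongrightarrow> 0"
    if A: "range A \<subseteq> ?\<Z>" "decseq A" "(\<Inter>i. A i) = {}" for A
  proof -
    have "\<forall>i. \<exists>m. cylinder M m (A i)" using A(1) by blast
    from choice[OF this] obtain m where cyl: "\<And>i. cylinder M (m i) (A i)" by blast
    define P where "P i = {x\<in>space M. \<exists>s. (\<forall>n. s n \<le> b) \<and> (x, s) \<in> A i}" for i
    \<comment> \<open>Since \<open>A i\<close> reads \<open>m i\<close> entries, padded prefixes
      suffice as witnesses; the union is then countable and \<open>P i\<close> measurable.\<close>
    have P_alt: "P i = (\<Union>l\<in>{l. \<forall>n. seq_of l n \<le> b}. {x\<in>space M. (x, seq_of l) \<in> A i})" for i
    proof (intro set_eqI iffI)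
      fix x assume "x \<in> P i"
      then obtain s where s: "x \<in> space M" "\<forall>n. s n \<le> b" "(x, s) \<in> A i" unfolding P_def by blast
      have "(x, seq_of (map s [0..<m i])) \<in> A i"
        by (rule cylinder_cong[OF cyl _ s(3)]) (simp add: seq_of_map)
      moreover have "\<forall>n. seq_of (map s [0..<m i]) n \<le> b" using s(2) by (simp add: seq_of_map)
      ultimately show "x \<in> (\<Union>l\<in>{l. \<forall>n. seq_of l n \<le> b}. {x\<in>space M. (x, seq_of l) \<in> A i})"
        using s(1) by blast
    qed (auto simp: P_def)
    have P_meas: "P i \<in> sets M" for i
      unfolding P_alt
    proof (intro sets.countable_UN'[OF countableI_type] image_subsetI)
      fix l
      have "(\<lambda>x. (x, seq_of l)) -` A i \<inter> space M \<in> sets M"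
        using measurable_sets[OF measurable_Pair2' cylinder_sets[OF cyl]] by simp
      moreover have "(\<lambda>x. (x, seq_of l)) -` A i \<inter> space M = {x\<in>space M. (x, seq_of l) \<in> A i}" by auto
      ultimately show "{x\<in>space M. (x, seq_of l) \<in> A i} \<in> sets M" by simp
    qed
    have "decseq P" using A(2) unfolding decseq_def P_def by blast
    have "x \<notin> (\<Inter>i. P i)" for x
    proof
      assume x: "x \<in> (\<Inter>i. P i)"
      have "\<exists>\<sigma>. (\<forall>i. \<sigma> i \<le> b) \<and> (\<forall>k. (x, \<sigma>) \<in> A k)"
      proof (rule koenig_sequences[where m = m])
        show "(x, \<tau>) \<in> A k" if "\<forall>i<m k. \<sigma> i = \<tau> i" "(x, \<sigma>) \<in> A k" for k \<sigma> \<tau>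
          using cylinder_cong[OF cyl that] .
        fix n
        obtain \<sigma> where "\<forall>i. \<sigma> i \<le> b" "(x, \<sigma>) \<in> A n" using x unfolding P_def by blast
        then show "\<exists>\<sigma>. (\<forall>i. \<sigma> i \<le> b) \<and> (\<forall>k\<le>n. (x, \<sigma>) \<in> A k)"
          using A(2) unfolding decseq_def by blast
      qed
      then show False using A(3) by blast
    qed
    then have "(\<Inter>i. P i) = {}" by blast
    then have lim: "(\<lambda>i. emeasure M (P i)) \<longlonglongrightarrow> 0"
      using Lim_emeasure_decseq[of P M] P_meas \<open>decseq P\<close> by auto
    have "ennreal (L (A i)) \<le> emeasure M (P i)" for i
    proof -
      have "h k (A i) \<le> measure M (P i)" for k
        unfolding h_def
      proof (rule finite_measure_mono[OF _ P_meas], rule subsetI)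
        fix x assume "x \<in> {x\<in>space M. (x, g k x) \<in> A i}"
        then show "x \<in> P i" using bound unfolding P_def by (auto intro!: exI[of _ "g k x"])
      qed
      then have "L (A i) \<le> measure M (P i)"
        by (intro tendsto_upperbound[OF L _ G(1)]) simp
      then show ?thesis unfolding emeasure_eq_measure by (rule ennreal_leI)
    qed
    then show ?thesis by (intro tendsto_sandwich[OF _ _ tendsto_const lim]) auto
  qed
  have "\<exists>\<mu> :: ('a \<times> (nat \<Rightarrow> nat)) set \<Rightarrow> ennreal. (\<forall>s\<in>?\<Z>. \<mu> s = ennreal (L s)) \<and>
      measure_space ?\<Omega> (sigma_sets ?\<Omega> ?\<Z>) \<mu>"
  proof (rule caratheodory_empty_continuous)
    show "positive ?\<Z> (\<lambda>Z. ennreal (L Z))" by (simp add: positive_def L_empty)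
    show "additive ?\<Z> (\<lambda>Z. ennreal (L Z))"
      unfolding additive_def using L_add L_nonneg by (simp add: ennreal_plus[symmetric] del: ennreal_plus)
  qed (use cont in auto)
  then obtain \<mu> where \<mu>: "\<And>Z. Z \<in> ?\<Z> \<Longrightarrow> \<mu> Z = ennreal (L Z)" and ms: "measure_space ?\<Omega> (sigma_sets ?\<Omega> ?\<Z>) \<mu>"
    by blast
  define N where "N = measure_of ?\<Omega> ?\<Z> \<mu>"
  have sets_N: "sets N = sigma_sets ?\<Omega> ?\<Z>" and space_N: "space N = ?\<Omega>"
    unfolding N_def using space_closed by (simp_all add: sets_measure_of space_measure_of)
  have em: "emeasure N Z = ennreal (L Z)" if "cylinder M m Z" for m Z
  proof -
    have Z: "Z \<in> ?\<Z>" using that by blast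
    have "emeasure N Z = \<mu> Z"
      using ms space_closed Z unfolding measure_space_def
      by (intro emeasure_measure_of[OF N_def]) (auto simp: sets_N intro: sigma_sets.Basic)
    then show ?thesis using \<mu>[OF Z] by simp
  qed
  have full: "cylinder M 0 ?\<Omega>"
    using sets.top[of "labeled M"] by (intro cylinderI) (auto simp: space_pair_measure)
  have "L ?\<Omega> = 1"
    by (rule tendsto_unique[OF G(1) L]) (simp add: h_def prob_space)
  then have "prob_space N" using em[OF full] space_N by (intro prob_spaceI) simp
  moreover have "measure N Z = L Z" if "cylinder M m Z" for m Z
    using em[OF that] L_nonneg by (simp add: measure_def)
  ultimately show ?thesis
    using G L sets_N unfolding sigma_sets_cylinders h_def
    by (intro exI[of _ N] exI[of _ G]) auto
qed

section \<open>An invariant random edge coloring\<close>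

text \<open>Sequences of naturals with discrete coordinates form a Polish space, so the product
  topology is Polish. Its countable base of measurable rectangles identifies its Borel sets with the
  product sigma algebra.\<close>

lemma standard_borel_product:
  fixes M :: "'a measure" and N :: "('a \<times> (nat \<Rightarrow> nat)) measure"
  assumes "standard_borel M" and N: "sets N = sets (labeled M)"
  shows "standard_borel N"
proof -
  obtain T where T: "completely_metrizable_space T" "separable_space T" "topspace T = space M"
    "sets M = sigma_sets (space M) {U. openin T U}"
    using assms unfolding standard_borel_def by auto
  have met: "metrizable_space T" using T(1) by (rule completely_metrizable_imp_metrizable_space)
  from countable_open_base[OF met T(2)]
  obtain U :: "nat \<Rightarrow> 'a set" where U': "\<forall>n. openin T (U n)"
    "\<forall>V x. openin T V \<longrightarrow> x \<in> V \<longrightarrow> (\<exists>n. x \<in> U n \<and> U n \<subseteq> V)"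
    by (elim exE conjE) (rule that)
  note U = U'[rule_format]
  define S :: "(nat \<Rightarrow> nat) topology" where "S = product_topology (\<lambda>_. discrete_topology UNIV) UNIV"
  define P where "P = prod_topology T S"
  have topS: "topspace S = UNIV" by (simp add: S_def PiE_def)
  have topP: "topspace P = space N"
    using sets_eq_imp_space_eq[OF N] T(3) topS by (simp add: P_def space_pair_measure)
  have "completely_metrizable_space S"
    unfolding S_def completely_metrizable_space_product_topology
    by (simp add: completely_metrizable_space_discrete_topology)
  then have cP: "completely_metrizable_space P"
    unfolding P_def completely_metrizable_space_prod_topology using T(1) by simp
  define cyl where "cyl l = {s :: nat \<Rightarrow> nat. \<forall>i<length l. s i = l ! i}" for l
  have cyl_PiE: "cyl l = PiE UNIV (\<lambda>i. if i < length l then {l ! i} else UNIV)" for l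
    by (auto simp: cyl_def PiE_def Pi_def split: if_splits)
  have cyl_open: "openin S (cyl l)" for l
    unfolding cyl_PiE S_def
  proof (subst openin_PiE_gen, intro disjI2 conjI ballI)
    show "finite {i \<in> UNIV. (if i < length l then {l ! i} else UNIV) \<noteq> topspace (discrete_topology UNIV)}"
      by (rule finite_subset[of _ "{..<length l}"]) auto
  qed simp
  have base: "\<exists>n l. fst p \<in> U n \<and> snd p \<in> cyl l \<and> U n \<times> cyl l \<subseteq> W" if W: "openin P W" "p \<in> W" for W p
  proof -
    obtain A B where AB: "openin T A" "openin S B" "fst p \<in> A" "snd p \<in> B" "A \<times> B \<subseteq> W"
      using W unfolding P_def openin_prod_topology_alt by (metis prod.collapse)
    obtain n where n: "fst p \<in> U n" "U n \<subseteq> A" using U(2)[OF AB(1,3)] by blast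
    obtain V where V: "finite {i\<in>UNIV. V i \<noteq> topspace (discrete_topology (UNIV :: nat set))}"
      "snd p \<in> PiE UNIV V" "PiE UNIV V \<subseteq> B"
      using AB(2,4) unfolding S_def openin_product_topology_alt by blast
    obtain m where m: "\<And>i. V i \<noteq> UNIV \<Longrightarrow> i < m"
      using V(1) unfolding finite_nat_set_iff_bounded by auto
    have "cyl (map (snd p) [0..<m]) \<subseteq> PiE UNIV V"
    proof
      fix s assume s: "s \<in> cyl (map (snd p) [0..<m])"
      have "s i \<in> V i" for i
        using m[of i] V(2) s unfolding cyl_def PiE_def Pi_def by (cases "i < m") auto
      then show "s \<in> PiE UNIV V" by (simp add: PiE_def)
    qed
    moreover have "snd p \<in> cyl (map (snd p) [0..<m])" by (simp add: cyl_def)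
    ultimately have l: "snd p \<in> cyl (map (snd p) [0..<m])" "cyl (map (snd p) [0..<m]) \<subseteq> B"
      using V(3) by (simp_all add: subset_trans)
    then have "U n \<times> cyl (map (snd p) [0..<m]) \<subseteq> W" using n(2) AB(5) by (meson Sigma_mono subset_trans)
    then show ?thesis using n(1) l(1) by (intro exI[of _ n] exI[of _ "map (snd p) [0..<m]"] conjI)
  qed
  have rect_open: "openin P (U n \<times> cyl l)" for n l
    unfolding P_def using U(1) cyl_open by (simp add: openin_prod_Times_iff)
  have "second_countable P"
    unfolding second_countable_def
  proof (intro exI[of _ "range (\<lambda>(n, l). U n \<times> cyl l)"] conjI allI impI ballI)
    fix V assume "V \<in> range (\<lambda>(n, l). U n \<times> cyl l)"
    then show "openin P V" using rect_open by auto
  next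
    fix W p assume W: "openin P W \<and> p \<in> W"
    then obtain n l where "fst p \<in> U n" "snd p \<in> cyl l" "U n \<times> cyl l \<subseteq> W" using base by blast
    then show "\<exists>V\<in>range (\<lambda>(n, l). U n \<times> cyl l). p \<in> V \<and> V \<subseteq> W"
      by (intro bexI[of _ "U n \<times> cyl l"]) (auto simp: mem_Times_iff intro: range_eqI[of _ _ "(n, l)"])
  qed simp
  then have sep: "separable_space P" by (rule second_countable_imp_separable_space)
  have "sets N = sigma_sets (space N) {W. openin P W}"
  proof
    have "W \<in> sets N" if W: "openin P W" for W
    proof -
      have "W = (\<Union>q\<in>{q. U (fst q) \<times> cyl (snd q) \<subseteq> W}. U (fst q) \<times> cyl (snd q))"
      proof (intro set_eqI iffI)
        fix p assume "p \<in> W"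
        then obtain n l where "fst p \<in> U n" "snd p \<in> cyl l" "U n \<times> cyl l \<subseteq> W" using base[OF W] by blast
        then show "p \<in> (\<Union>q\<in>{q. U (fst q) \<times> cyl (snd q) \<subseteq> W}. U (fst q) \<times> cyl (snd q))"
          by (intro UN_I[of "(n, l)"]) (auto simp: mem_Times_iff)
      qed blast
      also have "\<dots> \<in> sets N"
      proof (intro sets.countable_UN'[OF countableI_type] image_subsetI)
        fix q :: "nat \<times> nat list"
        have "cyl (snd q) \<in> sets seqM"
        proof -
          have "cyl (snd q) = {s\<in>space seqM. \<forall>i<length (snd q). s i = snd q ! i}" by (simp add: cyl_def)
          also have "\<dots> \<in> sets seqM" by measurable
          finally show ?thesis .
        qed
        moreover have "U (fst q) \<in> sets M" using U(1) T(4) by auto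
        ultimately show "U (fst q) \<times> cyl (snd q) \<in> sets N" unfolding N by (rule pair_measureI[rotated])
      qed
      finally show ?thesis .
    qed
    then show "sigma_sets (space N) {W. openin P W} \<subseteq> sets N" by (intro sets.sigma_sets_subset) auto
    define K where "K = sigma (space N) {W. openin P W}"
    have sub: "{W. openin P W} \<subseteq> Pow (space N)" using openin_subset topP by blast
    have K: "space K = space N" "sets K = sigma_sets (space N) {W. openin P W}"
      unfolding K_def using sub by (simp_all add: space_measure_of sets_measure_of)
    have Kopen: "W \<in> sets K" if "openin P W" for W using that unfolding K(2) by (blast intro: sigma_sets.Basic)
    have spN: "space N = space M \<times> UNIV" using sets_eq_imp_space_eq[OF N] by (simp add: space_pair_measure)
    have "(\<lambda>p. (fst p, snd p)) \<in> K \<rightarrow>\<^sub>M labeled M"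
    proof (rule measurable_Pair)
      show "fst \<in> K \<rightarrow>\<^sub>M M"
      proof (rule measurable_sigma_sets[OF T(4)])
        show "{U. openin T U} \<subseteq> Pow (space M)" using openin_subset T(3) by blast
        show "fst \<in> space K \<rightarrow> space M" using K(1) spN by auto
        fix A assume A: "A \<in> {U. openin T U}"
        then have "A \<subseteq> space M" using openin_subset T(3) by blast
        then have "fst -` A \<inter> space K = A \<times> topspace S" using K(1) spN topS by auto
        moreover have "openin P (A \<times> topspace S)" unfolding P_def using A by (simp add: openin_prod_Times_iff)
        ultimately show "fst -` A \<inter> space K \<in> sets K" using Kopen by simp
      qed
      show "snd \<in> K \<rightarrow>\<^sub>M seqM"
      proof (rule measurable_PiM_single')
        fix n :: nat
        show "(\<lambda>p. snd p n) \<in> K \<rightarrow>\<^sub>M count_space UNIV"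
        proof (rule measurableI)
          fix A :: "nat set"
          have "openin S (PiE UNIV (\<lambda>i. if i = n then A else UNIV))"
            unfolding S_def
          proof (subst openin_PiE_gen, intro disjI2 conjI ballI)
            show "finite {i \<in> UNIV. (if i = n then A else UNIV) \<noteq> topspace (discrete_topology UNIV)}"
              by (rule finite_subset[of _ "{n}"]) auto
          qed simp
          then have "openin P (topspace T \<times> PiE UNIV (\<lambda>i. if i = n then A else UNIV))"
            unfolding P_def by (simp add: openin_prod_Times_iff)
          moreover have "(\<lambda>p. snd p n) -` A \<inter> space K = topspace T \<times> PiE UNIV (\<lambda>i. if i = n then A else UNIV)"
            using K(1) spN T(3) by (auto simp: PiE_def Pi_def split: if_splits)
          ultimately show "(\<lambda>p. snd p n) -` A \<inter> space K \<in> sets K" using Kopen by simp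
        qed simp
      qed auto
    qed
    then have id: "(\<lambda>p. p) \<in> K \<rightarrow>\<^sub>M labeled M" by simp
    show "sets N \<subseteq> sigma_sets (space N) {W. openin P W}"
    proof
      fix A assume A: "A \<in> sets N"
      have "(\<lambda>p. p) -` A \<inter> space K = A" using sets.sets_into_space[OF A] K(1) by auto
      then show "A \<in> sigma_sets (space N) {W. openin P W}"
        using measurable_sets[OF id A[unfolded N]] K(2) by simp
    qed
  qed
  then show ?thesis unfolding standard_borel_def using cP sep topP by blast
qed

lemma separating_base_eq_measurable:
  assumes U: "separating_base M U" and f: "f \<in> K \<rightarrow>\<^sub>M M" "g \<in> K \<rightarrow>\<^sub>M M"
  shows "{k\<in>space K. f k = g k} \<in> sets K"
proof -
  have "{k\<in>space K. f k = g k} = {k\<in>space K. \<forall>n. f k \<in> U n \<longleftrightarrow> g k \<in> U n}"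
  proof (intro set_eqI iffI)
    fix k assume k: "k \<in> {k\<in>space K. \<forall>n. f k \<in> U n \<longleftrightarrow> g k \<in> U n}"
    then have sp: "f k \<in> space M" using measurable_space[OF f(1)] by blast
    have "f k = g k"
    proof (rule ccontr)
      assume "f k \<noteq> g k"
      then have "f k \<notin> {g k}" by simp
      then obtain n where "f k \<in> U n" "U n \<inter> {g k} = {}"
        using U sp unfolding separating_base_def by (meson finite.emptyI finite.insertI)
      then show False using k by blast
    qed
    then show "k \<in> {k\<in>space K. f k = g k}" using k by blast
  qed auto
  moreover have [measurable]: "U n \<in> sets M" for n using U unfolding separating_base_def by blast
  note [measurable] = f
  ultimately show ?thesis by simp
qed

section \<open>The coloring of a component, seen from a vertex, as a sequence\<close>

definition edge_code :: "nat list \<Rightarrow> nat \<Rightarrow> nat" where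
  "edge_code v i = prod_encode (list_encode v, i)"

definition code_word :: "nat \<Rightarrow> nat list" where
  "code_word n = list_decode (fst (prod_decode n))"

definition code_edge :: "nat \<Rightarrow> nat" where
  "code_edge n = snd (prod_decode n)"

lemma code_simps [simp]:
  "code_word (edge_code v i) = v" "code_edge (edge_code v i) = i"
  "edge_code (code_word n) (code_edge n) = n"
  by (simp_all add: edge_code_def code_word_def code_edge_def)

text \<open>Change of root: an edge found after the walk \<open>v\<close> from \<open>T j x\<close>
  is found after \<open>j # v\<close> from \<open>x\<close>, since \<open>fold\<close> applies the
  head of the word first.\<close>

definition shift :: "nat \<Rightarrow> (nat \<Rightarrow> nat) \<Rightarrow> nat \<Rightarrow> nat" where
  "shift j s n = s (edge_code (j # code_word n) (code_edge n))"

context involution_system begin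

text \<open>A sequence \<open>s\<close> attached to \<open>x\<close> stores at position \<open>edge_code v i\<close> the color of the edge joining
  \<open>fold T v x\<close> and its image under \<open>T i\<close>; the value \<open>d\<close> means that there is no color.\<close>

definition edge_at :: "'a \<Rightarrow> nat \<Rightarrow> 'a set" where
  "edge_at x n = {fold T (code_word n) x, T (code_edge n) (fold T (code_word n) x)}"

definition is_edge :: "'a \<Rightarrow> nat \<Rightarrow> bool" where
  "is_edge x n \<longleftrightarrow> T (code_edge n) (fold T (code_word n) x) \<noteq> fold T (code_word n) x"

definition lift :: "nat \<Rightarrow> 'a \<times> (nat \<Rightarrow> nat) \<Rightarrow> 'a \<times> (nat \<Rightarrow> nat)" where
  "lift j p = (T j (fst p), shift j (snd p))"

definition adjacent_edges :: "'a \<Rightarrow> nat \<Rightarrow> nat \<Rightarrow> bool" where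
  "adjacent_edges x n m \<longleftrightarrow> fold T (code_word n) x = fold T (code_word m) x \<and>
     is_edge x n \<and> is_edge x m \<and> code_edge n \<noteq> code_edge m"

text \<open>Different walks can name the same edge, so the first clause makes the label a function
  on edges. The alternative \<open>snd p n = d\<close> lets the first and third clauses hold exactly
  for every partial coloring; only the second has to be gained in the limit.\<close>

definition good :: "'a \<times> (nat \<Rightarrow> nat) \<Rightarrow> bool" where
  "good p \<longleftrightarrow> fst p \<in> space M \<and> (\<forall>n m. 
     (edge_at (fst p) n = edge_at (fst p) m \<longrightarrow> snd p n = snd p m) \<and>
     (is_edge (fst p) n \<longrightarrow> snd p n < d) \<and>
     (adjacent_edges (fst p) n m \<longrightarrow> snd p n \<noteq> snd p m \<or> snd p n = d))"

definition color_name :: "(nat \<Rightarrow> 'a \<Rightarrow> nat) \<Rightarrow> 'a \<Rightarrow> nat \<Rightarrow> nat" where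
  "color_name \<kappa> x n = \<kappa> (code_edge n) (fold T (code_word n) x)"

text \<open>This equivariance turns invariance of \<open>M\<close> under \<open>T j\<close> into
  invariance of the joint law under \<open>lift j\<close>.\<close>

lemma color_name_T: "color_name \<kappa> (T j x) = shift j (color_name \<kappa> x)"
  by (rule ext) (simp add: color_name_def shift_def)

lemma fold_T_measurable[measurable]: "fold T v \<in> M \<rightarrow>\<^sub>M M"
proof (induction v)
  case Nil
  then show ?case by (simp add: id_def)
next
  case (Cons i v)
  then show ?case by (simp add: measurable_comp[OF T_measurable])
qed

lemma fold_T_space: "x \<in> space M \<Longrightarrow> fold T v x \<in> space M"
  using fold_T_measurable by (rule measurable_space)

text \<open>An edge at the end of any fixed walk is as likely to be uncolored as the edge of the
  same matching at the root.\<close>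

lemma measure_fold_preimage:
  assumes "A \<in> sets M" shows "measure M (fold T v -` A \<inter> space M) = measure M A"
proof (induction v)
  case Nil
  then show ?case using sets.sets_into_space[OF assms] by (simp add: Int_absorb2)
next
  case (Cons i v)
  have "fold T (i # v) -` A \<inter> space M = T i -` (fold T v -` A \<inter> space M) \<inter> space M"
    using T_in_space by auto
  then have "measure M (fold T (i # v) -` A \<inter> space M) = measure M (fold T v -` A \<inter> space M)"
    using measure_preimage[OF measurable_sets[OF fold_T_measurable assms, of v], of i] by (simp only:)
  then show ?case using Cons by (simp only:)
qed

lemma color_name_measurable:
  assumes "partial_coloring \<kappa>" shows "color_name \<kappa> \<in> M \<rightarrow>\<^sub>M seqM"
proof -
  have [measurable]: "\<kappa> j \<in> M \<rightarrow>\<^sub>M count_space UNIV" for j using assms by (rule partial_coloring_measurable)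
  have "(\<lambda>x n. \<kappa> (code_edge n) (fold T (code_word n) x)) \<in> M \<rightarrow>\<^sub>M seqM"
    by (rule measurable_PiM_single') auto
  then show ?thesis by (simp add: color_name_def[abs_def])
qed

lemma color_name_le: "partial_coloring \<kappa> \<Longrightarrow> x \<in> space M \<Longrightarrow> color_name \<kappa> x n \<le> d"
  unfolding color_name_def using partial_coloringD(1) fold_T_space by blast

lemma color_name_edge_at:
  assumes \<kappa>: "partial_coloring \<kappa>" and x: "x \<in> space M" and eq: "edge_at x n = edge_at x m"
  shows "color_name \<kappa> x n = color_name \<kappa> x m"
proof -
  define y where "y = fold T (code_word n) x"
  define z where "z = fold T (code_word m) x"
  define i where "i = code_edge n"
  define j where "j = code_edge m"
  have sp: "y \<in> space M" "z \<in> space M" unfolding y_def z_def using fold_T_space x by auto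
  \<comment> \<open>Either both involutions fix \<open>z\<close> and both values are
    \<open>d\<close>, or they are the same matching by \<open>T_disjoint\<close>.\<close>
  have same: "\<kappa> i z = \<kappa> j z" if "T i z = T j z" "z \<in> space M" for z
  proof (cases "T i z = z")
    case True
    then have "\<kappa> i z = d" "\<kappa> j z = d"
      using partial_coloringD(1,3)[OF \<kappa> that(2)] that(1) by (metis le_neq_implies_less)+
    then show ?thesis by simp
  next
    case False
    then show ?thesis using T_disjoint that(1) by blast
  qed
  have "{y, T i y} = {z, T j z}" using eq unfolding edge_at_def y_def z_def i_def j_def .
  then consider "y = z" "T i y = T j z" | "y = T j z" "T i y = z" by (auto simp: doubleton_eq_iff)
  then have "\<kappa> i y = \<kappa> j z"
  proof cases
    case 1
    then show ?thesis using same[of z] sp by simp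
  next
    case 2
    then have "T j y = z" using T_involution by simp
    then have "\<kappa> i y = \<kappa> j y" using same[of y] 2 sp by simp
    also have "\<dots> = \<kappa> j z" using 2(1) partial_coloringD(2)[OF \<kappa> sp(2)] by simp
    finally show ?thesis .
  qed
  then show ?thesis by (simp add: color_name_def y_def z_def i_def j_def)
qed

lemma color_name_adjacent:
  assumes \<kappa>: "partial_coloring \<kappa>" and x: "x \<in> space M" and adj: "adjacent_edges x n m"
  shows "color_name \<kappa> x n \<noteq> color_name \<kappa> x m \<or> color_name \<kappa> x n = d"
proof -
  have "fold T (code_word n) x = fold T (code_word m) x" "code_edge n \<noteq> code_edge m"
    using adj by (auto simp: adjacent_edges_def)
  then show ?thesis
    using partial_coloringD(4)[OF \<kappa> fold_T_space[OF x, of "code_word m"], of "code_edge n" "code_edge m"]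
      partial_coloringD(1)[OF \<kappa> fold_T_space[OF x, of "code_word m"], of "code_edge n"]
    unfolding color_name_def by force
qed

lemma shift_measurable[measurable]: "shift j \<in> seqM \<rightarrow>\<^sub>M seqM"
proof -
  have "(\<lambda>s n. s (edge_code (j # code_word n) (code_edge n))) \<in> seqM \<rightarrow>\<^sub>M seqM"
    by (rule measurable_PiM_single') auto
  then show ?thesis by (simp add: shift_def[abs_def])
qed

lemma lift_measurable: "lift j \<in> labeled M \<rightarrow>\<^sub>M labeled M"
  unfolding lift_def[abs_def] by measurable

text \<open>The first \<open>m\<close> entries of a shifted label come from finitely many entries of
  the original one.\<close>

lemma cylinder_lift:
  assumes "cylinder M m Z"
  shows "\<exists>m'. cylinder M m' (lift j -` Z \<inter> space (labeled M))"
proof -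
  define c where "c n = edge_code (j # code_word n) (code_edge n)" for n
  obtain m' where m': "\<And>n. n < m \<Longrightarrow> c n < m'"
    using finite_nat_set_iff_bounded[of "c ` {..<m}"] by auto
  have "cylinder M m' (lift j -` Z \<inter> space (labeled M))"
  proof (rule cylinderI)
    show "lift j -` Z \<inter> space (labeled M) \<in> sets (labeled M)"
      using measurable_sets[OF lift_measurable cylinder_sets[OF assms]] .
    fix x and s t :: "nat \<Rightarrow> nat" assume eq: "\<forall>i<m'. s i = t i" and xs: "(x, s) \<in> lift j -` Z \<inter> space (labeled M)"
    have "\<forall>n<m. shift j s n = shift j t n" using eq m' by (simp add: shift_def c_def)
    then show "(x, t) \<in> lift j -` Z \<inter> space (labeled M)"
      using xs cylinder_cong[OF assms] by (auto simp: lift_def space_pair_measure)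
  qed
  then show ?thesis ..
qed

section \<open>Goodness as countably many cylinder conditions, and the limit measure\<close>

lemma edge_conditions_measurable:
  assumes U: "separating_base M U"
  shows "{x\<in>space M. edge_at x n = edge_at x m} \<in> sets M" "{x\<in>space M. is_edge x n} \<in> sets M"
    "{x\<in>space M. adjacent_edges x n m} \<in> sets M"
proof -
  have eq[measurable]: "{x\<in>space M. f x = g x} \<in> sets M" if "f \<in> M \<rightarrow>\<^sub>M M" "g \<in> M \<rightarrow>\<^sub>M M" for f g
    using separating_base_eq_measurable[OF U that] .
  have TF: "(\<lambda>x. T i (fold T v x)) \<in> M \<rightarrow>\<^sub>M M" for i v by measurable
  show e: "{x\<in>space M. is_edge x n} \<in> sets M" for n
  proof -
    have "{x\<in>space M. is_edge x n} = space M - {x\<in>space M. T (code_edge n) (fold T (code_word n) x) = fold T (code_word n) x}"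
      by (auto simp: is_edge_def)
    then show ?thesis using eq[OF TF fold_T_measurable] by auto
  qed
  have "{x\<in>space M. edge_at x n = edge_at x m} =
     ({x\<in>space M. fold T (code_word n) x = fold T (code_word m) x} \<inter>
      {x\<in>space M. T (code_edge n) (fold T (code_word n) x) = T (code_edge m) (fold T (code_word m) x)}) \<union>
     ({x\<in>space M. fold T (code_word n) x = T (code_edge m) (fold T (code_word m) x)} \<inter>
      {x\<in>space M. T (code_edge n) (fold T (code_word n) x) = fold T (code_word m) x})"
    by (auto simp: edge_at_def doubleton_eq_iff)
  then show "{x\<in>space M. edge_at x n = edge_at x m} \<in> sets M"
    using eq TF fold_T_measurable by auto
  have "{x\<in>space M. adjacent_edges x n m} = (if code_edge n = code_edge m then {} else
     {x\<in>space M. fold T (code_word n) x = fold T (code_word m) x} \<inter> {x\<in>space M. is_edge x n} \<inter> {x\<in>space M. is_edge x m})"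
    by (auto simp: adjacent_edges_def)
  then show "{x\<in>space M. adjacent_edges x n m} \<in> sets M"
    using eq[OF fold_T_measurable fold_T_measurable, of "code_word n" "code_word m"] e[of n] e[of m]
    by (simp split: if_splits)
qed

lemma cylinder_condition:
  assumes A: "A \<in> sets M"
  shows "cylinder M (Suc (max n m)) {p\<in>space (labeled M). fst p \<in> A \<longrightarrow> R (snd p n) (snd p m)}"
proof (rule cylinderI)
  note [measurable] = A
  have "(\<lambda>p. (snd p n, snd p m)) \<in> labeled M \<rightarrow>\<^sub>M count_space UNIV \<Otimes>\<^sub>M count_space UNIV" by measurable
  moreover have "count_space UNIV \<Otimes>\<^sub>M count_space UNIV = (count_space UNIV :: (nat \<times> nat) measure)"
    by (simp add: pair_measure_countable)
  ultimately have "(\<lambda>p. (snd p n, snd p m)) \<in> labeled M \<rightarrow>\<^sub>M count_space UNIV" by simp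
  from measurable_sets[OF this, of "{(a, b). R a b}"]
  have "{p\<in>space (labeled M). R (snd p n) (snd p m)} \<in> sets (labeled M)"
    by (simp add: vimage_def Int_def conj_commute)
  moreover have "{p\<in>space (labeled M). fst p \<notin> A} \<in> sets (labeled M)" by measurable
  ultimately have "{p\<in>space (labeled M). fst p \<notin> A} \<union> {p\<in>space (labeled M). R (snd p n) (snd p m)} \<in> sets (labeled M)"
    by auto
  moreover have "{p\<in>space (labeled M). fst p \<in> A \<longrightarrow> R (snd p n) (snd p m)} =
      {p\<in>space (labeled M). fst p \<notin> A} \<union> {p\<in>space (labeled M). R (snd p n) (snd p m)}" by blast
  ultimately show "{p\<in>space (labeled M). fst p \<in> A \<longrightarrow> R (snd p n) (snd p m)} \<in> sets (labeled M)" by simp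
qed (auto simp: space_pair_measure)

definition consistent_at :: "nat \<Rightarrow> nat \<Rightarrow> ('a \<times> (nat \<Rightarrow> nat)) set" where
  "consistent_at n m = {p\<in>space (labeled M). fst p \<in> {x\<in>space M. edge_at x n = edge_at x m} \<longrightarrow> snd p n = snd p m}"

definition colored_at :: "nat \<Rightarrow> ('a \<times> (nat \<Rightarrow> nat)) set" where
  "colored_at n = {p\<in>space (labeled M). fst p \<in> {x\<in>space M. is_edge x n} \<longrightarrow> snd p n < d}"

definition proper_at :: "nat \<Rightarrow> nat \<Rightarrow> ('a \<times> (nat \<Rightarrow> nat)) set" where
  "proper_at n m = {p\<in>space (labeled M). fst p \<in> {x\<in>space M. adjacent_edges x n m} \<longrightarrow> snd p n \<noteq> snd p m \<or> snd p n = d}"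

lemma cylinder_conditions:
  assumes "separating_base M U"
  shows "cylinder M (Suc (max n m)) (consistent_at n m)" "cylinder M (Suc (max n n)) (colored_at n)"
    "cylinder M (Suc (max n m)) (proper_at n m)"
  unfolding consistent_at_def colored_at_def proper_at_def
  using edge_conditions_measurable[OF assms] by (intro cylinder_condition; simp)+

lemma good_iff:
  assumes "p \<in> space (labeled M)"
  shows "good p \<longleftrightarrow> (\<forall>n m. p \<in> consistent_at n m \<and> p \<in> colored_at n \<and> p \<in> proper_at n m)"
proof -
  have "fst p \<in> space M" using assms by (auto simp: space_pair_measure)
  then show ?thesis unfolding good_def consistent_at_def colored_at_def proper_at_def using assms by simp
qed

text \<open>On cylinders \<open>N\<close> is a limit of frequencies. The marginal, invariance under
  lifts, consistency and properness hold exactly for each approximation. The condition at code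
  \<open>n\<close> that an edge has a color fails with the measure of the uncolored part of one
  matching, which tends to zero.\<close>

lemma invariant_joining:
  assumes U: "separating_base M U"
  shows "\<exists>N. prob_space N \<and> sets N = sets (labeled M) \<and> distr N M fst = M \<and>
    (\<forall>j. distr N N (lift j) = N) \<and> (AE p in N. good p)"
proof -
  \<comment> \<open>The \<open>k\<close>-th coloring is controlled on the first \<open>k\<close>
    matchings only; every fixed matching is eventually among them.\<close>
  have "\<forall>k. \<exists>\<kappa>. partial_coloring \<kappa> \<and> (\<Sum>j<k. measure M (uncolored \<kappa> j)) < inverse (real (Suc k))"
    using approximate_coloring by simp
  from choice[OF this] obtain \<kappa> where \<kappa>: "\<And>k. partial_coloring (\<kappa> k)"
    and small: "\<And>k. (\<Sum>j<k. measure M (uncolored (\<kappa> k) j)) < inverse (real (Suc k))" by auto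
  define g where "g k = color_name (\<kappa> k)" for k
  have g_meas[measurable]: "g k \<in> M \<rightarrow>\<^sub>M seqM" for k unfolding g_def using color_name_measurable[OF \<kappa>] .
  have g_le: "g k x n \<le> d" if "x \<in> space M" for k x n unfolding g_def using color_name_le[OF \<kappa> that] .
  obtain N G where N: "prob_space N" "sets N = sets (labeled M)" and G: "G \<noteq> bot" "G \<le> sequentially"
    and lim: "\<And>m Z. cylinder M m Z \<Longrightarrow> ((\<lambda>k. measure M {x\<in>space M. (x, g k x) \<in> Z}) \<longlongrightarrow> measure N Z) G"
    using limit_joining[of g d, OF g_meas g_le] by blast
  interpret N: prob_space N by fact
  have spN: "space N = space (labeled M)" using sets_eq_imp_space_eq[OF N(2)] .
  have lim_seq: "measure N Z = c" if "cylinder M m Z" "(\<lambda>k. measure M {x\<in>space M. (x, g k x) \<in> Z}) \<longlonglongrightarrow> c" for m Z c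
    using tendsto_unique[OF G(1) lim[OF that(1)] tendsto_mono[OF G(2) that(2)]] .
  have AE_one: "AE p in N. p \<in> Z" if "cylinder M m Z" "(\<lambda>k. measure M {x\<in>space M. (x, g k x) \<in> Z}) \<longlonglongrightarrow> 1" for m Z
    using N.AE_prob_1[OF lim_seq[OF that]] .
  have fst_meas: "fst \<in> N \<rightarrow>\<^sub>M M" using N(2) by (subst measurable_cong_sets[OF N(2) refl]) simp
  have "distr N M fst = M"
  proof (rule measure_eqI)
    fix B assume "B \<in> sets (distr N M fst)"
    then have B: "B \<in> sets M" by simp
    have pre: "fst -` B \<inter> space N = B \<times> UNIV"
      using sets.sets_into_space[OF B] by (auto simp: spN space_pair_measure)
    have cyl: "cylinder M 0 (B \<times> UNIV)"
      using B sets.top[of seqM] by (intro cylinderI) auto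
    have "{x\<in>space M. (x, g k x) \<in> B \<times> UNIV} = B" for k using sets.sets_into_space[OF B] by auto
    then have "measure N (B \<times> UNIV) = measure M B" by (intro lim_seq[OF cyl]) simp
    then show "emeasure (distr N M fst) B = emeasure M B"
      using B fst_meas pre by (simp add: emeasure_distr N.emeasure_eq_measure emeasure_eq_measure)
  qed simp
  moreover have "distr N N (lift j) = N" for j
  proof (rule measure_eqI_generator_eq[where E = "{Z. \<exists>m. cylinder M m Z}" and \<Omega> = "space M \<times> UNIV" and A = "\<lambda>_. space M \<times> UNIV"])
    interpret algebra "space M \<times> UNIV" "{Z. \<exists>m. cylinder M m Z}" by (rule algebra_cylinders)
    show "Int_stable {Z. \<exists>m. cylinder M m Z}" unfolding Int_stable_def using Int by blast
    show "{Z. \<exists>m. cylinder M m Z} \<subseteq> Pow (space M \<times> UNIV)" by (rule space_closed)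
    show "range (\<lambda>_. space M \<times> UNIV) \<subseteq> {Z. \<exists>m. cylinder M m Z}" using top by blast
    show "sets (distr N N (lift j)) = sigma_sets (space M \<times> UNIV) {Z. \<exists>m. cylinder M m Z}"
      "sets N = sigma_sets (space M \<times> UNIV) {Z. \<exists>m. cylinder M m Z}"
      using N(2) by (simp_all add: sigma_sets_cylinders)
    have lm: "lift j \<in> N \<rightarrow>\<^sub>M N" using lift_measurable by (simp add: measurable_cong_sets[OF N(2) N(2)])
    interpret D: prob_space "distr N N (lift j)" by (rule N.prob_space_distr[OF lm])
    show "emeasure (distr N N (lift j)) (space M \<times> UNIV) \<noteq> \<infinity>"
      by (simp only: D.emeasure_eq_measure) simp
    fix Z assume "Z \<in> {Z. \<exists>m. cylinder M m Z}"
    then obtain m where Z: "cylinder M m Z" by blast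
    obtain m' where Z': "cylinder M m' (lift j -` Z \<inter> space (labeled M))" using cylinder_lift[OF Z] by blast
    have "measure M {x\<in>space M. (x, g k x) \<in> lift j -` Z \<inter> space (labeled M)} = measure M {x\<in>space M. (x, g k x) \<in> Z}" for k
    proof -
      have meas: "{x\<in>space M. (x, g k x) \<in> Z} \<in> sets M" using cylinder_sets[OF Z] by measurable
      have "{x\<in>space M. (x, g k x) \<in> lift j -` Z \<inter> space (labeled M)} = T j -` {x\<in>space M. (x, g k x) \<in> Z} \<inter> space M"
        by (auto simp: lift_def g_def color_name_T space_pair_measure T_in_space)
      then show ?thesis using measure_preimage[OF meas] by simp
    qed
    then have "measure N (lift j -` Z \<inter> space (labeled M)) = measure N Z"
      using tendsto_unique[OF G(1) lim[OF Z']] lim[OF Z] by simp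
    then show "emeasure (distr N N (lift j)) Z = emeasure N Z"
      using lm cylinder_sets[OF Z] N(2) by (simp add: emeasure_distr N.emeasure_eq_measure spN)
  qed auto
  moreover have "AE p in N. good p"
  proof -
    note cyl = cylinder_conditions[OF U]
    have A1: "AE p in N. p \<in> consistent_at n m" for n m
    proof (rule AE_one[OF cyl(1)])
      have "{x\<in>space M. (x, g k x) \<in> consistent_at n m} = space M" for k
      proof -
        have "g k x n = g k x m" if "x \<in> space M" "edge_at x n = edge_at x m" for x
          unfolding g_def by (rule color_name_edge_at[OF \<kappa> that])
        then show ?thesis by (auto simp: consistent_at_def space_pair_measure)
      qed
      then show "(\<lambda>k. measure M {x\<in>space M. (x, g k x) \<in> consistent_at n m}) \<longlonglongrightarrow> 1"
        by (simp add: prob_space)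
    qed
    have A3: "AE p in N. p \<in> proper_at n m" for n m
    proof (rule AE_one[OF cyl(3)])
      have "{x\<in>space M. (x, g k x) \<in> proper_at n m} = space M" for k
      proof -
        have "g k x n \<noteq> g k x m \<or> g k x n = d" if "x \<in> space M" "adjacent_edges x n m" for x
          unfolding g_def by (rule color_name_adjacent[OF \<kappa> that])
        then show ?thesis by (auto simp: proper_at_def space_pair_measure)
      qed
      then show "(\<lambda>k. measure M {x\<in>space M. (x, g k x) \<in> proper_at n m}) \<longlonglongrightarrow> 1"
        by (simp add: prob_space)
    qed
    have A2: "AE p in N. p \<in> colored_at n" for n
    proof (rule AE_one[OF cyl(2)])
      let ?v = "code_word n" and ?i = "code_edge n"
      have bad: "measure M {x\<in>space M. (x, g k x) \<in> colored_at n}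
          = 1 - measure M (uncolored (\<kappa> k) ?i)" for k
      proof -
        have pm: "fold T ?v -` uncolored (\<kappa> k) ?i \<inter> space M \<in> sets M"
          using measurable_sets[OF fold_T_measurable uncolored_measurable[OF \<kappa>]] .
        have "{x\<in>space M. (x, g k x) \<in> colored_at n}
            = space M - (fold T ?v -` uncolored (\<kappa> k) ?i \<inter> space M)"
          using color_name_le[OF \<kappa>] fold_T_space
          by (fastforce simp: colored_at_def space_pair_measure g_def is_edge_def uncolored_def color_name_def le_less)
        then show ?thesis
          using prob_compl[OF pm] measure_fold_preimage[OF uncolored_measurable[OF \<kappa>]] by simp
      qed
      have "(\<lambda>k. measure M (uncolored (\<kappa> k) ?i)) \<longlonglongrightarrow> 0"
      proof (rule tendsto_sandwich[OF _ _ tendsto_const LIMSEQ_inverse_real_of_nat])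
        have "measure M (uncolored (\<kappa> k) ?i) \<le> inverse (real (Suc k))" if "k > ?i" for k
        proof -
          have "measure M (uncolored (\<kappa> k) ?i) \<le> (\<Sum>j<k. measure M (uncolored (\<kappa> k) j))"
            using that by (intro member_le_sum) auto
          then show ?thesis using small[of k] by simp
        qed
        then show "\<forall>\<^sub>F k in sequentially. measure M (uncolored (\<kappa> k) ?i) \<le> inverse (real (Suc k))"
          by (intro eventually_sequentiallyI[of "Suc ?i"]) auto
      qed simp
      from tendsto_diff[OF tendsto_const[of 1] this]
      show "(\<lambda>k. measure M {x\<in>space M. (x, g k x) \<in> colored_at n}) \<longlonglongrightarrow> 1"
        unfolding bad by simp
    qed
    have "AE p in N. \<forall>n m. p \<in> consistent_at n m"
      by (intro AE_all_countable[THEN iffD2] allI A1)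
    moreover have "AE p in N. \<forall>n. p \<in> colored_at n"
      by (intro AE_all_countable[THEN iffD2] allI A2)
    moreover have "AE p in N. \<forall>n m. p \<in> proper_at n m"
      by (intro AE_all_countable[THEN iffD2] allI A3)
    ultimately show ?thesis using AE_space
    proof eventually_elim
      case (elim p)
      then show ?case unfolding good_iff[OF elim(4)[unfolded spN]] by blast
    qed
  qed
  ultimately show ?thesis using N by blast
qed

end

section \<open>The covering graphing\<close>

lemma nat_eq_measurable:
  fixes f g :: "'k \<Rightarrow> nat"
  assumes fg: "f \<in> K \<rightarrow>\<^sub>M count_space UNIV" "g \<in> K \<rightarrow>\<^sub>M count_space UNIV"
  shows "{k\<in>space K. f k = g k} \<in> sets K"
proof -
  have "{k\<in>space K. f k = g k} = (\<Union>n. (f -` {n} \<inter> space K) \<inter> (g -` {n} \<inter> space K))" by auto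
  then show ?thesis using measurable_sets[OF fg(1)] measurable_sets[OF fg(2)] by auto
qed

locale lifted_system = involution_system M T X d + N: prob_space N
  for M :: "'a measure" and T X d and N :: "('a \<times> (nat \<Rightarrow> nat)) measure" +
  fixes U :: "nat \<Rightarrow> 'a set"
  assumes separating: "separating_base M U"
    and sets_N[measurable_cong]: "sets N = sets (labeled M)"
    and marginal: "distr N M fst = M"
    and lift_preserving: "distr N N (lift j) = N"
    and AE_good: "AE p in N. good p"
begin

text \<open>Goodness passes to the other end by \<open>good_lift\<close>, so it is asked of
  \<open>p\<close> only; points that are not good become isolated.\<close>

definition lifted_edges :: "(('a \<times> (nat \<Rightarrow> nat)) \<times> ('a \<times> (nat \<Rightarrow> nat))) set" where
  "lifted_edges = {(p, q). good p \<and> (\<exists>j. q = lift j p \<and> T j (fst p) \<noteq> fst p)}"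

lemma space_N: "space N = space M \<times> UNIV"
  using sets_eq_imp_space_eq[OF sets_N] by (simp add: space_pair_measure)

lemma fst_lift[simp]: "fst (lift j p) = T j (fst p)"
  by (simp add: lift_def)

lemma lift_in_space: "p \<in> space N \<Longrightarrow> lift j p \<in> space N"
  using T_in_space by (auto simp: space_N mem_Times_iff)

lemma lift_measurable_N[measurable]: "lift j \<in> N \<rightarrow>\<^sub>M N"
  using lift_measurable by (simp add: measurable_cong_sets[OF sets_N sets_N])

lemma fst_measurable_N: "fst \<in> N \<rightarrow>\<^sub>M M"
  by measurable

lemma good_space: "good p \<Longrightarrow> fst p \<in> space M"
  unfolding good_def by (rule conjunct1)

lemma good_edge_at: "good p \<Longrightarrow> edge_at (fst p) n = edge_at (fst p) m \<Longrightarrow> snd p n = snd p m"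
  unfolding good_def by blast

lemma good_edge: "good p \<Longrightarrow> is_edge (fst p) n \<Longrightarrow> snd p n < d"
  unfolding good_def by blast

lemma good_adjacent:
  assumes "good p" "adjacent_edges (fst p) n m" shows "snd p n \<noteq> snd p m"
proof -
  have "is_edge (fst p) n" using assms(2) unfolding adjacent_edges_def by (elim conjE)
  then have "snd p n < d" by (rule good_edge[OF assms(1)])
  moreover have "adjacent_edges (fst p) n m \<longrightarrow> snd p n \<noteq> snd p m \<or> snd p n = d"
    using assms(1) unfolding good_def by blast
  ultimately show ?thesis using assms(2) by linarith
qed

lemma good_lift:
  assumes "good p" shows "good (lift j p)"
proof -
  define c where "c n = edge_code (j # code_word n) (code_edge n)" for n
  have eqs: "edge_at (fst (lift j p)) n = edge_at (fst p) (c n)" "is_edge (fst (lift j p)) n = is_edge (fst p) (c n)"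
    "adjacent_edges (fst (lift j p)) n m = adjacent_edges (fst p) (c n) (c m)" "snd (lift j p) n = snd p (c n)" for n m
    by (simp_all add: c_def edge_at_def is_edge_def adjacent_edges_def lift_def shift_def)
  show ?thesis unfolding good_def
  proof (intro conjI allI impI)
    show "fst (lift j p) \<in> space M" using T_in_space[OF good_space[OF assms]] by simp
    fix n m
    show "snd (lift j p) n = snd (lift j p) m" if "edge_at (fst (lift j p)) n = edge_at (fst (lift j p)) m"
      using that unfolding eqs by (rule good_edge_at[OF assms])
    show "snd (lift j p) n < d" if "is_edge (fst (lift j p)) n"
      using that unfolding eqs by (rule good_edge[OF assms])
    show "snd (lift j p) n \<noteq> snd (lift j p) m \<or> snd (lift j p) n = d" if "adjacent_edges (fst (lift j p)) n m"
      using that unfolding eqs by (intro disjI1) (rule good_adjacent[OF assms])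
  qed
qed

section \<open>Lifted walks and the edge relation of the covering graphing\<close>

lemma fold_lift: "fold lift w p = (fold T w (fst p), \<lambda>n. snd p (edge_code (w @ code_word n) (code_edge n)))"
proof (induction w arbitrary: p)
  case (Cons i w)
  then show ?case by (simp add: lift_def shift_def)
qed simp

text \<open>If two walks end at the same vertex, then any continuation names the same edge after
  either of them, and consistency gives equal entries. Hence the projection is injective on
  components.\<close>

lemma fold_lift_eq:
  assumes "good p" and eq: "fold T w (fst p) = fold T w' (fst p)"
  shows "fold lift w p = fold lift w' p"
proof -
  have "snd p (edge_code (w @ code_word n) (code_edge n)) = snd p (edge_code (w' @ code_word n) (code_edge n))" for n
    by (rule good_edge_at[OF assms(1)]) (simp add: edge_at_def eq)
  then show ?thesis unfolding fold_lift eq by simp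
qed

text \<open>For a general label the entries at codes beginning with \<open>j, j\<close> are
  unrelated to the shortened codes; goodness is what makes them agree.\<close>

lemma lift_lift: "good p \<Longrightarrow> lift j (lift j p) = p"
  using fold_lift_eq[of p "[j, j]" "[]"] T_involution by simp

lemma lifted_edgesI: "good p \<Longrightarrow> T j (fst p) \<noteq> fst p \<Longrightarrow> (p, lift j p) \<in> lifted_edges"
  unfolding lifted_edges_def by blast

lemma lifted_edgesE:
  assumes "(p, q) \<in> lifted_edges"
  obtains j where "good p" "q = lift j p" "T j (fst p) \<noteq> fst p"
  using assms unfolding lifted_edges_def by blast

lemma sym_lifted_edges: "sym lifted_edges"
proof (rule symI)
  fix p q assume "(p, q) \<in> lifted_edges"
  then obtain j where j: "good p" "q = lift j p" "T j (fst p) \<noteq> fst p" by (rule lifted_edgesE)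
  then have "(q, lift j q) \<in> lifted_edges"
    using T_involution by (intro lifted_edgesI good_lift) (auto simp: good_lift)
  then show "(q, p) \<in> lifted_edges" using lift_lift[OF j(1)] j(2) by simp
qed

lemma irrefl_lifted_edges: "irrefl lifted_edges"
  unfolding irrefl_def
proof (intro allI notI)
  fix p assume "(p, p) \<in> lifted_edges"
  then obtain j where "p = lift j p" "T j (fst p) \<noteq> fst p" by (rule lifted_edgesE)
  then show False by (metis fst_lift)
qed

lemma lifted_nbrs: "good p \<Longrightarrow> lifted_edges `` {p} \<inter> B = (\<lambda>j. lift j p) ` {j. T j (fst p) \<noteq> fst p \<and> lift j p \<in> B}"
  unfolding lifted_edges_def by auto

lemma inj_lift: "inj_on (\<lambda>j. lift j p) {j. T j (fst p) \<noteq> fst p}"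
proof (rule inj_onI)
  fix i j assume i: "i \<in> {j. T j (fst p) \<noteq> fst p}" and eq: "lift i p = lift j p"
  have "T i (fst p) = T j (fst p)" using arg_cong[OF eq, of fst] by simp
  then show "i = j" by (rule T_disjoint) (use i in simp)
qed

lemma deg_lifted_edges:
  assumes "good p"
  shows "deg lifted_edges p B = card {j. T j (fst p) \<noteq> fst p \<and> lift j p \<in> B}"
  unfolding deg_def lifted_nbrs[OF assms]
  by (rule card_image) (rule inj_on_subset[OF inj_lift], blast)

lemma finite_moved: "good p \<Longrightarrow> finite {j. T j (fst p) \<noteq> fst p} \<and> card {j. T j (fst p) \<noteq> fst p} \<le> d"
  using T_degree[OF good_space] .

lemma not_good_nbrs: "\<not> good p \<Longrightarrow> lifted_edges `` {p} = {}"
  unfolding lifted_edges_def by auto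

lemma bounded_degree_lifted_edges:
  "finite (lifted_edges `` {p}) \<and> deg lifted_edges p B \<le> d"
proof (cases "good p")
  case True
  have fin: "finite {j. T j (fst p) \<noteq> fst p}" "card {j. T j (fst p) \<noteq> fst p} \<le> d" using finite_moved[OF True] by auto
  have "finite (lifted_edges `` {p})" using lifted_nbrs[OF True, of UNIV] fin by simp
  moreover have "card {j. T j (fst p) \<noteq> fst p \<and> lift j p \<in> B} \<le> card {j. T j (fst p) \<noteq> fst p}"
    using fin(1) by (intro card_mono) auto
  ultimately show ?thesis using fin(2) deg_lifted_edges[OF True] by simp
qed (simp add: not_good_nbrs deg_def)

lemma good_measurable[measurable]: "{p\<in>space N. good p} \<in> sets N"
proof -
  note cyl = cylinder_conditions[OF separating, THEN cylinder_sets, folded sets_N]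
  have "(\<Inter>n. \<Inter>m. consistent_at n m \<inter> colored_at n \<inter> proper_at n m) \<in> sets N"
    by (intro sets.countable_INT sets.Int image_subsetI cyl) auto
  moreover have "{p\<in>space N. good p} = (\<Inter>n. \<Inter>m. consistent_at n m \<inter> colored_at n \<inter> proper_at n m)"
  proof -
    have sp: "space N = space (labeled M)" by (rule sets_eq_imp_space_eq[OF sets_N])
    have "good p \<longleftrightarrow> (\<forall>n m. p \<in> consistent_at n m \<and> p \<in> colored_at n \<and> p \<in> proper_at n m)" if "p \<in> space N" for p
      by (rule good_iff[OF that[unfolded sp]])
    then have "p \<in> {p\<in>space N. good p} \<longleftrightarrow> p \<in> (\<Inter>n. \<Inter>m. consistent_at n m \<inter> colored_at n \<inter> proper_at n m)" if "p \<in> space N" for p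
      using that by simp
    moreover have "consistent_at 0 0 \<subseteq> space N" unfolding sp consistent_at_def by (rule Collect_restrict)
    then have "p \<notin> (\<Inter>n. \<Inter>m. consistent_at n m \<inter> colored_at n \<inter> proper_at n m)" if "p \<notin> space N" for p using that by auto
    ultimately show ?thesis by (intro set_eqI) (metis (mono_tags, lifting) mem_Collect_eq)
  qed
  ultimately show ?thesis by simp
qed

lemma moved_measurable_N[measurable]: "{p\<in>space N. T j (fst p) \<noteq> fst p} \<in> sets N"
proof -
  have "{p\<in>space N. T j (fst p) \<noteq> fst p} = fst -` {x\<in>space M. T j x \<noteq> x} \<inter> space N"
    by (auto simp: space_N)
  then show ?thesis using measurable_sets[OF fst_measurable_N moved_measurable] by simp
qed

lemma lifted_edges_measurable: "lifted_edges \<in> sets (N \<Otimes>\<^sub>M N)"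
proof -
  define G where "G j = {r\<in>space (N \<Otimes>\<^sub>M N). fst (snd r) = T j (fst (fst r))} \<inter>
      (\<Inter>n. {r\<in>space (N \<Otimes>\<^sub>M N). snd (snd r) n = snd (fst r) (edge_code (j # code_word n) (code_edge n))})" for j
  define P where "P = fst -` {p\<in>space N. good p} \<inter> space (N \<Otimes>\<^sub>M N)"
  define Q where "Q j = fst -` {p\<in>space N. T j (fst p) \<noteq> fst p} \<inter> space (N \<Otimes>\<^sub>M N)" for j
  have G: "G j \<in> sets (N \<Otimes>\<^sub>M N)" for j
  proof -
    have "{r\<in>space (N \<Otimes>\<^sub>M N). fst (snd r) = T j (fst (fst r))} \<in> sets (N \<Otimes>\<^sub>M N)"
      by (rule separating_base_eq_measurable[OF separating]) measurable
    moreover have "{r\<in>space (N \<Otimes>\<^sub>M N). snd (snd r) n = snd (fst r) m} \<in> sets (N \<Otimes>\<^sub>M N)" for n m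
      by (rule nat_eq_measurable) measurable
    ultimately show ?thesis unfolding G_def by (intro sets.Int sets.countable_INT) auto
  qed
  have goodm: "P \<in> sets (N \<Otimes>\<^sub>M N)"
    and movm: "Q j \<in> sets (N \<Otimes>\<^sub>M N)" for j
    unfolding P_def Q_def by (rule measurable_sets[OF measurable_fst]; measurable)+
  have eq: "lifted_edges = (\<Union>j. G j \<inter> P \<inter> Q j)"
  proof (intro set_eqI)
    fix r :: "('a \<times> (nat \<Rightarrow> nat)) \<times> ('a \<times> (nat \<Rightarrow> nat))"
    obtain p q where r: "r = (p, q)" by (cases r)
    have leq: "q = lift j p \<longleftrightarrow> fst q = T j (fst p) \<and> (\<forall>n. snd q n = snd p (edge_code (j # code_word n) (code_edge n)))" for j
      by (auto simp: lift_def prod_eq_iff shift_def)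
    have "r \<in> G j \<inter> P \<inter> Q j \<longleftrightarrow> p \<in> space N \<and> q \<in> space N \<and> q = lift j p \<and> good p \<and> T j (fst p) \<noteq> fst p" for j
      unfolding leq unfolding G_def P_def Q_def r by (auto simp: space_pair_measure)
    moreover have "p \<in> space N \<and> q \<in> space N" if "q = lift j p" "good p" for j
      using lift_in_space[of p j] that by (simp add: good_space space_N mem_Times_iff)
    ultimately show "r \<in> lifted_edges \<longleftrightarrow> r \<in> (\<Union>j. G j \<inter> P \<inter> Q j)"
      unfolding UN_iff r lifted_edges_def by auto
  qed
  show ?thesis unfolding eq
    by (intro sets.countable_UN image_subsetI sets.Int[OF sets.Int[OF G goodm] movm])
qed

text \<open>The degree is a sum over the matchings of indicators of the sets \<open>S j A B\<close>.
  Each \<open>lift j\<close> preserves \<open>N\<close>, and it exchanges \<open>S j A B\<close>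
  with \<open>S j B A\<close> because it is an involution at good points, hence almost
  everywhere.\<close>

lemma preserving_lifted_edges:
  assumes A: "A \<in> sets N" and B: "B \<in> sets N"
  shows "(\<integral>\<^sup>+p\<in>A. of_nat (deg lifted_edges p B) \<partial>N) = (\<integral>\<^sup>+p\<in>B. of_nat (deg lifted_edges p A) \<partial>N)"
proof -
  define S where "S j A B = A \<inter> {p\<in>space N. good p} \<inter> {p\<in>space N. T j (fst p) \<noteq> fst p} \<inter> (lift j -` B \<inter> space N)" for j A B
  have S_meas: "S j A B \<in> sets N" if "A \<in> sets N" "B \<in> sets N" for j A B
    unfolding S_def using that measurable_sets[OF lift_measurable_N that(2)] by auto
  have swap: "emeasure N (S j A B) = emeasure N (S j B A)" for j
  proof -
    have "emeasure N (S j A B) = emeasure (distr N N (lift j)) (S j A B)" by (simp only: lift_preserving)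
    also have "\<dots> = emeasure N (lift j -` S j A B \<inter> space N)"
      by (rule emeasure_distr[OF lift_measurable_N S_meas[OF A B]])
    also have "\<dots> = emeasure N (S j B A)"
    proof (rule emeasure_eq_AE)
      show "AE p in N. p \<in> lift j -` S j A B \<inter> space N \<longleftrightarrow> p \<in> S j B A"
        using AE_good AE_space
      proof eventually_elim
        case (elim p)
        then show ?case
          using lift_lift[OF elim(1), of j] good_lift[OF elim(1), of j] lift_in_space[OF elim(2), of j]
          by (auto simp: S_def T_involution)
      qed
      show "lift j -` S j A B \<inter> space N \<in> sets N"
        by (rule measurable_sets[OF lift_measurable_N S_meas[OF A B]])
    qed (rule S_meas[OF B A])
    finally show ?thesis .
  qed
  have sum: "(\<integral>\<^sup>+p\<in>A. of_nat (deg lifted_edges p B) \<partial>N) = (\<Sum>j. emeasure N (S j A B))"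
    if A: "A \<in> sets N" and B: "B \<in> sets N" for A B
  proof -
    have "(\<integral>\<^sup>+p\<in>A. of_nat (deg lifted_edges p B) \<partial>N) = (\<integral>\<^sup>+p. (\<Sum>j. indicator (S j A B) p) \<partial>N)"
    proof (rule nn_integral_cong)
      fix p assume p: "p \<in> space N"
      show "of_nat (deg lifted_edges p B) * indicator A p = (\<Sum>j. indicator (S j A B) p :: ennreal)"
      proof (cases "good p \<and> p \<in> A")
        case True
        define J where "J = {j. T j (fst p) \<noteq> fst p \<and> lift j p \<in> B}"
        have "finite J" unfolding J_def using finite_moved[of p] True by (auto intro: finite_subset[rotated])
        have "indicator (S j A B) p = (if j \<in> J then 1 else 0 :: ennreal)" for j
          using p True by (auto simp: S_def J_def indicator_def)
        then have "(\<Sum>j. indicator (S j A B) p :: ennreal) = (\<Sum>j\<in>J. 1)"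
          using suminf_finite[OF \<open>finite J\<close>, of "\<lambda>j. indicator (S j A B) p :: ennreal"] by simp
        also have "\<dots> = of_nat (deg lifted_edges p B)" using True by (simp add: deg_lifted_edges J_def)
        finally show ?thesis using True by simp
      next
        case False
        then have "indicator (S j A B) p = (0 :: ennreal)" for j by (auto simp: S_def indicator_def)
        moreover have "deg lifted_edges p B = 0 \<or> p \<notin> A" using False not_good_nbrs[of p] by (auto simp: deg_def)
        ultimately show ?thesis by auto
      qed
    qed
    also have "\<dots> = (\<Sum>j. \<integral>\<^sup>+p. indicator (S j A B) p \<partial>N)"
      using S_meas[OF A B] by (intro nn_integral_suminf) auto
    also have "\<dots> = (\<Sum>j. emeasure N (S j A B))" using S_meas[OF A B] by simp
    finally show ?thesis .
  qed
  show ?thesis unfolding sum[OF A B] sum[OF B A] swap ..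
qed

section \<open>The coloring of the lifted edges\<close>

definition edge_color :: "('a \<times> (nat \<Rightarrow> nat)) set \<Rightarrow> nat" where
  "edge_color A = (SOME k. \<exists>p j. A = {p, lift j p} \<and> good p \<and> T j (fst p) \<noteq> fst p \<and> k = snd p (edge_code [] j))"

lemma edge_color_unique:
  assumes p: "good p" "T j (fst p) \<noteq> fst p" and q: "good q" "T i (fst q) \<noteq> fst q"
    and eq: "{p, lift j p} = {q, lift i q}"
  shows "snd p (edge_code [] j) = snd q (edge_code [] i)"
proof -
  consider "p = q" "lift j p = lift i q" | "p = lift i q" "lift j p = q"
    using eq by (auto simp: doubleton_eq_iff)
  then show ?thesis
  proof cases
    case 1
    then have "T j (fst p) = T i (fst p)" by (metis fst_lift)
    then show ?thesis using T_disjoint p(2) 1(1) by blast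
  next
    case 2
    have "T j (fst p) = fst q" using 2(2) by (metis fst_lift)
    moreover have "T i (fst p) = fst q" using 2(1) T_involution by simp
    ultimately have "j = i" using T_disjoint p(2) by metis
    \<comment> \<open>The entry read at the other end is, seen from \<open>q\<close>, that of the
      edge along \<open>i\<close> after walking along \<open>i\<close>. This is the same edge
      traversed backwards, so consistency applies.\<close>
    moreover have "snd p (edge_code [] i) = snd q (edge_code [i] i)" using 2(1) by (simp add: lift_def shift_def)
    moreover have "\<dots> = snd q (edge_code [] i)"
      by (rule good_edge_at[OF q(1)]) (auto simp: edge_at_def T_involution)
    ultimately show ?thesis by simp
  qed
qed

lemma edge_color_eq:
  assumes "good p" "T j (fst p) \<noteq> fst p"
  shows "edge_color {p, lift j p} = snd p (edge_code [] j)"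
  unfolding edge_color_def
proof (rule some_equality)
  show "\<exists>p' j'. {p, lift j p} = {p', lift j' p'} \<and> good p' \<and> T j' (fst p') \<noteq> fst p' \<and> snd p (edge_code [] j) = snd p' (edge_code [] j')"
    using assms by blast
  fix k assume "\<exists>p' j'. {p, lift j p} = {p', lift j' p'} \<and> good p' \<and> T j' (fst p') \<noteq> fst p' \<and> k = snd p' (edge_code [] j')"
  then show "k = snd p (edge_code [] j)" using edge_color_unique assms by metis
qed

lemma proper_edge_coloring_lifted: "proper_edge_coloring lifted_edges d edge_color"
  unfolding proper_edge_coloring_def
proof (intro conjI ballI allI impI)
  fix r assume "r \<in> lifted_edges"
  then obtain p j where r: "r = (p, lift j p)" "good p" "T j (fst p) \<noteq> fst p" by (cases r) (auto elim: lifted_edgesE)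
  have "snd p (edge_code [] j) < d" by (rule good_edge[OF r(2)]) (simp add: is_edge_def r(3))
  then show "case r of (x, y) \<Rightarrow> edge_color {x, y} < d" using r edge_color_eq by simp
next
  fix p q q' assume e: "(p, q) \<in> lifted_edges" "(p, q') \<in> lifted_edges" and ne: "q \<noteq> q'"
  obtain j where j: "good p" "q = lift j p" "T j (fst p) \<noteq> fst p" using e(1) by (rule lifted_edgesE)
  obtain i where i: "q' = lift i p" "T i (fst p) \<noteq> fst p" using e(2) by (rule lifted_edgesE)
  have "i \<noteq> j" using i j ne by blast
  then have "adjacent_edges (fst p) (edge_code [] j) (edge_code [] i)"
    using i j by (simp add: adjacent_edges_def is_edge_def)
  then have "snd p (edge_code [] j) \<noteq> snd p (edge_code [] i)" by (rule good_adjacent[OF j(1)])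
  then show "edge_color {p, q} \<noteq> edge_color {p, q'}" using i j edge_color_eq by simp
qed

lemma measurable_edge_coloring_lifted: "measurable_edge_coloring N lifted_edges edge_color"
  unfolding measurable_edge_coloring_def
proof (intro bexI AE_I2 allI impI)
  \<comment> \<open>The matching of an edge is recovered from the vertices of its two ends; on edges
    the least index is the only one by \<open>T_disjoint\<close>.\<close>
  let ?f = "\<lambda>r. snd (fst r) (edge_code [] (LEAST j. T j (fst (fst r)) = fst (snd r)))"
  have [measurable]: "{r\<in>space (N \<Otimes>\<^sub>M N). T j (fst (fst r)) = fst (snd r)} \<in> sets (N \<Otimes>\<^sub>M N)" for j
    by (rule separating_base_eq_measurable[OF separating]) measurable
  have least: "(\<lambda>r. LEAST j. T j (fst (fst r)) = fst (snd r)) \<in> N \<Otimes>\<^sub>M N \<rightarrow>\<^sub>M count_space UNIV"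
    by measurable
  show "?f \<in> N \<Otimes>\<^sub>M N \<rightarrow>\<^sub>M count_space UNIV"
    by (rule measurable_compose_countable[OF _ least]) measurable
  fix p q assume "(p, q) \<in> lifted_edges"
  then obtain j where j: "good p" "q = lift j p" "T j (fst p) \<noteq> fst p" by (rule lifted_edgesE)
  have "(LEAST i. T i (fst p) = T j (fst p)) = j"
  proof (rule Least_equality)
    fix i assume "T i (fst p) = T j (fst p)"
    then have "i = j" using T_disjoint[of i "fst p" j] j(3) by simp
    then show "j \<le> i" by simp
  qed simp
  then show "edge_color {p, q} = ?f (p, q)" using j edge_color_eq by simp
qed

section \<open>The projection onto the original graphing\<close>

lemma emeasure_times_UNIV:
  assumes "A \<in> sets M" shows "A \<times> UNIV \<in> sets N" "emeasure N (A \<times> UNIV) = emeasure M A"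
proof -
  have eq: "fst -` A \<inter> space N = A \<times> UNIV" using sets.sets_into_space[OF assms] by (auto simp: space_N)
  show "A \<times> UNIV \<in> sets N" using measurable_sets[OF fst_measurable_N assms] unfolding eq .
  have "emeasure (distr N M fst) A = emeasure N (A \<times> UNIV)"
    unfolding emeasure_distr[OF fst_measurable_N assms] eq ..
  then show "emeasure N (A \<times> UNIV) = emeasure M A" unfolding marginal by simp
qed

lemma null_sets_times_UNIV: "K \<in> null_sets M \<Longrightarrow> K \<times> UNIV \<in> null_sets N"
  by (intro null_setsI) (simp_all add: emeasure_times_UNIV null_setsD2 null_setsD1)

lemma completion_times_UNIV:
  assumes "A \<in> sets (completion M)" shows "A \<times> UNIV \<in> sets (completion N)"
proof -
  obtain A' K where A: "A' \<in> sets M" "K \<in> null_sets M" "A' \<subseteq> A" "A \<subseteq> A' \<union> K"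
    by (rule completion_borel_approx[OF assms]) (rule that)
  show ?thesis
  proof (rule sets_completionI)
    show "A \<times> UNIV = (A' \<times> UNIV) \<union> ((A - A') \<times> UNIV)" using A(3) by blast
    show "(A - A') \<times> UNIV \<subseteq> K \<times> UNIV" using A(4) by blast
  qed (use A emeasure_times_UNIV null_sets_times_UNIV in auto)
qed

lemma graphing_lifted:
  assumes "standard_borel M" shows "graphing N lifted_edges"
proof (intro graphing.intro graphing_axioms.intro N.prob_space_axioms)
  show "standard_borel N" by (rule standard_borel_product[OF assms sets_N])
  show "\<exists>D. \<forall>p\<in>space N. finite (lifted_edges `` {p}) \<and> deg lifted_edges p (space N) \<le> D"
    using bounded_degree_lifted_edges by blast
qed (use lifted_edges_measurable sym_lifted_edges irrefl_lifted_edges preserving_lifted_edges in blast)+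

text \<open>Edges lift from good points, which gives surjectivity. Points of a lifted component are
  ends of lifted walks, so \<open>fold_lift_eq\<close> gives injectivity. Injectivity also
  identifies the lift of an edge with the prescribed endpoint, so edges are reflected.\<close>

lemma rooted_isomorphism_fst:
  assumes p: "good p" "fst p \<in> C" and fixed: "\<And>x j. x \<notin> C \<Longrightarrow> T j x = x"
    and adj: "\<And>x y. x \<in> C \<Longrightarrow> (x, y) \<in> E \<longleftrightarrow> (\<exists>j. y = T j x \<and> y \<noteq> x)"
  shows "rooted_isomorphism fst (graph_component lifted_edges p) lifted_edges p (graph_component E (fst p)) E (fst p)"
proof -
  \<comment> \<open>A point moved out of \<open>C\<close> would be fixed there, and the involution
    could not return it.\<close>
  have stay: "T j x \<in> C" if "x \<in> C" for j x
    using fixed[of "T j x" j] T_involution[of j x] that by metis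
  have edge: "(fst q, fst r) \<in> E" if "(q, r) \<in> lifted_edges" "fst q \<in> C" for q r
    using that by (auto elim!: lifted_edgesE simp: adj)
  have comp: "good q \<and> fst q \<in> C \<and> (fst p, fst q) \<in> E\<^sup>* \<and> (\<exists>w. q = fold lift w p)"
    if "(p, q) \<in> lifted_edges\<^sup>*" for q
    using that
  proof induction
    case base
    then show ?case using p by (auto intro: exI[of _ "[]"])
  next
    case (step q r)
    obtain j where j: "r = lift j q" using step.hyps(2) by (rule lifted_edgesE)
    obtain w where w: "q = fold lift w p" using step.IH by blast
    have "r = fold lift (w @ [j]) p" using j w by simp
    moreover have "good r" "fst r \<in> C" using step.IH j good_lift stay by auto
    moreover have "(fst p, fst r) \<in> E\<^sup>*" using step.IH edge[OF step.hyps(2)] by (meson rtrancl.rtrancl_into_rtrancl)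
    ultimately show ?case by blast
  qed
  have inj: "q = r" if q: "(p, q) \<in> lifted_edges\<^sup>*" and r: "(p, r) \<in> lifted_edges\<^sup>*" and eq: "fst q = fst r" for q r
  proof -
    obtain w where w: "q = fold lift w p" using comp[OF q] by blast
    obtain w' where w': "r = fold lift w' p" using comp[OF r] by blast
    have "fold T w (fst p) = fold T w' (fst p)" using eq unfolding w w' fold_lift by simp
    then show ?thesis unfolding w w' by (rule fold_lift_eq[OF p(1)])
  qed
  have lift_edge: "\<exists>r. (q, r) \<in> lifted_edges \<and> fst r = y" if "good q" "fst q \<in> C" "(fst q, y) \<in> E" for q y
  proof -
    from adj[OF that(2), THEN iffD1, OF that(3)] obtain j where j: "y = T j (fst q)" "y \<noteq> fst q" by blast
    then have "(q, lift j q) \<in> lifted_edges" by (intro lifted_edgesI that(1)) simp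
    then show ?thesis using j(1) by (intro exI[of _ "lift j q"]) simp
  qed
  have surj: "\<exists>q. (p, q) \<in> lifted_edges\<^sup>* \<and> fst q = y" if "(fst p, y) \<in> E\<^sup>*" for y
    using that
  proof induction
    case base
    then show ?case by blast
  next
    case (step y z)
    then obtain q where q: "(p, q) \<in> lifted_edges\<^sup>*" "fst q = y" by blast
    then obtain r where r: "(q, r) \<in> lifted_edges" "fst r = z" using comp[OF q(1)] lift_edge[of q z] step.hyps(2) by blast
    then show ?case using rtrancl.rtrancl_into_rtrancl[OF q(1) r(1)] by blast
  qed
  show ?thesis
    unfolding rooted_isomorphism_def graph_component_def
  proof (intro conjI ballI)
    show "bij_betw fst (lifted_edges\<^sup>* `` {p}) (E\<^sup>* `` {fst p})"
      unfolding bij_betw_def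
    proof
      show "inj_on fst (lifted_edges\<^sup>* `` {p})" using inj by (auto intro: inj_onI)
      show "fst ` (lifted_edges\<^sup>* `` {p}) = E\<^sup>* `` {fst p}"
      proof
        show "fst ` (lifted_edges\<^sup>* `` {p}) \<subseteq> E\<^sup>* `` {fst p}" using comp by auto
        show "E\<^sup>* `` {fst p} \<subseteq> fst ` (lifted_edges\<^sup>* `` {p})" using surj by force
      qed
    qed
    fix q r assume "q \<in> lifted_edges\<^sup>* `` {p}" "r \<in> lifted_edges\<^sup>* `` {p}"
    then have q: "(p, q) \<in> lifted_edges\<^sup>*" and r: "(p, r) \<in> lifted_edges\<^sup>*" by auto
    show "(q, r) \<in> lifted_edges \<longleftrightarrow> (fst q, fst r) \<in> E"
    proof
      assume "(q, r) \<in> lifted_edges"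
      then show "(fst q, fst r) \<in> E" using edge comp[OF q] by blast
    next
      assume "(fst q, fst r) \<in> E"
      then obtain r' where r': "(q, r') \<in> lifted_edges" "fst r' = fst r" using lift_edge comp[OF q] by blast
      then have "(p, r') \<in> lifted_edges\<^sup>*" using q by (meson rtrancl.rtrancl_into_rtrancl)
      then have "r' = r" using inj r r'(2) by blast
      then show "(q, r) \<in> lifted_edges" using r'(1) by simp
    qed
  qed simp
qed

end

lemma (in graphing) deg_le_max_degree:
  assumes "x \<in> space M" shows "deg E x (space M) \<le> max_degree M E"
proof -
  obtain D where "\<forall>x\<in>space M. deg E x (space M) \<le> D" using bounded_degree by blast
  then have "(\<lambda>x. deg E x (space M)) ` space M \<subseteq> {..D}" by (intro image_subsetI) simp
  then have "finite ((\<lambda>x. deg E x (space M)) ` space M)" by (rule finite_subset) simp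
  then show ?thesis unfolding max_degree_def by (rule Max_ge[OF _ imageI[OF assms]])
qed

(* Every standard Borel space is Borel isomorphic to a Borel subset of the Baire space, so
   letting the covering graphing live on a subset of 'a \<times> (nat \<Rightarrow> nat) is no restriction. *)
theorem corollary5:
  fixes M :: "'a measure" and E :: "('a \<times> 'a) set" and X\<^sub>1 X\<^sub>2 :: "'a set" and d :: nat
  assumes "bipartite_graphing X\<^sub>1 X\<^sub>2 M E"
    and "max_degree M E = d"
  shows "\<exists>(N :: ('a \<times> (nat \<Rightarrow> nat)) measure) F Y\<^sub>1 Y\<^sub>2 c.
           bipartite_graphing Y\<^sub>1 Y\<^sub>2 N F \<and>
           local_isomorphic_image M E N F \<and>
           proper_edge_coloring F d c \<and>
           measurable_edge_coloring N F c"
proof -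
  interpret G: bipartite_graphing X\<^sub>1 X\<^sub>2 M E by fact
  have "\<exists>T X Z. involution_system M T X d \<and> Z \<in> null_sets M \<and>
    (\<forall>x. x \<notin> space M - Z \<longrightarrow> (\<forall>j. T j x = x)) \<and>
    (\<forall>x\<in>space M - Z. \<forall>y. (x, y) \<in> E \<longleftrightarrow> (\<exists>j. y = T j x \<and> y \<noteq> x))"
    using G.deg_le_max_degree assms(2) by (intro G.involution_system_exists) simp
  then obtain T X Z where T: "involution_system M T X d" and Z: "Z \<in> null_sets M"
    and *: "\<forall>x. x \<notin> space M - Z \<longrightarrow> (\<forall>j. T j x = x)"
    "\<forall>x\<in>space M - Z. \<forall>y. (x, y) \<in> E \<longleftrightarrow> (\<exists>j. y = T j x \<and> y \<noteq> x)" by (elim exE conjE)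
  have fixed: "T j x = x" if "x \<notin> space M - Z" for x j using *(1) that by blast
  have adj: "(x, y) \<in> E \<longleftrightarrow> (\<exists>j. y = T j x \<and> y \<noteq> x)" if "x \<in> space M - Z" for x y
    using *(2) that by blast
  obtain U where U: "separating_base M U"
    by (rule separating_base_exists[OF G.standard_borel]) (rule that)
  interpret T: involution_system M T X d by fact
  obtain N where N: "prob_space N" "sets N = sets (labeled M)" "distr N M fst = M"
    "\<And>j. distr N N (T.lift j) = N" "AE p in N. T.good p"
    using T.invariant_joining[OF U] by blast
  interpret L: lifted_system M T X d N U
    by (intro lifted_system.intro lifted_system_axioms.intro T N U)
  have "bipartite_graphing (X\<^sub>1 \<times> UNIV) (X\<^sub>2 \<times> UNIV) N L.lifted_edges"
  proof (intro bipartite_graphing.intro bipartite_graphing_axioms.intro L.graphing_lifted G.standard_borel)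
    show "X\<^sub>1 \<times> UNIV \<in> sets (completion N)" "X\<^sub>2 \<times> UNIV \<in> sets (completion N)"
      using G.parts_measurable by (auto intro: L.completion_times_UNIV)
    show "X\<^sub>1 \<times> UNIV \<union> X\<^sub>2 \<times> UNIV = space N" using G.parts_cover by (auto simp: L.space_N)
    show "X\<^sub>1 \<times> UNIV \<inter> X\<^sub>2 \<times> UNIV = {}" using G.parts_disjoint by auto
    show "L.lifted_edges \<subseteq> (X\<^sub>1 \<times> UNIV) \<times> (X\<^sub>2 \<times> UNIV) \<union> (X\<^sub>2 \<times> UNIV) \<times> (X\<^sub>1 \<times> UNIV)"
    proof
      fix r assume "r \<in> L.lifted_edges"
      then obtain p j where r: "r = (p, T.lift j p)" "T j (fst p) \<noteq> fst p"
        by (cases r) (auto elim: L.lifted_edgesE)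
      \<comment> \<open>The involutions move only points of the space outside \<open>Z\<close>, and
        there they describe \<open>E\<close> exactly.\<close>
      then have "(fst p, T j (fst p)) \<in> E" using fixed adj by metis
      then show "r \<in> (X\<^sub>1 \<times> UNIV) \<times> (X\<^sub>2 \<times> UNIV) \<union> (X\<^sub>2 \<times> UNIV) \<times> (X\<^sub>1 \<times> UNIV)"
        using G.edges_between r(1) by (auto simp: mem_Times_iff)
    qed
  qed
  moreover have "local_isomorphic_image M E N L.lifted_edges"
    unfolding local_isomorphic_image_def
  proof (intro exI[of _ fst] conjI)
    show "fst \<in> completion N \<rightarrow>\<^sub>M M" by (rule measurable_completion[OF L.fst_measurable_N])
    show "distr (completion N) M fst = M" unfolding distr_completion[OF L.fst_measurable_N] by (rule N(3))
    show "AE p in N. rooted_isomorphism fst (graph_component L.lifted_edges p) L.lifted_edges p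
        (graph_component E (fst p)) E (fst p)"
      using N(5) AE_not_in[OF L.null_sets_times_UNIV[OF Z]]
    proof eventually_elim
      case (elim p)
      have "fst p \<in> space M - Z" using elim(2) L.good_space[OF elim(1)] by (simp add: mem_Times_iff)
      then show ?case by (rule L.rooted_isomorphism_fst[OF elim(1) _ fixed adj])
    qed
  qed
  ultimately show ?thesis
    using L.proper_edge_coloring_lifted L.measurable_edge_coloring_lifted by blast
qed

end
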